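(* Let $n\ge 1$ be an integer, $-\infty<a<b<\infty$, and let $A$ be the minimal operator generated in $L^2(a,b)$ by $\mathcal{A}=(-1)^n\frac{d^{2n}}{dx^{2n}}$, with adjoint $A^*$ (the maximal operator). Let $\{\mathbb{C}^{2n},\Gamma_0,\Gamma_1\}$ be the boundary triplet for $A^*$ given, for $f\in\operatorname{dom}A^*=W^{2n,2}(a,b)$, by $$\Gamma_0 f=\big(f(a),\dots,f^{(n-1)}(a),f(b),\dots,f^{(n-1)}(b)\big)^{\top},$$ $$\Gamma_1 f=\big((-1)^{n-1}f^{(2n-1)}(a),\dots,f^{(n)}(a),(-1)^{n}f^{(2n-1)}(b),\dots,-f^{(n)}(b)\big)^{\top},$$ that is, for $k=1,\dots,n$, the $k$-th entry of $\Gamma_1 f$ is $(-1)^{n-k}f^{(2n-k)}(a)$ and the $(n+k)$-th entry is $(-1)^{n-k+1}f^{(2n-k)}(b)$. Let $\widehat{A}_K$ be the Krein extension of $A$. Then the following hold. (i) The domain of $\widehat{A}_K$ is $$\operatorname{dom}\widehat{A}_K=\left\{f\in W^{2n,2}(a,b):\ \begin{pmatrix} f^{(2n-1)}(b)\\ \vdots\\ f(b)\end{pmatrix}=T\begin{pmatrix} f^{(2n-1)}(a)\\ \vdots\\ f(a)\end{pmatrix}\right\},$$ where $T$ is the lower-triangular Toeplitz $2n\times 2n$ matrix with entries $T_{jk}=\frac{(b-a)^{j-k}}{(j-k)!}$ for $j\ge k$ and $T_{jk}=0$ for $j<k$. (ii) $\widehat{A}_K$ is given by $$\operatorname{dom}\widehat{A}_K=\left\{f\in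 W^{2n,2}(a,b):\ \Gamma_1 f=B_K\Gamma_0 f\right\},$$ where $$B_K=\begin{pmatrix} QT_2^{-1}T_1S & -QT_2^{-1}S\\ -QT_1T_2^{-1}T_1S & QT_1T_2^{-1}S\end{pmatrix}$$ and $T_1,T_2,Q,S$ are the $n\times n$ matrices with entries, for $j,k\in\{1,\dots,n\}$: $(T_1)_{jk}=\frac{(b-a)^{j-k}}{(j-k)!}$ if $j\ge k$ and $0$ otherwise; $(T_2)_{jk}=\frac{(b-a)^{n+j-k}}{(n+j-k)!}$; $Q=\operatorname{diag}\big((-1)^n,(-1)^{n-1},\dots,-1\big)$; and $S_{jk}=1$ if $j+k=n+1$, $S_{jk}=0$ otherwise.
   Context: The minimal operator $A=A_{\min}$ generated by $\mathcal{A}=(-1)^n\frac{d^{2n}}{dx^{2n}}$ in $L^2(a,b)$ is the closure of $f\mapsto(-1)^nf^{(2n)}$ defined on $C_0^\infty(a,b)$. Its adjoint is the maximal operator $A^*=A_{\max}$, $A^*f=(-1)^nf^{(2n)}$ with domain the Sobolev space $W^{2n,2}(a,b)$. The operator $A$ is closed, densely defined, symmetric and non-negative. For a non-negative densely defined symmetric operator $A$, let $\operatorname{Ext}_A(0,\infty)$ be the set of all its non-negative self-adjoint extensions. There are two extreme elements $\widehat{A}_F$ (Friedrichs extension) and $\widehat{A}_K$ (Krein extension) of this set, uniquely determined by $$(\widehat{A}_F+x)^{-1}\le(\widetilde{A}+x)^{-1}\le(\widehat{A}_K+x)^{-1},\qquad x\in(0,\infty),\ \widetilde{A}\in\operatorname{Ext}_A(0,\infty).$$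 As an extension of $A$, $\widehat{A}_K$ is a restriction of $A^*$, so it is determined by its domain. A boundary triplet for $A^*$ is a triple $\{\mathcal{H},\Gamma_0,\Gamma_1\}$ with $\mathcal{H}$ a Hilbert space and $\Gamma_0,\Gamma_1:\operatorname{dom}A^*\to\mathcal{H}$ linear maps such that $(A^*f,g)-(f,A^*g)=(\Gamma_1f,\Gamma_0g)_{\mathcal{H}}-(\Gamma_0f,\Gamma_1g)_{\mathcal{H}}$ for all $f,g\in\operatorname{dom}A^*$ and $f\mapsto(\Gamma_0f,\Gamma_1f)$ is onto $\mathcal{H}\oplus\mathcal{H}$. *)

theory Defs
  imports
    "HOL-Analysis.Analysis"
    "Jordan_Normal_Form.Gauss_Jordan_Elimination"
    "Jordan_Normal_Form.Conjugate"
begin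

section \<open>Unbounded operators in a complex L2 space\<close>

text \<open>
  Elements of \<open>L\<^sup>2(M)\<close> are represented by square-integrable functions, and an operator by its
  graph, a set of pairs of such functions. Equality in \<open>L\<^sup>2(M)\<close> is equality almost everywhere.
  The closure and the adjoint defined below contain, with a pair, all pairs that are
  a.e. equal to it; so inclusion and equality of closed or self-adjoint graphs are inclusion
  and equality of the operators on the quotient space, and \<^const>\<open>Domain\<close> is the set of all
  representatives of elements of the operator domain.
\<close>

type_synonym 'a graph = "(('a \<Rightarrow> complex) \<times> ('a \<Rightarrow> complex)) set"

definition l2 :: "'a measure \<Rightarrow> ('a \<Rightarrow> complex) set" where
  "l2 M = {f \<in> borel_measurable M. integrable M (\<lambda>x. (cmod (f x))\<^sup>2)}"

definition l2_inner :: "'a measure \<Rightarrow> ('a \<Rightarrow> complex) \<Rightarrow> ('a \<Rightarrow> complex) \<Rightarrow> complex" where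
  "l2_inner M f g = (LINT x|M. f x * cnj (g x))"

definition l2_dist :: "'a measure \<Rightarrow> ('a \<Rightarrow> complex) \<Rightarrow> ('a \<Rightarrow> complex) \<Rightarrow> real" where
  "l2_dist M f g = sqrt (LINT x|M. (cmod (f x - g x))\<^sup>2)"

definition graph_closure :: "'a measure \<Rightarrow> 'a graph \<Rightarrow> 'a graph" where
  "graph_closure M G = {(f, u). f \<in> l2 M \<and> u \<in> l2 M \<and>
     (\<forall>e>0. \<exists>(g, v)\<in>G. l2_dist M f g < e \<and> l2_dist M u v < e)}"

definition op_adjoint :: "'a measure \<Rightarrow> 'a graph \<Rightarrow> 'a graph" where
  "op_adjoint M G = {(g, v). g \<in> l2 M \<and> v \<in> l2 M \<and>
     (\<forall>(f, u)\<in>G. l2_inner M u g = l2_inner M f v)}"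

definition densely_defined :: "'a measure \<Rightarrow> 'a graph \<Rightarrow> bool" where
  "densely_defined M G \<longleftrightarrow> (\<forall>h\<in>l2 M. \<forall>e>0. \<exists>f\<in>Domain G. l2_dist M h f < e)"

text \<open>
  The adjoint of a densely defined graph is linear and single-valued up to a.e. equality, so a
  self-adjoint graph is automatically the graph of a linear operator.
\<close>

definition selfadjoint :: "'a measure \<Rightarrow> 'a graph \<Rightarrow> bool" where
  "selfadjoint M G \<longleftrightarrow> densely_defined M G \<and> op_adjoint M G = G"

definition nonneg :: "'a measure \<Rightarrow> 'a graph \<Rightarrow> bool" where
  "nonneg M G \<longleftrightarrow> (\<forall>(f, u)\<in>G. l2_inner M u f \<in> \<real>\<^sub>\<ge>\<^sub>0)"

definition Ext :: "'a measure \<Rightarrow> 'a graph \<Rightarrow> 'a graph set" where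
  "Ext M A = {B. A \<subseteq> B \<and> selfadjoint M B \<and> nonneg M B}"

text \<open>The graph of \<open>(B + x)\<^sup>-\<^sup>1\<close>.\<close>

definition resolvent :: "'a graph \<Rightarrow> real \<Rightarrow> 'a graph" where
  "resolvent B x = {(\<lambda>t. u t + of_real x * f t, f) | f u. (f, u) \<in> B}"

text \<open>
  The order of bounded self-adjoint operators via quadratic forms. It is applied only to
  \<open>(B + x)\<^sup>-\<^sup>1\<close> with \<open>B\<close> non-negative self-adjoint and \<open>x > 0\<close>, which is defined on all of
  \<open>L\<^sup>2(M)\<close> and has a real quadratic form.
\<close>

definition op_le :: "'a measure \<Rightarrow> 'a graph \<Rightarrow> 'a graph \<Rightarrow> bool" where
  "op_le M R S \<longleftrightarrow> (\<forall>h\<in>l2 M. \<forall>f g. (h, f) \<in> R \<longrightarrow> (h, g) \<in> S \<longrightarrow>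
     Re (l2_inner M f h) \<le> Re (l2_inner M g h))"

definition is_krein_extension :: "'a measure \<Rightarrow> 'a graph \<Rightarrow> 'a graph \<Rightarrow> bool" where
  "is_krein_extension M A K \<longleftrightarrow> K \<in> Ext M A \<and>
     (\<forall>B\<in>Ext M A. \<forall>x>0. op_le M (resolvent B x) (resolvent K x))"

definition krein_extension :: "'a measure \<Rightarrow> 'a graph \<Rightarrow> 'a graph" where
  "krein_extension M A = (THE K. is_krein_extension M A K)"

text \<open>
  Boundary triplets \<open>{\<complex>\<^sup>d, \<Gamma>\<^sub>0, \<Gamma>\<^sub>1}\<close> for the operator with graph \<open>G\<close> (the adjoint of the
  symmetric operator under consideration). The first clause says that the
  maps are well defined on \<open>L\<^sup>2(M)\<close> classes.
\<close>

definition boundary_triplet ::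
  "'a measure \<Rightarrow> 'a graph \<Rightarrow> nat \<Rightarrow> (('a \<Rightarrow> complex) \<Rightarrow> complex Matrix.vec) \<Rightarrow>
    (('a \<Rightarrow> complex) \<Rightarrow> complex Matrix.vec) \<Rightarrow> bool" where
  "boundary_triplet M G d \<Gamma>\<^sub>0 \<Gamma>\<^sub>1 \<longleftrightarrow>
     (\<forall>\<Gamma>\<in>{\<Gamma>\<^sub>0, \<Gamma>\<^sub>1}.
        (\<forall>f\<in>Domain G. \<forall>g\<in>Domain G. (AE t in M. f t = g t) \<longrightarrow> \<Gamma> f = \<Gamma> g) \<and>
        (\<forall>f\<in>Domain G. \<Gamma> f \<in> carrier_vec d) \<and>
        (\<forall>f\<in>Domain G. \<forall>g\<in>Domain G. \<Gamma> (\<lambda>t. f t + g t) = \<Gamma> f + \<Gamma> g) \<and>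
        (\<forall>f\<in>Domain G. \<forall>c. \<Gamma> (\<lambda>t. c * f t) = c \<cdot>\<^sub>v \<Gamma> f)) \<and>
     (\<forall>(f, u)\<in>G. \<forall>(g, v)\<in>G.
        l2_inner M u g - l2_inner M f v = \<Gamma>\<^sub>1 f \<bullet>c \<Gamma>\<^sub>0 g - \<Gamma>\<^sub>0 f \<bullet>c \<Gamma>\<^sub>1 g) \<and>
     (\<forall>p\<in>carrier_vec d. \<forall>q\<in>carrier_vec d. \<exists>f\<in>Domain G. \<Gamma>\<^sub>0 f = p \<and> \<Gamma>\<^sub>1 f = q)"


section \<open>Sobolev spaces on a bounded interval\<close>

definition nth_deriv :: "nat \<Rightarrow> (real \<Rightarrow> complex) \<Rightarrow> real \<Rightarrow> complex" where
  "nth_deriv k \<phi> = ((\<lambda>f x. vector_derivative f (at x)) ^^ k) \<phi>"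

text \<open>\<open>C\<^sub>0\<^sup>\<infinity>(a,b)\<close>, each function extended by zero to the real line.\<close>

definition test_functions :: "real \<Rightarrow> real \<Rightarrow> (real \<Rightarrow> complex) set" where
  "test_functions a b = {\<phi>. (\<forall>k x. nth_deriv k \<phi> differentiable (at x)) \<and>
     closure {x. \<phi> x \<noteq> 0} \<subseteq> {a<..<b}}"

definition weak_deriv :: "real \<Rightarrow> real \<Rightarrow> nat \<Rightarrow> (real \<Rightarrow> complex) \<Rightarrow> (real \<Rightarrow> complex) \<Rightarrow> bool" where
  "weak_deriv a b k f g \<longleftrightarrow>
     f \<in> l2 (lebesgue_on {a<..<b}) \<and> g \<in> l2 (lebesgue_on {a<..<b}) \<and>
     (\<forall>\<phi>\<in>test_functions a b.
        (LINT x|lebesgue_on {a<..<b}. f x * nth_deriv k \<phi> x) =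
        (-1) ^ k * (LINT x|lebesgue_on {a<..<b}. g x * \<phi> x))"

text \<open>The space \<open>W\<^sup>m\<^sup>,\<^sup>2(a,b)\<close>.\<close>

definition sobolev :: "nat \<Rightarrow> real \<Rightarrow> real \<Rightarrow> (real \<Rightarrow> complex) set" where
  "sobolev m a b = {f \<in> l2 (lebesgue_on {a<..<b}). \<forall>k\<le>m. \<exists>g. weak_deriv a b k f g}"

text \<open>
  The value \<open>f\<^sup>(\<^sup>k\<^sup>)(c)\<close> for \<open>c \<in> [a,b]\<close>: the value at \<open>c\<close> of the representative of the weak
  derivative that is continuous on \<open>[a,b]\<close>. For \<open>f\<close> in \<open>W\<^sup>m\<^sup>,\<^sup>2(a,b)\<close> and \<open>k < m\<close> it exists and is
  unique.
\<close>

definition deriv_value :: "real \<Rightarrow> real \<Rightarrow> nat \<Rightarrow> (real \<Rightarrow> complex) \<Rightarrow> real \<Rightarrow> complex" where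
  "deriv_value a b k f c =
     (THE y. \<exists>g. continuous_on {a..b} g \<and> weak_deriv a b k f g \<and> g c = y)"


section \<open>The minimal operator, its boundary triplet and the matrices\<close>

definition A_min :: "nat \<Rightarrow> real \<Rightarrow> real \<Rightarrow> real graph" where
  "A_min n a b = graph_closure (lebesgue_on {a<..<b})
     {(\<phi>, \<lambda>x. (-1) ^ n * nth_deriv (2 * n) \<phi> x) | \<phi>. \<phi> \<in> test_functions a b}"

text \<open>
  Vector and matrix indices start at 0, so the entry with index \<open>i\<close> (or \<open>i, j\<close>) is the entry
  numbered \<open>i + 1\<close> (or \<open>i + 1, j + 1\<close>) in the usual count from 1.
\<close>

definition \<Gamma>\<^sub>0 :: "nat \<Rightarrow> real \<Rightarrow> real \<Rightarrow> (real \<Rightarrow> complex) \<Rightarrow> complex Matrix.vec" where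
  "\<Gamma>\<^sub>0 n a b f =
     Matrix.vec n (\<lambda>i. deriv_value a b i f a) @\<^sub>v Matrix.vec n (\<lambda>i. deriv_value a b i f b)"

definition \<Gamma>\<^sub>1 :: "nat \<Rightarrow> real \<Rightarrow> real \<Rightarrow> (real \<Rightarrow> complex) \<Rightarrow> complex Matrix.vec" where
  "\<Gamma>\<^sub>1 n a b f =
     Matrix.vec n (\<lambda>i. (-1) ^ (n - 1 - i) * deriv_value a b (2 * n - 1 - i) f a) @\<^sub>v
     Matrix.vec n (\<lambda>i. (-1) ^ (n - i) * deriv_value a b (2 * n - 1 - i) f b)"

text \<open>\<open>(f\<^sup>(\<^sup>m\<^sup>-\<^sup>1\<^sup>)(c), \<dots>, f(c))\<close>\<close>

definition deriv_vec :: "real \<Rightarrow> real \<Rightarrow> nat \<Rightarrow> (real \<Rightarrow> complex) \<Rightarrow> real \<Rightarrow> complex Matrix.vec" where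
  "deriv_vec a b m f c = Matrix.vec m (\<lambda>i. deriv_value a b (m - 1 - i) f c)"

text \<open>
  The lower-triangular Toeplitz matrix of size \<open>m\<close>: \<open>T\<close> for \<open>m = 2n\<close>, \<open>T\<^sub>1\<close> for \<open>m = n\<close>.
\<close>

definition T_toeplitz :: "nat \<Rightarrow> real \<Rightarrow> real \<Rightarrow> complex Matrix.mat" where
  "T_toeplitz m a b = Matrix.mat m m (\<lambda>(j, k).
     if j \<ge> k then of_real ((b - a) ^ (j - k) / fact (j - k)) else 0)"

definition T\<^sub>2 :: "nat \<Rightarrow> real \<Rightarrow> real \<Rightarrow> complex Matrix.mat" where
  "T\<^sub>2 n a b = Matrix.mat n n (\<lambda>(j, k). of_real ((b - a) ^ (n + j - k) / fact (n + j - k)))"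

definition Q_mat :: "nat \<Rightarrow> complex Matrix.mat" where
  "Q_mat n = Matrix.mat n n (\<lambda>(j, k). if j = k then (-1) ^ (n - j) else 0)"

definition S_mat :: "nat \<Rightarrow> complex Matrix.mat" where
  "S_mat n = Matrix.mat n n (\<lambda>(j, k). if (j + 1) + (k + 1) = n + 1 then 1 else 0)"

text \<open>
  \<^const>\<open>mat_inverse\<close> returns an option; \<open>T\<^sub>2\<close> is invertible when \<open>a < b\<close>.
\<close>

definition B_K :: "nat \<Rightarrow> real \<Rightarrow> real \<Rightarrow> complex Matrix.mat" where
  "B_K n a b =
    (let T1 = T_toeplitz n a b; T2inv = the (mat_inverse (T\<^sub>2 n a b)); Q = Q_mat n; S = S_mat n
     in four_block_mat
          (Q * T2inv * T1 * S)          (- (Q * T2inv * S))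
          (- (Q * T1 * T2inv * T1 * S)) (Q * T1 * T2inv * S))"

end

theory Submission
  imports Defs "HOL-Real_Asymp.Real_Asymp" "Jordan_Normal_Form.Determinant"
begin

text \<open>
  A square-integrable function with a weak derivative of order \<open>m\<close> in \<open>L\<^sup>2\<close> is an \<open>m\<close>-fold indefinite
  integral plus a polynomial of degree less than \<open>m\<close> (\<open>weak_deriv_obtains_chain\<close>). So the adjoint
  of the minimal operator is the maximal one, and an element of its domain may be replaced by a
  chain \<open>F 0, \<dots>, F (2 n)\<close> in which every function is an indefinite integral of the next. The
  boundary values of the chain are, up to sign, the entries of the two boundary maps. Repeated
  integration by parts (\<open>chain_by_parts\<close>) is Green's identity, Hermite interpolation prescribes
  all boundary values at once, and the two facts together are the boundary triplet.

  The kernel of the maximal operator consists of the polynomials of degree less than \<open>2 n\<close>. The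
  graph \<open>A_Krein n\<close> restricts the maximal operator to those \<open>f\<close> whose image is orthogonal to this
  kernel. Green's identity against polynomials turns the orthogonality into a boundary
  condition: \<open>f\<close> and its Taylor polynomial at \<open>a\<close> have the same derivatives at \<open>b\<close> up to order
  \<open>2 n - 1\<close> (\<open>orthogonal_iff_Taylor\<close>). In matrix form this is the condition with the Toeplitz
  matrix \<open>T\<close>, and solving its lower block for the higher derivatives at \<open>a\<close> gives the one with
  \<open>B\<^sub>K\<close>. It also says that \<open>f = \<phi> + p\<close>, where \<open>\<phi>\<close> has zero boundary values and \<open>p\<close> lies in the kernel.
  With this decomposition self-adjointness and non-negativity are short computations.

  The operator \<open>K\<close> with graph \<open>A_Krein n\<close> is extremal for the following reason
  (\<open>resolvent_difference\<close>). Let \<open>B\<close> be a non-negative self-adjoint extension, let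
  \<open>(B + x) f = h = (K + x) g\<close> and \<open>g = \<phi> + p\<close>. The function \<open>\<phi>\<close> lies in the domain of \<open>B\<close>, and expanding
  the inner products gives
  \<open>(g, h) - (f, h) = (B (f - \<phi>), f - \<phi>) + x (f - g, f - g)\<close>,
  which is non-negative. If \<open>B\<close> is a Krein extension too, the left-hand side is also non-positive, so
  \<open>f = g\<close>; hence \<open>B = K\<close>, provided that \<open>(K + x) g = h\<close> can be solved for every \<open>h\<close> and one
  positive \<open>x\<close>. For small \<open>x\<close> this is a fixed point problem for a contraction
  (\<open>K_plus_surjective\<close>).
\<close>

section \<open>Square-integrable functions and adjoint graphs\<close>

lemma l2_measurable: "f \<in> l2 M \<Longrightarrow> f \<in> borel_measurable M"
  by (simp add: l2_def)

lemma l2_square_integrable: "f \<in> l2 M \<Longrightarrow> integrable M (\<lambda>x. (cmod (f x))\<^sup>2)"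
  by (simp add: l2_def)

lemma l2_bound:
  assumes f: "f \<in> borel_measurable M" and g: "integrable M g"
    and le: "\<And>x. x \<in> space M \<Longrightarrow> (cmod (f x))\<^sup>2 \<le> g x"
  shows "f \<in> l2 M"
proof -
  have "integrable M (\<lambda>x. (cmod (f x))\<^sup>2)"
  proof (rule Bochner_Integration.integrable_bound[OF g])
    show "(\<lambda>x. (cmod (f x))\<^sup>2) \<in> borel_measurable M" using f by measurable
    have "\<bar>(cmod (f x))\<^sup>2\<bar> \<le> \<bar>g x\<bar>" if "x \<in> space M" for x
      using le[OF that] zero_le_power2[of "cmod (f x)"] by linarith
    then show "AE x in M. norm ((cmod (f x))\<^sup>2) \<le> norm (g x)"
      by (auto intro!: AE_I2)
  qed
  then show ?thesis using f by (simp add: l2_def)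
qed

lemma l2_zero [simp]: "(\<lambda>x. 0) \<in> l2 M"
  by (simp add: l2_def)

lemma norm_mult_le_squares: "cmod (z * w) \<le> (cmod z)\<^sup>2 + (cmod w)\<^sup>2"
proof -
  have "0 \<le> cmod z * cmod w" by simp
  then show ?thesis
    using sum_squares_bound[of "cmod z" "cmod w"] unfolding norm_mult by linarith
qed

lemma norm_add_square_le: "(cmod (z + w))\<^sup>2 \<le> 2 * (cmod z)\<^sup>2 + 2 * (cmod w)\<^sup>2"
proof -
  have "(cmod (z + w))\<^sup>2 \<le> (cmod z + cmod w)\<^sup>2"
    by (intro power_mono norm_triangle_ineq norm_ge_zero)
  also have "\<dots> \<le> 2 * (cmod z)\<^sup>2 + 2 * (cmod w)\<^sup>2"
    using sum_squares_bound[of "cmod z" "cmod w"] by (simp add: power2_sum)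
  finally show ?thesis .
qed

lemma l2_add:
  assumes "f \<in> l2 M" "g \<in> l2 M"
  shows "(\<lambda>x. f x + g x) \<in> l2 M"
proof (rule l2_bound)
  show "(\<lambda>x. f x + g x) \<in> borel_measurable M"
    using assms[THEN l2_measurable] by measurable
  show "integrable M (\<lambda>x. 2 * (cmod (f x))\<^sup>2 + 2 * (cmod (g x))\<^sup>2)"
    using assms[THEN l2_square_integrable] by simp
qed (rule norm_add_square_le)

lemma l2_cmult:
  assumes "f \<in> l2 M"
  shows "(\<lambda>x. c * f x) \<in> l2 M"
proof (rule l2_bound)
  show "(\<lambda>x. c * f x) \<in> borel_measurable M"
    using assms[THEN l2_measurable] by measurable
  show "integrable M (\<lambda>x. (cmod c)\<^sup>2 * (cmod (f x))\<^sup>2)"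
    using assms[THEN l2_square_integrable] by simp
qed (simp add: norm_mult power_mult_distrib)

lemma l2_diff:
  assumes "f \<in> l2 M" "g \<in> l2 M"
  shows "(\<lambda>x. f x - g x) \<in> l2 M"
  using l2_add[OF assms(1) l2_cmult[OF assms(2), of "-1"]] by simp

lemma l2_cnj:
  assumes "f \<in> l2 M"
  shows "(\<lambda>x. cnj (f x)) \<in> l2 M"
proof (rule l2_bound)
  show "(\<lambda>x. cnj (f x)) \<in> borel_measurable M"
    by (rule measurable_compose[OF l2_measurable[OF assms] borel_measurable_continuous_onI])
       (intro continuous_intros)
  show "integrable M (\<lambda>x. (cmod (f x))\<^sup>2)"
    by (rule l2_square_integrable[OF assms])
qed simp

lemma l2_mult_integrable:
  assumes "f \<in> l2 M" "g \<in> l2 M"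
  shows "integrable M (\<lambda>x. f x * g x)"
proof (rule Bochner_Integration.integrable_bound)
  show "integrable M (\<lambda>x. (cmod (f x))\<^sup>2 + (cmod (g x))\<^sup>2)"
    using assms[THEN l2_square_integrable] by simp
  show "(\<lambda>x. f x * g x) \<in> borel_measurable M"
    using assms[THEN l2_measurable] by measurable
  have "norm (f x * g x) \<le> norm ((cmod (f x))\<^sup>2 + (cmod (g x))\<^sup>2)" for x
    using norm_mult_le_squares[of "f x" "g x"] by simp
  then show "AE x in M. norm (f x * g x) \<le> norm ((cmod (f x))\<^sup>2 + (cmod (g x))\<^sup>2)"
    by simp
qed

lemma l2_inner_integrable:
  "f \<in> l2 M \<Longrightarrow> g \<in> l2 M \<Longrightarrow> integrable M (\<lambda>x. f x * cnj (g x))"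
  by (intro l2_mult_integrable l2_cnj)

lemma l2_inner_commute: "cnj (l2_inner M f g) = l2_inner M g f"
  unfolding l2_inner_def
  by (subst Bochner_Integration.integral_cnj[symmetric]) (simp add: mult.commute)

lemma l2_inner_add_left:
  "\<lbrakk>f \<in> l2 M; g \<in> l2 M; h \<in> l2 M\<rbrakk> \<Longrightarrow>
   l2_inner M (\<lambda>x. f x + g x) h = l2_inner M f h + l2_inner M g h"
  by (simp add: l2_inner_def ring_distribs l2_inner_integrable)

lemma l2_inner_add_right:
  "\<lbrakk>f \<in> l2 M; g \<in> l2 M; h \<in> l2 M\<rbrakk> \<Longrightarrow>
   l2_inner M h (\<lambda>x. f x + g x) = l2_inner M h f + l2_inner M h g"
  by (simp add: l2_inner_def ring_distribs l2_inner_integrable)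

lemma l2_inner_diff_left:
  "\<lbrakk>f \<in> l2 M; g \<in> l2 M; h \<in> l2 M\<rbrakk> \<Longrightarrow>
   l2_inner M (\<lambda>x. f x - g x) h = l2_inner M f h - l2_inner M g h"
  by (simp add: l2_inner_def ring_distribs l2_inner_integrable)

lemma l2_inner_diff_right:
  "\<lbrakk>f \<in> l2 M; g \<in> l2 M; h \<in> l2 M\<rbrakk> \<Longrightarrow>
   l2_inner M h (\<lambda>x. f x - g x) = l2_inner M h f - l2_inner M h g"
  by (simp add: l2_inner_def ring_distribs l2_inner_integrable)

lemma l2_inner_cmult_left: "l2_inner M (\<lambda>x. c * f x) h = c * l2_inner M f h"
  by (simp add: l2_inner_def mult.assoc)

lemma l2_inner_cmult_right: "l2_inner M f (\<lambda>x. c * h x) = cnj c * l2_inner M f h"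
  by (simp add: l2_inner_def mult.left_commute)

lemma l2_inner_zero [simp]: "l2_inner M (\<lambda>x. 0) h = 0" "l2_inner M h (\<lambda>x. 0) = 0"
  by (simp_all add: l2_inner_def)

lemma l2_inner_cong_AE:
  assumes "f \<in> l2 M" "f' \<in> l2 M" "g \<in> l2 M" "g' \<in> l2 M"
    and "AE x in M. f x = f' x" "AE x in M. g x = g' x"
  shows "l2_inner M f g = l2_inner M f' g'"
  unfolding l2_inner_def
proof (rule integral_cong_AE)
  show "(\<lambda>x. f x * cnj (g x)) \<in> borel_measurable M" "(\<lambda>x. f' x * cnj (g' x)) \<in> borel_measurable M"
    by (rule borel_measurable_integrable, rule l2_inner_integrable, fact+)+
  show "AE x in M. f x * cnj (g x) = f' x * cnj (g' x)"
    using assms(5,6) by eventually_elim simp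
qed

lemma l2_inner_self: "l2_inner M f f = of_real (LINT x|M. (cmod (f x))\<^sup>2)"
  unfolding l2_inner_def complex_norm_square[symmetric] of_real_power[symmetric]
  by (rule integral_complex_of_real)

lemma AE_zero_of_l2_inner_self:
  assumes f: "f \<in> l2 M" and le: "Re (l2_inner M f f) \<le> 0"
  shows "AE x in M. f x = 0"
proof -
  have "(LINT x|M. (cmod (f x))\<^sup>2) = 0"
    using le by (intro antisym integral_nonneg_AE) (simp_all add: l2_inner_self)
  then have "AE x in M. (cmod (f x))\<^sup>2 = 0"
    using integral_nonneg_eq_0_iff_AE[OF l2_square_integrable[OF f]] by simp
  then show ?thesis by simp
qed

text \<open>
  A substitute for the Cauchy-Schwarz inequality: the integral of
  \<open>|d g| \<le> |d|\<^sup>2 / e + e |g|\<^sup>2\<close>. It suffices for passing to the limit in an inner product.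
\<close>

lemma l2_inner_le:
  assumes d: "d \<in> l2 M" and g: "g \<in> l2 M" and e: "e > 0"
    and small: "(LINT x|M. (cmod (d x))\<^sup>2) \<le> e\<^sup>2"
  shows "cmod (l2_inner M d g) \<le> e * (1 + (LINT x|M. (cmod (g x))\<^sup>2))"
proof -
  note [simp] = l2_square_integrable[OF d] l2_square_integrable[OF g]
  have pt: "norm (d x * cnj (g x)) \<le> (cmod (d x))\<^sup>2 / e + e * (cmod (g x))\<^sup>2" for x
  proof -
    have "0 \<le> (cmod (d x) - e * cmod (g x))\<^sup>2" by simp
    then have "2 * e * (cmod (d x) * cmod (g x)) \<le> (cmod (d x))\<^sup>2 + e\<^sup>2 * (cmod (g x))\<^sup>2"
      by (simp add: power2_diff power_mult_distrib mult_ac)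
    moreover have "0 \<le> e * (cmod (d x) * cmod (g x))" using e by simp
    ultimately have "e * (cmod (d x) * cmod (g x)) \<le> (cmod (d x))\<^sup>2 + e\<^sup>2 * (cmod (g x))\<^sup>2"
      by linarith
    then show ?thesis using e by (simp add: norm_mult field_simps power2_eq_square)
  qed
  have "cmod (l2_inner M d g) \<le> (LINT x|M. norm (d x * cnj (g x)))"
    unfolding l2_inner_def by (rule integral_norm_bound)
  also have "\<dots> \<le> (LINT x|M. (cmod (d x))\<^sup>2 / e + e * (cmod (g x))\<^sup>2)"
    by (rule integral_mono[OF integrable_norm[OF l2_inner_integrable[OF d g]] _ pt]) simp
  also have "\<dots> = (LINT x|M. (cmod (d x))\<^sup>2) / e + e * (LINT x|M. (cmod (g x))\<^sup>2)"
    by simp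
  also have "\<dots> \<le> e * (1 + (LINT x|M. (cmod (g x))\<^sup>2))"
    using small e by (simp add: field_simps power2_eq_square)
  finally show ?thesis .
qed

lemma l2_dist_less_square:
  assumes "l2_dist M f g < e"
  shows "(LINT x|M. (cmod (f x - g x))\<^sup>2) < e\<^sup>2"
proof -
  have nn: "0 \<le> (LINT x|M. (cmod (f x - g x))\<^sup>2)" by (rule integral_nonneg_AE) simp
  then have "0 \<le> l2_dist M f g" by (simp add: l2_dist_def)
  then have "(l2_dist M f g)\<^sup>2 < e\<^sup>2" using assms by (intro power_strict_mono) auto
  then show ?thesis using nn by (simp add: l2_dist_def)
qed

lemma op_adjoint_l2: "(f, u) \<in> op_adjoint M G \<Longrightarrow> f \<in> l2 M \<and> u \<in> l2 M"
  by (auto simp: op_adjoint_def)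

lemma op_adjoint_subset: "op_adjoint M G \<subseteq> l2 M \<times> l2 M"
  by (auto simp: op_adjoint_def)

lemma op_adjointD:
  "(g, v) \<in> op_adjoint M G \<Longrightarrow> (f, u) \<in> G \<Longrightarrow> l2_inner M u g = l2_inner M f v"
  by (auto simp: op_adjoint_def)

lemma op_adjoint_antimono: "G \<subseteq> H \<Longrightarrow> op_adjoint M H \<subseteq> op_adjoint M G"
  by (auto simp: op_adjoint_def)

text \<open>
  Being formally adjoint to each other is a symmetric relation of two graphs.
\<close>

lemma subset_op_adjoint_swap:
  assumes "G \<subseteq> op_adjoint M H" and H: "H \<subseteq> l2 M \<times> l2 M"
  shows "H \<subseteq> op_adjoint M G"
proof (clarsimp simp: op_adjoint_def)
  fix g v assume gv: "(g, v) \<in> H"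
  have "l2_inner M u g = l2_inner M f v" if "(f, u) \<in> G" for f u
  proof -
    have "l2_inner M v f = l2_inner M g u"
      using assms(1) that gv op_adjointD by blast
    then show ?thesis by (metis l2_inner_commute)
  qed
  then show "g \<in> l2 M \<and> v \<in> l2 M \<and> (\<forall>(f, u)\<in>G. l2_inner M u g = l2_inner M f v)"
    using gv H by auto
qed

lemma op_adjoint_diff:
  assumes G: "G \<subseteq> l2 M \<times> l2 M" and "(f, u) \<in> op_adjoint M G" "(g, v) \<in> op_adjoint M G"
  shows "(\<lambda>x. f x - g x, \<lambda>x. u x - v x) \<in> op_adjoint M G"
proof -
  have l2: "f \<in> l2 M" "u \<in> l2 M" "g \<in> l2 M" "v \<in> l2 M"
    using assms(2,3) op_adjoint_l2 by blast+
  have "l2_inner M q (\<lambda>x. f x - g x) = l2_inner M p (\<lambda>x. u x - v x)" if "(p, q) \<in> G" for p q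
    using op_adjointD[OF assms(2) that] op_adjointD[OF assms(3) that] G that l2
    by (auto simp: l2_inner_diff_right)
  then show ?thesis using l2 by (auto simp: op_adjoint_def intro: l2_diff)
qed

lemma op_adjoint_AE:
  assumes G: "G \<subseteq> l2 M \<times> l2 M" and "(f, u) \<in> op_adjoint M G" "g \<in> l2 M" "v \<in> l2 M"
    and "AE x in M. f x = g x" "AE x in M. u x = v x"
  shows "(g, v) \<in> op_adjoint M G"
proof -
  have l2: "f \<in> l2 M" "u \<in> l2 M" using assms(2) op_adjoint_l2 by blast+
  have "l2_inner M q g = l2_inner M p v" if "(p, q) \<in> G" for p q
  proof -
    have "p \<in> l2 M" "q \<in> l2 M" using G that by auto
    then have "l2_inner M q g = l2_inner M q f" "l2_inner M p v = l2_inner M p u"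
      using assms l2 by (auto intro!: l2_inner_cong_AE)
    then show ?thesis using op_adjointD[OF assms(2) that] by simp
  qed
  then show ?thesis using assms by (auto simp: op_adjoint_def)
qed

lemma subset_graph_closure: "G \<subseteq> l2 M \<times> l2 M \<Longrightarrow> G \<subseteq> graph_closure M G"
proof
  fix p assume p: "p \<in> G" "G \<subseteq> l2 M \<times> l2 M"
  obtain f u where fu: "p = (f, u)" by (cases p)
  have "l2_dist M h h = 0" for h by (simp add: l2_dist_def)
  then show "p \<in> graph_closure M G"
    using p unfolding fu graph_closure_def by (auto intro!: bexI[of _ "(f, u)"])
qed

text \<open>
  The condition defining the adjoint is continuous in the pair that it tests, so it extends to
  limits of such pairs.
\<close>

lemma op_adjoint_graph_closure:
  assumes G: "G \<subseteq> l2 M \<times> l2 M"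
  shows "op_adjoint M (graph_closure M G) = op_adjoint M G"
proof
  show "op_adjoint M (graph_closure M G) \<subseteq> op_adjoint M G"
    using subset_graph_closure[OF G] by (rule op_adjoint_antimono)
  show "op_adjoint M G \<subseteq> op_adjoint M (graph_closure M G)"
  proof clarify
    fix g v assume gv: "(g, v) \<in> op_adjoint M G"
    then have g: "g \<in> l2 M" and v: "v \<in> l2 M" using op_adjoint_l2 by blast+
    have "l2_inner M u g = l2_inner M f v" if fu: "(f, u) \<in> graph_closure M G" for f u
    proof -
      have f: "f \<in> l2 M" and u: "u \<in> l2 M" using fu by (auto simp: graph_closure_def)
      define C where "C = (1 + (LINT x|M. (cmod (g x))\<^sup>2)) + (1 + (LINT x|M. (cmod (v x))\<^sup>2))"
      have "0 \<le> (LINT x|M. (cmod (h x))\<^sup>2)" for h by (rule integral_nonneg_AE) simp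
      from this[of g] this[of v] have C: "C > 0" unfolding C_def by linarith
      have "cmod (l2_inner M u g - l2_inner M f v) \<le> 0 + e" if e: "e > 0" for e
      proof -
        define d where "d = e / C"
        have d: "d > 0" using e C by (simp add: d_def)
        then obtain f' u' where fu': "(f', u') \<in> G" "l2_dist M f f' < d" "l2_dist M u u' < d"
          using fu unfolding graph_closure_def by blast
        then have l2': "f' \<in> l2 M" "u' \<in> l2 M" using G by auto
        have "cmod (l2_inner M (\<lambda>x. u x - u' x) g) \<le> d * (1 + (LINT x|M. (cmod (g x))\<^sup>2))"
          using l2_dist_less_square[OF fu'(3)] by (intro l2_inner_le l2_diff u l2' g d) simp
        moreover have "cmod (l2_inner M (\<lambda>x. f x - f' x) v) \<le> d * (1 + (LINT x|M. (cmod (v x))\<^sup>2))"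
          using l2_dist_less_square[OF fu'(2)] by (intro l2_inner_le l2_diff f l2' v d) simp
        moreover have "l2_inner M u g - l2_inner M f v =
            l2_inner M (\<lambda>x. u x - u' x) g - l2_inner M (\<lambda>x. f x - f' x) v"
          by (simp add: l2_inner_diff_left op_adjointD[OF gv fu'(1)] f u g v l2')
        ultimately have "cmod (l2_inner M u g - l2_inner M f v) \<le> d * C"
          using norm_triangle_ineq4[of "l2_inner M (\<lambda>x. u x - u' x) g" "l2_inner M (\<lambda>x. f x - f' x) v"]
          unfolding C_def distrib_left[of d "1 + (LINT x|M. (cmod (g x))\<^sup>2)"] by simp
        then show ?thesis using C by (simp add: d_def)
      qed
      then have "cmod (l2_inner M u g - l2_inner M f v) \<le> 0" by (rule field_le_epsilon)
      then show ?thesis by simp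
    qed
    then show "(g, v) \<in> op_adjoint M (graph_closure M G)"
      using g v by (auto simp: op_adjoint_def)
  qed
qed

lemma graph_closure_subset_op_adjoint:
  assumes G: "G \<subseteq> op_adjoint M H" and H: "H \<subseteq> l2 M \<times> l2 M"
  shows "graph_closure M G \<subseteq> op_adjoint M H"
proof -
  have Gl2: "G \<subseteq> l2 M \<times> l2 M" using G op_adjoint_subset[of M H] by (rule subset_trans)
  have "H \<subseteq> op_adjoint M (graph_closure M G)"
    using subset_op_adjoint_swap[OF G H] op_adjoint_graph_closure[OF Gl2] by simp
  then show ?thesis by (rule subset_op_adjoint_swap) (auto simp: graph_closure_def)
qed

section \<open>Polynomials on the real line\<close>

text \<open>
  A polynomial and its derivatives, as functions on the real line. In this form polynomials take
  part in integrations by parts.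
\<close>

definition pchain :: "complex poly \<Rightarrow> nat \<Rightarrow> real \<Rightarrow> complex" where
  "pchain p k t = poly ((pderiv ^^ k) p) (of_real t)"

lemma pchain_0: "pchain p 0 = (\<lambda>t. poly p (of_real t))"
  by (simp add: pchain_def fun_eq_iff)

lemma pchain_has_vector_derivative:
  "(pchain p k has_vector_derivative pchain p (Suc k) t) (at t)"
proof -
  have "(poly ((pderiv ^^ k) p) has_field_derivative poly (pderiv ((pderiv ^^ k) p)) (of_real t)) (at (of_real t))"
    by (rule poly_DERIV)
  from has_vector_derivative_real_field[OF this] show ?thesis
    by (simp add: pchain_def[abs_def])
qed

lemma pchain_continuous: "continuous_on S (pchain p k)"
  by (meson continuous_at_imp_continuous_on has_vector_derivative_continuous
      pchain_has_vector_derivative)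

lemma degree_funpow_pderiv: "degree ((pderiv ^^ k) (p :: complex poly)) = degree p - k"
  by (induction k) (auto simp: degree_pderiv)

section \<open>Indefinite integrals and Green's formula\<close>

locale bounded_interval =
  fixes a b :: real
  assumes ab: "a < b"
begin

abbreviation M :: "real measure" where "M \<equiv> lebesgue_on {a<..<b}"

lemma finite_measure_M: "finite_measure M"
  by (rule finite_measure_lebesgue_on) simp

lemma continuous_measurable: "continuous_on {a..b} (g :: real \<Rightarrow> complex) \<Longrightarrow> g \<in> borel_measurable M"
  by (rule continuous_imp_measurable_on_sets_lebesgue)
     (auto elim: continuous_on_subset)

lemma continuous_boundedE:
  assumes "continuous_on {a..b} (g :: real \<Rightarrow> complex)"
  obtains C where "C > 0" "\<And>t. t \<in> {a..b} \<Longrightarrow> cmod (g t) \<le> C"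
proof -
  have "bounded (g ` {a..b})"
    by (intro compact_imp_bounded compact_continuous_image assms compact_Icc)
  then show ?thesis using that unfolding bounded_pos by blast
qed

lemma integrable_mult_continuous:
  assumes w: "integrable M w" and g: "continuous_on {a..b} (g :: real \<Rightarrow> complex)"
  shows "integrable M (\<lambda>t. w t * g t)"
proof -
  obtain C where C: "C > 0" "\<And>t. t \<in> {a..b} \<Longrightarrow> cmod (g t) \<le> C"
    using continuous_boundedE[OF g] by metis
  show ?thesis
  proof (rule Bochner_Integration.integrable_bound)
    show "integrable M (\<lambda>t. C * norm (w t))" using w by simp
    show "(\<lambda>t. w t * g t) \<in> borel_measurable M"
      using borel_measurable_integrable[OF w] continuous_measurable[OF g] by measurable
    have "norm (w t * g t) \<le> norm (C * norm (w t))" if "t \<in> space M" for t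
      using C(2)[of t] C(1) that by (simp add: norm_mult mult.commute mult_right_mono)
    then show "AE t in M. norm (w t * g t) \<le> norm (C * norm (w t))"
      by (auto intro!: AE_I2)
  qed
qed

lemma integrable_const_M: "integrable M (\<lambda>t. c :: complex)"
  by (rule finite_measure.integrable_const[OF finite_measure_M])

lemma continuous_l2:
  assumes "continuous_on {a..b} g"
  shows "g \<in> l2 M"
proof -
  obtain C where C: "C > 0" "\<And>t. t \<in> {a..b} \<Longrightarrow> cmod (g t) \<le> C"
    using continuous_boundedE[OF assms] by metis
  show ?thesis
  proof (rule l2_bound)
    show "g \<in> borel_measurable M" by (rule continuous_measurable[OF assms])
    show "integrable M (\<lambda>t. C\<^sup>2)"
      by (rule finite_measure.integrable_const[OF finite_measure_M])
    show "(cmod (g t))\<^sup>2 \<le> C\<^sup>2" if "t \<in> space M" for t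
      using C(2)[of t] that by (intro power_mono) auto
  qed
qed

lemma l2_integrable:
  assumes "f \<in> l2 M"
  shows "integrable M f"
  using l2_mult_integrable[OF assms continuous_l2[of "\<lambda>t. 1"]] by simp

text \<open>
  The Volterra operator; the iterates \<open>J ^^ k\<close> are the repeated integrals with base point \<open>a\<close>.
\<close>

definition J :: "(real \<Rightarrow> complex) \<Rightarrow> real \<Rightarrow> complex" where
  "J w x = integral {a..x} w"

lemma J_a [simp]: "J w a = 0"
  by (simp add: J_def)

lemma integrable_on_Icc:
  assumes "integrable M (w :: real \<Rightarrow> complex)" "x \<in> {a..b}"
  shows "w integrable_on {a..x}"
proof -
  have "(w has_integral (integral\<^sup>L M w)) {a<..<b}"
    by (rule has_integral_integral_lebesgue_on) (auto simp: assms)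
  then have "w integrable_on {a<..<b}" by blast
  then have "w integrable_on {a..b}"
    by (simp add: integrable_on_open_interval_real)
  then show ?thesis
    by (rule integrable_on_subinterval) (use assms(2) in auto)
qed

lemma J_continuous: "integrable M w \<Longrightarrow> continuous_on {a..b} (J w)"
  unfolding J_def[abs_def] using integrable_on_Icc[of w b] ab
  by (intro indefinite_integral_continuous_1) auto

lemma J_eq_LINT_le:
  assumes w: "integrable M w" and x: "x \<in> {a..b}"
  shows "J w x = (LINT t|M. (if t \<le> x then w t else 0))"
    and "integrable M (\<lambda>t. if t \<le> x then w t else 0)"
proof -
  have "integrable M (\<lambda>t. indicator ({..x} \<inter> {a<..<b}) t *\<^sub>R w t)"
    by (rule integrable_mult_indicator[OF _ w]) (simp add: sets_restrict_space_iff)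
  then show i: "integrable M (\<lambda>t. if t \<le> x then w t else 0)"
    by (rule Bochner_Integration.integrable_cong[THEN iffD1, rotated 2]) auto
  have "(LINT t|M. (if t \<le> x then w t else 0)) = integral {a<..<b} (\<lambda>t. if t \<in> {..x} then w t else 0)"
    using lebesgue_integral_eq_integral[OF i] by simp
  also have "\<dots> = integral ({..x} \<inter> {a<..<b}) w"
    by (rule integral_restrict_Int)
  also have "\<dots> = integral {a..x} w"
    by (rule integral_spike_set; rule negligible_subset[of "{a, b, x}"]) (use x in auto)
  finally show "J w x = (LINT t|M. (if t \<le> x then w t else 0))" by (simp add: J_def)
qed

lemma J_b: "integrable M w \<Longrightarrow> J w b = integral\<^sup>L M w"
  by (subst J_eq_LINT_le) (auto simp: ab less_imp_le intro!: Bochner_Integration.integral_cong)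

text \<open>Integration by parts is Fubini's theorem on the triangle \<open>s \<le> t\<close>.\<close>

lemma J_by_parts:
  assumes w: "integrable M w" and v: "integrable M v"
  shows "(LINT t|M. w t * J v t) + (LINT t|M. v t * J w t) = J w b * J v b"
proof -
  interpret finite_measure M by (rule finite_measure_M)
  interpret pair_sigma_finite M M ..
  define k where "k = (\<lambda>(s, t). if s \<le> t then w s * v t else 0)"
  have [measurable]: "w \<in> borel_measurable M" "v \<in> borel_measurable M"
    using w v by auto
  have id: "(\<lambda>t. t) \<in> measurable M borel"
    using id_borel_measurable_lebesgue_on by (simp add: id_def)
  have [measurable]: "fst \<in> borel_measurable (M \<Otimes>\<^sub>M M)" "snd \<in> borel_measurable (M \<Otimes>\<^sub>M M)"
    by (rule measurable_compose[OF measurable_fst id], rule measurable_compose[OF measurable_snd id])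
  have [measurable]: "(\<lambda>p. w (fst p)) \<in> borel_measurable (M \<Otimes>\<^sub>M M)"
      "(\<lambda>p. v (snd p)) \<in> borel_measurable (M \<Otimes>\<^sub>M M)"
    by (auto intro: measurable_compose[OF measurable_fst] measurable_compose[OF measurable_snd])
  have k_meas: "k \<in> borel_measurable (M \<Otimes>\<^sub>M M)"
    unfolding k_def case_prod_beta by measurable
  have prod: "integrable (M \<Otimes>\<^sub>M M) (\<lambda>p. w (fst p) * v (snd p))"
  proof (rule Fubini_integrable)
    show "integrable M (\<lambda>s. LINT t|M. norm (w (fst (s, t)) * v (snd (s, t))))"
      using w by (simp add: norm_mult)
    show "AE s in M. integrable M (\<lambda>t. w (fst (s, t)) * v (snd (s, t)))"
      using v by simp
  qed measurable
  have k_int: "integrable (M \<Otimes>\<^sub>M M) k"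
    by (rule Bochner_Integration.integrable_bound[OF prod k_meas]) (auto simp: k_def)
  have "(LINT t|M. v t * J w t) = (LINT t|M. LINT s|M. k (s, t))"
  proof (rule Bochner_Integration.integral_cong[OF refl])
    fix t assume "t \<in> space M"
    then have t: "t \<in> {a..b}" by simp
    have "(LINT s|M. k (s, t)) = (LINT s|M. v t * (if s \<le> t then w s else 0))"
      by (intro Bochner_Integration.integral_cong) (auto simp: k_def)
    then show "v t * J w t = (LINT s|M. k (s, t))"
      by (simp add: J_eq_LINT_le(1)[OF w t])
  qed
  also have "\<dots> = (LINT s|M. LINT t|M. k (s, t))"
    using Fubini_integral[of "\<lambda>s t. k (s, t)"] k_int by simp
  also have "\<dots> = (LINT s|M. w s * J v b - w s * J v s)"
  proof (rule Bochner_Integration.integral_cong[OF refl])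
    fix s assume "s \<in> space M"
    then have s: "s \<in> {a..b}" by simp
    have ne: "AE t in M. t \<noteq> s"
      using AE_completion[OF AE_lborel_singleton[of s]]
      by (subst AE_restrict_space_iff) auto
    have "(LINT t|M. k (s, t)) = (LINT t|M. w s * (v t - (if t \<le> s then v t else 0)))"
    proof (rule integral_cong_AE)
      show "AE t in M. k (s, t) = w s * (v t - (if t \<le> s then v t else 0))"
        using ne by eventually_elim (auto simp: k_def)
      show "(\<lambda>t. k (s, t)) \<in> borel_measurable M"
        using measurable_compose[OF measurable_Pair1' k_meas] \<open>s \<in> space M\<close> by auto
      show "(\<lambda>t. w s * (v t - (if t \<le> s then v t else 0))) \<in> borel_measurable M"
        using J_eq_LINT_le(2)[OF v s] by measurable
    qed
    also have "\<dots> = w s * (J v b - J v s)"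
      using v J_eq_LINT_le(2)[OF v s] by (simp add: J_b J_eq_LINT_le(1)[OF v s])
    finally show "(LINT t|M. k (s, t)) = w s * J v b - w s * J v s"
      by (simp add: algebra_simps)
  qed
  also have "\<dots> = J w b * J v b - (LINT s|M. w s * J v s)"
    using w integrable_mult_continuous[OF w J_continuous[OF v]] by (simp add: J_b)
  finally show ?thesis by simp
qed

lemma integration_by_parts:
  assumes w: "integrable M w" and v: "integrable M v"
    and F: "\<And>x. x \<in> {a..b} \<Longrightarrow> F x = F a + J w x"
    and G: "\<And>x. x \<in> {a..b} \<Longrightarrow> G x = G a + J v x"
  shows "(LINT t|M. w t * G t) = F b * G b - F a * G a - (LINT t|M. F t * v t)"
proof -
  note [simp] = w v integrable_mult_continuous[OF w J_continuous[OF v]]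
    integrable_mult_continuous[OF v J_continuous[OF w]]
  have Fb: "F b = F a + J w b" and Gb: "G b = G a + J v b" using F[of b] G[of b] ab by simp_all
  have "(LINT t|M. w t * G t) = (LINT t|M. w t * G a + w t * J v t)"
    by (intro Bochner_Integration.integral_cong[OF refl], subst G) (auto simp: distrib_left)
  also have "\<dots> = J w b * G a + (LINT t|M. w t * J v t)"
    by (simp add: J_b)
  finally have 1: "(LINT t|M. w t * G t) = J w b * G a + (LINT t|M. w t * J v t)" .
  have "(LINT t|M. F t * v t) = (LINT t|M. v t * F a + v t * J w t)"
    by (intro Bochner_Integration.integral_cong[OF refl], subst F) (auto simp: algebra_simps)
  also have "\<dots> = J v b * F a + (LINT t|M. v t * J w t)"
    by (simp add: J_b)
  finally have 2: "(LINT t|M. F t * v t) = J v b * F a + (LINT t|M. v t * J w t)" .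
  show ?thesis unfolding 1 2 Fb Gb using J_by_parts[OF w v] by (simp add: algebra_simps)
qed

lemma J_diff:
  assumes "integrable M w" "integrable M v" "x \<in> {a..b}"
  shows "J (\<lambda>t. w t - v t) x = J w x - J v x"
  unfolding J_def by (intro integral_diff integrable_on_Icc assms)

lemma J_cmult: "J (\<lambda>t. c * w t) x = c * J w x"
  unfolding J_def by simp

lemma J_cnj: "J (\<lambda>t. cnj (w t)) x = cnj (J w x)"
  unfolding J_def by (simp add: integral_cnj)

lemma J_cong:
  assumes "\<And>t. t \<in> {a..b} \<Longrightarrow> w t = v t" "x \<in> {a..b}"
  shows "J w x = J v x"
  unfolding J_def by (rule integral_cong) (use assms in auto)

lemma J_norm_le:
  assumes w: "continuous_on {a..b} w" and le: "\<And>t. t \<in> {a..b} \<Longrightarrow> cmod (w t) \<le> C" and x: "x \<in> {a..b}"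
  shows "cmod (J w x) \<le> (b - a) * C"
proof -
  have C: "0 \<le> C" using le[OF x] norm_ge_zero order_trans by blast
  have "cmod (J w x) \<le> C * (x - a)"
    unfolding J_def using x le by (intro integral_bound continuous_on_subset[OF w]) auto
  also have "\<dots> \<le> C * (b - a)" using x C by (intro mult_left_mono) auto
  finally show ?thesis by (simp add: mult.commute)
qed

lemma J_FTC:
  assumes "\<And>t. t \<in> {a..b} \<Longrightarrow> (F has_vector_derivative w t) (at t)" and x: "x \<in> {a..b}"
  shows "F x = F a + J w x"
proof -
  have "(w has_integral F x - F a) {a..x}"
  proof (rule fundamental_theorem_of_calculus)
    show "(F has_vector_derivative w t) (at t within {a..x})" if "t \<in> {a..x}" for t
      by (rule has_vector_derivative_at_within, rule assms(1)) (use that x in auto)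
  qed (use x in auto)
  then show ?thesis unfolding J_def by (simp add: integral_unique)
qed

text \<open>
  A chain consists of a function and its successive derivatives: \<open>F 0\<close> is the continuous
  representative of an element of the Sobolev space of order \<open>m\<close>, and \<open>F m\<close> is its weak
  derivative of that order.
\<close>

definition chain :: "nat \<Rightarrow> (nat \<Rightarrow> real \<Rightarrow> complex) \<Rightarrow> bool" where
  "chain m F \<longleftrightarrow> F m \<in> l2 M \<and> (\<forall>k<m. \<forall>x\<in>{a..b}. F k x = F k a + J (F (Suc k)) x)"

lemma chainD: "chain m F \<Longrightarrow> k < m \<Longrightarrow> x \<in> {a..b} \<Longrightarrow> F k x = F k a + J (F (Suc k)) x"
  unfolding chain_def by blast

lemma continuous_on_eq_const_plus_J:
  assumes "integrable M w" "\<And>x. x \<in> {a..b} \<Longrightarrow> F x = F a + J w x"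
  shows "continuous_on {a..b} F"
proof -
  have "continuous_on {a..b} (\<lambda>x. F a + J w x)"
    by (rule continuous_on_add[OF continuous_on_const J_continuous[OF assms(1)]])
  then show ?thesis
    by (rule continuous_on_eq) (rule assms(2)[symmetric])
qed

lemma chain_l2:
  assumes "chain m F" "k \<le> m"
  shows "F k \<in> l2 M"
  using assms(2)
proof (induction k rule: inc_induct)
  case base
  then show ?case using assms(1) by (simp add: chain_def)
next
  case (step k)
  show ?case
    by (rule continuous_l2, rule continuous_on_eq_const_plus_J[OF l2_integrable[OF step.IH]])
       (rule chainD[OF assms(1) step.hyps(2)])
qed

lemma chain_continuous:
  assumes "chain m F" "k < m"
  shows "continuous_on {a..b} (F k)"
  by (rule continuous_on_eq_const_plus_J[OF l2_integrable[OF chain_l2[OF assms(1), of "Suc k"]]])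
     (use assms(2) in simp, rule chainD[OF assms])

lemma chain_diff:
  assumes "chain m F" "chain m G"
  shows "chain m (\<lambda>k t. F k t - G k t)"
  unfolding chain_def
proof (intro conjI allI impI ballI)
  show "(\<lambda>t. F m t - G m t) \<in> l2 M" by (intro l2_diff chain_l2[OF _ order_refl] assms)
  fix k x assume k: "k < m" and x: "x \<in> {a..b}"
  have "J (\<lambda>t. F (Suc k) t - G (Suc k) t) x = J (F (Suc k)) x - J (G (Suc k)) x"
    using k x by (intro J_diff l2_integrable chain_l2[OF assms(1)] chain_l2[OF assms(2)]) auto
  then show "F k x - G k x = F k a - G k a + J (\<lambda>t. F (Suc k) t - G (Suc k) t) x"
    using chainD[OF assms(1) k x] chainD[OF assms(2) k x] by simp
qed

lemma chain_cmult:
  assumes "chain m F"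
  shows "chain m (\<lambda>k t. c * F k t)"
  unfolding chain_def
proof (intro conjI allI impI ballI)
  show "(\<lambda>t. c * F m t) \<in> l2 M" by (intro l2_cmult chain_l2[OF assms order_refl])
  fix k x assume k: "k < m" and x: "x \<in> {a..b}"
  show "c * F k x = c * F k a + J (\<lambda>t. c * F (Suc k) t) x"
    unfolding J_cmult using chainD[OF assms k x] by (metis distrib_left)
qed

lemma chain_add:
  assumes "chain m F" "chain m G"
  shows "chain m (\<lambda>k t. F k t + G k t)"
  using chain_diff[OF assms(1) chain_cmult[OF assms(2), of "-1"]] by simp

lemma chain_cnj:
  assumes "chain m F"
  shows "chain m (\<lambda>k t. cnj (F k t))"
  unfolding chain_def
proof (intro conjI allI impI ballI)
  show "(\<lambda>t. cnj (F m t)) \<in> l2 M" by (intro l2_cnj chain_l2[OF assms order_refl])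
  fix k x assume k: "k < m" and x: "x \<in> {a..b}"
  show "cnj (F k x) = cnj (F k a) + J (\<lambda>t. cnj (F (Suc k) t)) x"
    unfolding J_cnj using chainD[OF assms k x] by (metis complex_cnj_add)
qed

text \<open>Each of the \<open>r\<close> integrations by parts moves one derivative from \<open>F\<close> to \<open>G\<close>.\<close>

lemma chain_by_parts:
  assumes F: "chain m F" and G: "chain l G" and "j + r \<le> m" "k + r \<le> l"
  shows "(LINT t|M. F (j + r) t * G k t) =
    (\<Sum>i<r. (-1) ^ i * (F (j + r - 1 - i) b * G (k + i) b - F (j + r - 1 - i) a * G (k + i) a))
    + (-1) ^ r * (LINT t|M. F j t * G (k + r) t)"
  using assms(3,4)
proof (induction r arbitrary: k)
  case 0
  then show ?case by simp
next
  case (Suc r)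
  let ?B = "\<lambda>p q. F p b * G q b - F p a * G q a"
  have e1: "(LINT t|M. F (Suc (j + r)) t * G k t) =
      F (j + r) b * G k b - F (j + r) a * G k a - (LINT t|M. F (j + r) t * G (Suc k) t)"
    using Suc.prems
    by (intro integration_by_parts l2_integrable chain_l2[OF F] chain_l2[OF G] chainD[OF F] chainD[OF G]) auto
  have e2: "(LINT t|M. F (j + r) t * G (Suc k) t) =
      (\<Sum>i<r. (-1) ^ i * ?B (j + r - 1 - i) (Suc k + i))
      + (-1) ^ r * (LINT t|M. F j t * G (Suc k + r) t)"
    using Suc.prems by (intro Suc.IH) auto
  have e3: "(\<Sum>i<Suc r. (-1) ^ i * ?B (j + r - i) (k + i)) =
      ?B (j + r) k - (\<Sum>i<r. (-1) ^ i * ?B (j + r - 1 - i) (Suc k + i))"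
    unfolding sum.lessThan_Suc_shift by (simp add: sum_negf)
  have "(LINT t|M. F (Suc (j + r)) t * G k t) =
      (\<Sum>i<Suc r. (-1) ^ i * ?B (j + r - i) (k + i)) + (-1) ^ Suc r * (LINT t|M. F j t * G (Suc k + r) t)"
    unfolding e1 e2 e3 by simp
  then show ?case by (simp del: sum.lessThan_Suc)
qed

lemma chain_pchain: "chain m (pchain p)"
  unfolding chain_def
  by (auto intro!: continuous_l2 pchain_continuous J_FTC pchain_has_vector_derivative)

end

section \<open>Smooth functions and cutoffs\<close>

definition smooth :: "(real \<Rightarrow> complex) \<Rightarrow> bool" where
  "smooth f \<longleftrightarrow> (\<forall>k x. nth_deriv k f differentiable (at x))"

lemma nth_deriv_0 [simp]: "nth_deriv 0 f = f"
  by (simp add: nth_deriv_def)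

lemma nth_deriv_Suc: "nth_deriv (Suc k) f = (\<lambda>x. vector_derivative (nth_deriv k f) (at x))"
  by (simp add: nth_deriv_def)

lemma nth_deriv_Suc_eq:
  assumes "\<And>x. (f has_vector_derivative f' x) (at x)"
  shows "nth_deriv (Suc k) f = nth_deriv k f'"
proof -
  have "(\<lambda>x. vector_derivative f (at x)) = f'"
    using assms by (auto intro: vector_derivative_at)
  then show ?thesis by (simp add: nth_deriv_def funpow_Suc_right del: funpow.simps)
qed

lemma smooth_has_derivative:
  "smooth f \<Longrightarrow> (nth_deriv k f has_vector_derivative nth_deriv (Suc k) f x) (at x)"
  unfolding nth_deriv_Suc using vector_derivative_works smooth_def by blast

lemma smooth_continuous: "smooth f \<Longrightarrow> continuous_on S (nth_deriv k f)"
  by (meson continuous_at_imp_continuous_on has_vector_derivative_continuous smooth_has_derivative)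

text \<open>
  Smoothness is coinductive: it suffices to put the function into a set that is closed under
  taking derivatives.
\<close>

lemma smooth_coinduct:
  assumes "f \<in> S" and step: "\<And>g. g \<in> S \<Longrightarrow> \<exists>g'\<in>S. \<forall>x. (g has_vector_derivative g' x) (at x)"
  shows "smooth f"
proof -
  have "nth_deriv k f \<in> S" for k
  proof (induction k)
    case (Suc k)
    then obtain g' where "g' \<in> S" "\<And>x. (nth_deriv k f has_vector_derivative g' x) (at x)"
      using step by metis
    moreover from this(2) have "nth_deriv (Suc k) f = g'"
      unfolding nth_deriv_Suc by (auto intro: vector_derivative_at)
    ultimately show ?case by simp
  qed (simp add: assms(1))
  then show ?thesis
    unfolding smooth_def using step differentiableI_vector by metis
qed

lemma smooth_derivative:
  assumes "smooth f"
  shows "smooth (nth_deriv (Suc 0) f)"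
proof -
  have "nth_deriv (Suc k) f = nth_deriv k (nth_deriv (Suc 0) f)" for k
    using smooth_has_derivative[OF assms, of 0] by (intro nth_deriv_Suc_eq) simp
  then show ?thesis using assms unfolding smooth_def by metis
qed

lemma smooth_antiderivative:
  assumes "smooth f'" "\<And>x. (f has_vector_derivative f' x) (at x)"
  shows "smooth f"
proof -
  have "nth_deriv k f differentiable (at x)" for k x
  proof (cases k)
    case 0
    then show ?thesis using assms(2) by (auto intro: differentiableI_vector)
  next
    case (Suc j)
    then show ?thesis using assms(1) nth_deriv_Suc_eq[OF assms(2)] by (simp add: smooth_def)
  qed
  then show ?thesis by (simp add: smooth_def)
qed

lemma smooth_pchain: "smooth (pchain p k)"
  by (rule smooth_coinduct[where S = "range (\<lambda>k. pchain p k)"])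
     (auto intro: pchain_has_vector_derivative)

lemma smooth_affine:
  assumes f: "smooth f"
  shows "smooth (\<lambda>x. f (c * x + d))"
proof (rule smooth_coinduct)
  let ?S = "{(\<lambda>x. e * nth_deriv k f (c * x + d)) |e k. True}"
  show "(\<lambda>x. f (c * x + d)) \<in> ?S"
    by (intro CollectI exI[of _ 1] exI[of _ 0]) simp
  fix g assume "g \<in> ?S"
  then obtain e k where g: "g = (\<lambda>x. e * nth_deriv k f (c * x + d))" by blast
  have "(g has_vector_derivative (e * of_real c) * nth_deriv (Suc k) f (c * x + d)) (at x)" for x
  proof -
    have "((\<lambda>x. c * x + d) has_vector_derivative c) (at x)"
      by (auto intro!: derivative_eq_intros simp flip: has_real_derivative_iff_has_vector_derivative)
    from vector_diff_chain_at[OF this smooth_has_derivative[OF f]]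
    have "((\<lambda>x. nth_deriv k f (c * x + d)) has_vector_derivative c *\<^sub>R nth_deriv (Suc k) f (c * x + d)) (at x)"
      by (simp add: o_def)
    from has_vector_derivative_mult_right[OF this, of e]
    show ?thesis unfolding g by (simp add: scaleR_conv_of_real mult.assoc)
  qed
  then show "\<exists>g'\<in>?S. \<forall>x. (g has_vector_derivative g' x) (at x)"
    by (intro bexI[of _ "\<lambda>x. (e * of_real c) * nth_deriv (Suc k) f (c * x + d)"]) auto
qed

text \<open>
  By the product rule, the finite sums of products of smooth functions are closed under taking
  derivatives; this is the set to which coinduction is applied for products.
\<close>

inductive_set smooth_products :: "(real \<Rightarrow> complex) set" where
  mult: "smooth f \<Longrightarrow> smooth g \<Longrightarrow> (\<lambda>x. f x * g x) \<in> smooth_products"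
| add: "f \<in> smooth_products \<Longrightarrow> g \<in> smooth_products \<Longrightarrow> (\<lambda>x. f x + g x) \<in> smooth_products"

lemma smooth_products_derivative:
  "g \<in> smooth_products \<Longrightarrow> \<exists>g'\<in>smooth_products. \<forall>x. (g has_vector_derivative g' x) (at x)"
proof (induction rule: smooth_products.induct)
  case (mult f g)
  have "(\<lambda>x. f x * nth_deriv (Suc 0) g x + nth_deriv (Suc 0) f x * g x) \<in> smooth_products"
    by (intro smooth_products.intros mult smooth_derivative)
  moreover have "((\<lambda>x. f x * g x) has_vector_derivative
      f x * nth_deriv (Suc 0) g x + nth_deriv (Suc 0) f x * g x) (at x)" for x
    using has_vector_derivative_mult[OF smooth_has_derivative[OF mult(1), of 0 x] smooth_has_derivative[OF mult(2), of 0 x]]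
    by simp
  ultimately show ?case
    by (intro bexI[of _ "\<lambda>x. f x * nth_deriv (Suc 0) g x + nth_deriv (Suc 0) f x * g x"]) auto
next
  case (add f g)
  then obtain f' g' where "f' \<in> smooth_products" "g' \<in> smooth_products"
    "\<And>x. (f has_vector_derivative f' x) (at x)" "\<And>x. (g has_vector_derivative g' x) (at x)"
    by blast
  then show ?case
    by (intro bexI[of _ "\<lambda>x. f' x + g' x"]) (auto intro: smooth_products.add has_vector_derivative_add)
qed

lemma smooth_mult: "smooth f \<Longrightarrow> smooth g \<Longrightarrow> smooth (\<lambda>x. f x * g x)"
  by (rule smooth_coinduct[OF smooth_products.mult smooth_products_derivative])

lemma smooth_add:
  assumes "smooth f" "smooth g"
  shows "smooth (\<lambda>x. f x + g x)"
proof (rule smooth_coinduct)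
  have one: "smooth (\<lambda>x. 1)" using smooth_pchain[of "[:1:]" 0] by (simp add: pchain_0)
  show "(\<lambda>x. f x + g x) \<in> smooth_products"
    using smooth_products.add[OF smooth_products.mult[OF assms(1) one] smooth_products.mult[OF assms(2) one]]
    by simp
qed (rule smooth_products_derivative)

lemma smooth_cmult: "smooth f \<Longrightarrow> smooth (\<lambda>x. c * f x)"
  using smooth_mult[OF smooth_pchain[of "[:c:]" 0]] by (simp add: pchain_0)

lemma nth_deriv_diff_cmult:
  assumes "smooth f" "smooth g"
  shows "nth_deriv k (\<lambda>x. f x - c * g x) = (\<lambda>x. nth_deriv k f x - c * nth_deriv k g x)"
proof (induction k)
  case (Suc k)
  have "((\<lambda>x. nth_deriv k f x - c * nth_deriv k g x) has_vector_derivative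
      nth_deriv (Suc k) f x - c * nth_deriv (Suc k) g x) (at x)" for x
    by (intro has_vector_derivative_diff has_vector_derivative_mult_right smooth_has_derivative assms)
  then show ?case
    unfolding nth_deriv_Suc[of k "\<lambda>x. f x - c * g x"] Suc.IH by (auto intro: vector_derivative_at)
qed simp

text \<open>
  The functions \<open>p (1/x) exp (-1/x)\<close>, extended by zero, are closed under differentiation,
  including at the origin, where the exponential beats every power.
\<close>

definition flat_exp :: "real poly \<Rightarrow> real \<Rightarrow> real" where
  "flat_exp p x = (if x \<le> 0 then 0 else poly p (inverse x) * exp (- inverse x))"

lemma poly_times_exp_tendsto_0: "((\<lambda>y. poly p y * exp (- y)) \<longlongrightarrow> (0 :: real)) at_top"
proof -
  have "((\<lambda>y. \<Sum>i\<le>degree p. coeff p i * (y ^ i / exp y)) \<longlongrightarrow> (\<Sum>i\<le>degree p. coeff p i * 0)) at_top"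
    by (intro tendsto_sum tendsto_mult tendsto_const tendsto_power_div_exp_0)
  then show ?thesis
    by (simp add: poly_altdef sum_distrib_right exp_minus field_simps sum_divide_distrib)
qed

lemma flat_exp_has_derivative:
  "(flat_exp p has_real_derivative flat_exp ([:0, 0, 1:] * (p - pderiv p)) x) (at x)"
proof -
  consider "x < 0" | "x = 0" | "x > 0" by linarith
  then show ?thesis
  proof cases
    case 1
    have "((\<lambda>x. 0) has_real_derivative 0) (at x)" by simp
    then have "(flat_exp p has_real_derivative 0) (at x)"
      by (rule has_field_derivative_transform_within_open[where S = "{..<0}"])
         (use 1 in \<open>auto simp: flat_exp_def\<close>)
    then show ?thesis using 1 by (simp add: flat_exp_def)
  next
    case 3
    have "((\<lambda>x. poly p (inverse x) * exp (- inverse x)) has_real_derivative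
        flat_exp ([:0, 0, 1:] * (p - pderiv p)) x) (at x)"
      using 3 by (auto intro!: derivative_eq_intros simp: flat_exp_def power2_eq_square algebra_simps)
    then show ?thesis
      by (rule has_field_derivative_transform_within_open[where S = "{0<..}"])
         (use 3 in \<open>auto simp: flat_exp_def\<close>)
  next
    case 2
    have "((\<lambda>h. poly ([:0, 1:] * p) (inverse h) * exp (- inverse h)) \<longlongrightarrow> 0) (at_right (0::real))"
      by (rule filterlim_compose[OF poly_times_exp_tendsto_0 filterlim_inverse_at_top_right])
    moreover have "\<forall>\<^sub>F h in at_right 0. poly ([:0, 1:] * p) (inverse h) * exp (- inverse h) = flat_exp p h / h"
      by (auto simp: eventually_at_filter flat_exp_def field_simps)
    ultimately have "((\<lambda>h. flat_exp p h / h) \<longlongrightarrow> 0) (at_right 0)"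
      by (rule Lim_transform_eventually)
    moreover have "((\<lambda>h. flat_exp p h / h) \<longlongrightarrow> 0) (at_left 0)"
      by (rule tendsto_eventually) (auto simp: eventually_at_filter flat_exp_def)
    ultimately have "((\<lambda>h. flat_exp p h / h) \<longlongrightarrow> 0) (at 0)"
      by (simp add: filterlim_at_split)
    then show ?thesis using 2 by (simp add: DERIV_def flat_exp_def)
  qed
qed

definition cutoff1 :: "real \<Rightarrow> complex" where
  "cutoff1 x = of_real (flat_exp 1 x)"

lemma smooth_cutoff1: "smooth cutoff1"
proof (rule smooth_coinduct)
  let ?S = "{(\<lambda>x. complex_of_real (flat_exp p x)) |p. True}"
  show "cutoff1 \<in> ?S" by (auto simp: cutoff1_def fun_eq_iff)
  fix g assume "g \<in> ?S"
  then obtain p where g: "g = (\<lambda>x. complex_of_real (flat_exp p x))" by blast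
  show "\<exists>g'\<in>?S. \<forall>x. (g has_vector_derivative g' x) (at x)"
    unfolding g using has_vector_derivative_of_real[OF flat_exp_has_derivative[of p]]
    by (intro bexI[of _ "\<lambda>x. of_real (flat_exp ([:0, 0, 1:] * (p - pderiv p)) x)"]) auto
qed

lemma cutoff1_eq_0: "x \<le> 0 \<Longrightarrow> cutoff1 x = 0"
  by (simp add: cutoff1_def flat_exp_def)

lemma cutoff1_norm_le: "cmod (cutoff1 x) \<le> 1"
  by (simp add: cutoff1_def flat_exp_def)

lemma cutoff1_tendsto: "(cutoff1 \<longlongrightarrow> 1) at_top"
proof -
  have "((\<lambda>x. exp (- inverse x)) \<longlongrightarrow> exp (- 0 :: real)) at_top"
    by (intro tendsto_intros tendsto_inverse_0_at_top filterlim_ident)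
  then have "((\<lambda>x. complex_of_real (exp (- inverse x))) \<longlongrightarrow> of_real 1) at_top"
    by (intro tendsto_of_real) simp
  moreover have "\<forall>\<^sub>F x in at_top. complex_of_real (exp (- inverse x)) = cutoff1 x"
    using eventually_gt_at_top[of 0] by eventually_elim (simp add: cutoff1_def flat_exp_def)
  ultimately show ?thesis by (simp add: Lim_transform_eventually)
qed

context bounded_interval
begin

abbreviation test :: "(real \<Rightarrow> complex) set" where "test \<equiv> test_functions a b"

text \<open>
  A closed support inside the open interval keeps a positive distance from the end points. In
  this form the condition passes easily to linear combinations and antiderivatives.
\<close>

lemma test_iff:
  "\<phi> \<in> test \<longleftrightarrow> smooth \<phi> \<and> (\<exists>e>0. \<forall>x. x \<notin> {a + e..b - e} \<longrightarrow> \<phi> x = 0)"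
proof
  assume \<phi>: "\<phi> \<in> test"
  let ?K = "closure {x. \<phi> x \<noteq> 0}"
  have K: "?K \<subseteq> {a<..<b}" using \<phi> by (simp add: test_functions_def)
  have "a \<notin> {a<..<b}" "b \<notin> {a<..<b}" by simp_all
  then have aK: "a \<in> - ?K" and bK: "b \<in> - ?K" using K by blast+
  have op: "open (- ?K)" by (intro open_Compl closed_closure)
  obtain e1 where e1: "e1 > 0" "ball a e1 \<subseteq> - ?K" by (rule openE[OF op aK])
  obtain e2 where e2: "e2 > 0" "ball b e2 \<subseteq> - ?K" by (rule openE[OF op bK])
  have "\<phi> x = 0" if "x \<notin> {a + min e1 e2..b - min e1 e2}" for x
  proof (rule ccontr)
    assume "\<phi> x \<noteq> 0"
    then have x: "x \<in> ?K" by (intro subsetD[OF closure_subset]) simp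
    then have "x \<in> {a<..<b}" using K by blast
    moreover have "x \<notin> ball a e1" "x \<notin> ball b e2" using x subsetD[OF e1(2)] subsetD[OF e2(2)] by blast+
    ultimately have "a < x" "x < b" "e1 \<le> \<bar>a - x\<bar>" "e2 \<le> \<bar>b - x\<bar>"
      by (simp_all add: dist_real_def)
    then have "a + min e1 e2 \<le> x" "x \<le> b - min e1 e2" by linarith+
    then show False using that by simp
  qed
  moreover have "smooth \<phi>" using \<phi> by (simp add: test_functions_def smooth_def)
  moreover have "min e1 e2 > 0" using e1(1) e2(1) by simp
  ultimately show "smooth \<phi> \<and> (\<exists>e>0. \<forall>x. x \<notin> {a + e..b - e} \<longrightarrow> \<phi> x = 0)"
    by blast
next
  assume "smooth \<phi> \<and> (\<exists>e>0. \<forall>x. x \<notin> {a + e..b - e} \<longrightarrow> \<phi> x = 0)"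
  then obtain e where e: "smooth \<phi>" "e > 0" "\<And>x. x \<notin> {a + e..b - e} \<Longrightarrow> \<phi> x = 0" by blast
  have "{x. \<phi> x \<noteq> 0} \<subseteq> {a + e..b - e}" using e(3) by blast
  then have "closure {x. \<phi> x \<noteq> 0} \<subseteq> {a + e..b - e}"
    by (rule closure_minimal) (rule closed_atLeastAtMost)
  moreover have "{a + e..b - e} \<subseteq> {a<..<b}" using e(2) by auto
  ultimately have "closure {x. \<phi> x \<noteq> 0} \<subseteq> {a<..<b}" by (rule subset_trans)
  then show "\<phi> \<in> test" using e(1) by (simp add: test_functions_def smooth_def)
qed

lemma test_smooth: "\<phi> \<in> test \<Longrightarrow> smooth \<phi>"
  by (simp add: test_iff)

lemma test_nth_deriv_zero:
  assumes "\<phi> \<in> test"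
  shows "nth_deriv k \<phi> a = 0" "nth_deriv k \<phi> b = 0"
proof -
  obtain e where e: "smooth \<phi>" "e > 0" "\<And>x. x \<notin> {a + e..b - e} \<Longrightarrow> \<phi> x = 0"
    using assms by (auto simp: test_iff)
  have op: "open (- {a + e..b - e})" by (simp add: open_Compl)
  have "\<forall>x. x \<notin> {a + e..b - e} \<longrightarrow> nth_deriv k \<phi> x = 0"
  proof (induction k)
    case (Suc k)
    have "(nth_deriv k \<phi> has_vector_derivative 0) (at x)" if "x \<notin> {a + e..b - e}" for x
      by (rule has_vector_derivative_transform_within_open[OF has_vector_derivative_const op])
         (use Suc that in auto)
    then show ?case unfolding nth_deriv_Suc by (auto intro: vector_derivative_at)
  qed (simp add: e)
  then show "nth_deriv k \<phi> a = 0" "nth_deriv k \<phi> b = 0" using e(2) by auto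
qed

lemma chain_smooth: "smooth \<phi> \<Longrightarrow> chain m (\<lambda>k. nth_deriv k \<phi>)"
  unfolding chain_def
  by (auto intro!: continuous_l2 smooth_continuous J_FTC smooth_has_derivative)

text \<open>
  For \<open>k \<ge> 1\<close> the two factors vanish for \<open>x \<le> a + 1/k\<close> and for \<open>x \<ge> b - 1/k\<close>, respectively. For \<open>k \<rightarrow> \<infinity>\<close> both arguments tend to
  infinity at every interior point, so the cutoffs exhaust the open interval.
\<close>

definition cutoff :: "nat \<Rightarrow> real \<Rightarrow> complex" where
  "cutoff k x = cutoff1 (real k * x + (- real k * a - 1)) * cutoff1 (- real k * x + (real k * b - 1))"

lemma cutoff_norm_le: "cmod (cutoff k x) \<le> 1"
  using mult_mono[OF cutoff1_norm_le cutoff1_norm_le]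
  by (simp add: cutoff_def norm_mult)

lemma cutoff_tendsto:
  assumes "x \<in> {a<..<b}"
  shows "(\<lambda>k. cutoff k x) \<longlonglongrightarrow> 1"
proof -
  have lim: "filterlim (\<lambda>k. real k * c - 1) at_top sequentially" if "c > 0" for c :: real
    using that by real_asymp
  have "(\<lambda>k. cutoff1 (real k * (x - a) - 1) * cutoff1 (real k * (b - x) - 1)) \<longlonglongrightarrow> 1 * 1"
    using assms by (intro tendsto_mult filterlim_compose[OF cutoff1_tendsto] lim) auto
  then show ?thesis by (simp add: cutoff_def algebra_simps)
qed

lemma cutoff_mult_test:
  assumes f: "smooth f"
  shows "(\<lambda>x. f x * cutoff (Suc k) x) \<in> test"
  unfolding test_iff
proof (intro conjI exI allI impI)
  show "smooth (\<lambda>x. f x * cutoff (Suc k) x)"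
    unfolding cutoff_def by (intro smooth_mult f smooth_affine smooth_cutoff1)
  show "1 / real (Suc k) > 0" by simp
  fix x assume "x \<notin> {a + 1 / real (Suc k)..b - 1 / real (Suc k)}"
  then have "real (Suc k) * x + (- real (Suc k) * a - 1) \<le> 0 \<or> - real (Suc k) * x + (real (Suc k) * b - 1) \<le> 0"
    by (auto simp: field_simps not_le)
  then show "f x * cutoff (Suc k) x = 0"
    unfolding cutoff_def using cutoff1_eq_0 by auto
qed

lemma cutoff_integral_tendsto:
  assumes h: "integrable M h" and f: "smooth f"
  shows "(\<lambda>k. LINT t|M. h t * (f t * cutoff (Suc k) t)) \<longlonglongrightarrow> (LINT t|M. h t * f t)"
proof (rule integral_dominated_convergence)
  have hf: "integrable M (\<lambda>t. h t * f t)"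
    using integrable_mult_continuous[OF h smooth_continuous[OF f, of _ 0]] by simp
  show "integrable M (\<lambda>t. norm (h t * f t))" using hf by simp
  show "(\<lambda>t. h t * f t) \<in> borel_measurable M" using hf by (rule borel_measurable_integrable)
  show "(\<lambda>t. h t * (f t * cutoff (Suc k) t)) \<in> borel_measurable M" for k
    using smooth_continuous[OF test_smooth[OF cutoff_mult_test[OF f, of k]], of _ 0]
    by (intro borel_measurable_integrable integrable_mult_continuous[OF h]) simp
  show "AE t in M. (\<lambda>k. h t * (f t * cutoff (Suc k) t)) \<longlonglongrightarrow> h t * f t"
  proof (rule AE_I2)
    fix t assume "t \<in> space M"
    then have "(\<lambda>k. cutoff (Suc k) t) \<longlonglongrightarrow> 1"
      by (intro LIMSEQ_Suc cutoff_tendsto) simp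
    then have "(\<lambda>k. h t * (f t * cutoff (Suc k) t)) \<longlonglongrightarrow> h t * (f t * 1)"
      by (intro tendsto_intros)
    then show "(\<lambda>k. h t * (f t * cutoff (Suc k) t)) \<longlonglongrightarrow> h t * f t" by simp
  qed
  show "AE t in M. norm (h t * (f t * cutoff (Suc k) t)) \<le> norm (h t * f t)" for k
    using mult_left_mono[OF cutoff_norm_le, of "norm (h _ * f _)"] by (simp add: norm_mult mult.assoc)
qed

end

section \<open>Weak derivatives\<close>

lemma real_polynomial_function_poly:
  assumes "real_polynomial_function f"
  obtains p :: "complex poly" where "\<And>x. of_real (f x) = poly p (of_real x)"
proof -
  obtain c n where f: "f = (\<lambda>x. \<Sum>i\<le>n::nat. c i * x ^ i)"
    using real_polynomial_function_imp_sum[OF assms] by blast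
  have "of_real (f x) = poly (\<Sum>i\<le>n. monom (complex_of_real (c i)) i) (of_real x)" for x
    by (simp add: f poly_sum poly_monom)
  then show ?thesis using that by blast
qed

lemma funpow_pderiv_add: "(pderiv ^^ k) (p + q) = (pderiv ^^ k) p + (pderiv ^^ k) (q :: complex poly)"
  by (induction k) (simp_all add: pderiv_add)

lemma pchain_add: "pchain (p + q) k t = pchain p k t + pchain q k t"
  by (simp add: pchain_def funpow_pderiv_add)

lemma funpow_pderiv_monom: "(pderiv ^^ m) (monom c m) = [:c * fact m:]" for c :: complex
proof (induction m arbitrary: c)
  case (Suc m)
  then show ?case by (simp add: funpow_Suc_right pderiv_monom mult_ac del: funpow.simps)
qed (simp add: monom_0)

context bounded_interval
begin

lemma Weierstrass_complex:
  assumes f: "continuous_on {a..b} f" and e: "e > 0"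
  obtains p where "\<And>t. t \<in> {a..b} \<Longrightarrow> cmod (f t - pchain p 0 t) < e"
proof -
  have "continuous_on {a..b} (\<lambda>t. Re (f t))" "continuous_on {a..b} (\<lambda>t. Im (f t))"
    using f by (auto intro: continuous_intros)
  then obtain g h where g: "real_polynomial_function g" "\<And>t. t \<in> {a..b} \<Longrightarrow> \<bar>Re (f t) - g t\<bar> < e / 2"
    and h: "real_polynomial_function h" "\<And>t. t \<in> {a..b} \<Longrightarrow> \<bar>Im (f t) - h t\<bar> < e / 2"
    using Stone_Weierstrass_real_polynomial_function[OF compact_Icc, of _ _ _ "e / 2"] half_gt_zero[OF e] by metis
  obtain p :: "complex poly" where p: "\<And>x. of_real (g x) = poly p (of_real x)"
    by (rule real_polynomial_function_poly[OF g(1)], blast)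
  obtain q :: "complex poly" where q: "\<And>x. of_real (h x) = poly q (of_real x)"
    by (rule real_polynomial_function_poly[OF h(1)], blast)
  have "cmod (f t - pchain (p + [:\<i>:] * q) 0 t) < e" if t: "t \<in> {a..b}" for t
  proof -
    have "f t - pchain (p + [:\<i>:] * q) 0 t = Complex (Re (f t) - g t) (Im (f t) - h t)"
      by (simp add: pchain_0 complex_eq_iff flip: p q)
    then have "cmod (f t - pchain (p + [:\<i>:] * q) 0 t) \<le> \<bar>Re (f t) - g t\<bar> + \<bar>Im (f t) - h t\<bar>"
      using cmod_le[of "Complex (Re (f t) - g t) (Im (f t) - h t)"] by simp
    then show ?thesis using g(2)[OF t] h(2)[OF t] by linarith
  qed
  then show ?thesis using that by blast
qed

text \<open>
  A bounded measurable function is almost everywhere a limit of continuous functions; these may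
  be truncated at the bound and then replaced by polynomials.
\<close>

lemma bounded_approx_polynomials:
  assumes g: "g \<in> borel_measurable M" and B: "\<And>t. t \<in> {a<..<b} \<Longrightarrow> cmod (g t) \<le> B"
  obtains q :: "nat \<Rightarrow> complex poly" where
    "AE t in M. (\<lambda>n. pchain (q n) 0 t) \<longlonglongrightarrow> g t"
    "\<And>n t. t \<in> {a..b} \<Longrightarrow> cmod (pchain (q n) 0 t) \<le> \<bar>B\<bar> + 2"
proof -
  define B' where "B' = \<bar>B\<bar> + 1"
  have B': "B' > 0" by (simp add: B'_def)
  \<comment> \<open>radial retraction onto the disc of radius \<open>B'\<close>\<close>
  define c where "c z = z / of_real (max 1 (cmod z / B'))" for z :: complex
  have c_le: "cmod (c z) \<le> B'" for z
    using B' by (simp add: c_def norm_divide max_def field_simps)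
  have c_id: "c z = z" if "cmod z \<le> B'" for z
    using that B' by (simp add: c_def max_def field_simps)
  have c_cont: "continuous_on UNIV c"
    unfolding c_def[abs_def] using B' by (intro continuous_intros) auto
  have "g measurable_on {a<..<b}" using g by (simp add: measurable_on_iff_borel_measurable)
  then obtain N f where N: "negligible N" and f: "\<And>n. continuous_on UNIV (f n)"
    and lim: "\<And>x. x \<notin> N \<Longrightarrow> (\<lambda>n. f n x) \<longlonglongrightarrow> (if x \<in> {a<..<b} then g x else 0)"
    unfolding measurable_on_def by blast
  have "\<exists>p. \<forall>t\<in>{a..b}. cmod (c (f n t) - pchain p 0 t) < inverse (real (Suc n))" for n :: nat
  proof -
    have "continuous_on {a..b} (\<lambda>t. c (f n t))"
      by (rule continuous_on_compose2[OF c_cont continuous_on_subset[OF f]]) auto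
    then show ?thesis
      using Weierstrass_complex[of "\<lambda>t. c (f n t)" "inverse (real (Suc n))"]
      by (metis inverse_positive_iff_positive of_nat_0_less_iff zero_less_Suc)
  qed
  then obtain q where q: "\<And>n t. t \<in> {a..b} \<Longrightarrow> cmod (c (f n t) - pchain (q n) 0 t) < inverse (real (Suc n))"
    by metis
  show ?thesis
  proof
    have "AE t in lebesgue. t \<notin> N"
      using N by (simp add: negligible_iff_null_sets AE_not_in)
    then have "AE t in M. t \<notin> N"
      by (subst AE_restrict_space_iff) auto
    then show "AE t in M. (\<lambda>n. pchain (q n) 0 t) \<longlonglongrightarrow> g t"
    proof (rule AE_mp, intro AE_I2 impI)
      fix t assume "t \<in> space M" and tN: "t \<notin> N"
      then have t: "t \<in> {a<..<b}" by simp
      have "(\<lambda>n. f n t) \<longlonglongrightarrow> g t" using lim[OF tN] t by simp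
      then have "(\<lambda>n. c (f n t)) \<longlonglongrightarrow> c (g t)"
        using c_cont continuous_on_tendsto_compose[of UNIV c] by fastforce
      moreover have "c (g t) = g t" using B[OF t] by (intro c_id) (simp add: B'_def)
      moreover have "(\<lambda>n. c (f n t) - pchain (q n) 0 t) \<longlonglongrightarrow> 0"
        by (rule Lim_null_comparison[OF _ LIMSEQ_inverse_real_of_nat])
           (use q[of t] t in \<open>auto intro!: always_eventually less_imp_le\<close>)
      ultimately have "(\<lambda>n. c (f n t) - (c (f n t) - pchain (q n) 0 t)) \<longlonglongrightarrow> g t - 0"
        by (intro tendsto_diff) auto
      then show "(\<lambda>n. pchain (q n) 0 t) \<longlonglongrightarrow> g t" by simp
    qed
    show "cmod (pchain (q n) 0 t) \<le> \<bar>B\<bar> + 2" if t: "t \<in> {a..b}" for n t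
    proof -
      have "cmod (pchain (q n) 0 t) \<le> cmod (c (f n t)) + cmod (c (f n t) - pchain (q n) 0 t)"
        by (metis norm_minus_commute norm_triangle_sub)
      moreover have "inverse (real (Suc n)) \<le> 1" by (simp add: field_simps)
      ultimately show ?thesis using c_le[of "f n t"] q[OF t, of n] unfolding B'_def by linarith
    qed
  qed
qed

text \<open>
  Approximating the phase \<open>cnj h / |h|\<close> boundedly by polynomials shows that the integral of \<open>|h|\<close>
  is zero.
\<close>

lemma AE_zero_if_orthogonal_to_polynomials:
  assumes h: "integrable M h" and orth: "\<And>p. (LINT t|M. h t * pchain p 0 t) = 0"
  shows "AE t in M. h t = 0"
proof -
  define g where "g t = cnj (h t) / of_real (cmod (h t))" for t
  have hm: "h \<in> borel_measurable M" using h by simp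
  have gm: "g \<in> borel_measurable M"
  proof -
    have "(\<lambda>t. cnj (h t)) \<in> borel_measurable M"
      by (rule borel_measurable_integrable) (use h in simp)
    moreover have "(\<lambda>t. complex_of_real (cmod (h t))) \<in> borel_measurable M"
      by (rule borel_measurable_integrable) (use h in simp)
    ultimately show ?thesis unfolding g_def[abs_def] by (rule borel_measurable_divide)
  qed
  have hg: "h t * g t = of_real (cmod (h t))" for t
  proof (cases "h t = 0")
    case False
    have "h t * g t = (of_real (cmod (h t)))\<^sup>2 / of_real (cmod (h t))"
      unfolding g_def times_divide_eq_right complex_norm_square[symmetric] by simp
    then show ?thesis using False by (simp add: power2_eq_square)
  qed (simp add: g_def)
  have g1: "cmod (g t) \<le> 1" for t by (simp add: g_def norm_divide)
  from bounded_approx_polynomials[OF gm g1] obtain q where q: "AE t in M. (\<lambda>n. pchain (q n) 0 t) \<longlonglongrightarrow> g t"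
    "\<And>n t. t \<in> {a..b} \<Longrightarrow> cmod (pchain (q n) 0 t) \<le> \<bar>1\<bar> + 2"
    by blast
  have "(\<lambda>n. LINT t|M. h t * pchain (q n) 0 t) \<longlonglongrightarrow> (LINT t|M. h t * g t)"
  proof (rule integral_dominated_convergence)
    show "(\<lambda>t. h t * g t) \<in> borel_measurable M" using hm gm by (rule borel_measurable_times)
    show "(\<lambda>t. h t * pchain (q n) 0 t) \<in> borel_measurable M" for n
      using integrable_mult_continuous[OF h pchain_continuous] by (rule borel_measurable_integrable)
    show "integrable M (\<lambda>t. 3 * norm (h t))" using h by simp
    show "AE t in M. (\<lambda>n. h t * pchain (q n) 0 t) \<longlonglongrightarrow> h t * g t"
      using q(1) by eventually_elim (intro tendsto_intros)
    show "AE t in M. norm (h t * pchain (q n) 0 t) \<le> 3 * norm (h t)" for n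
    proof (rule AE_I2)
      fix t assume "t \<in> space M"
      then show "norm (h t * pchain (q n) 0 t) \<le> 3 * norm (h t)"
        using mult_left_mono[OF q(2)[of t n], of "norm (h t)"] by (simp add: norm_mult mult.commute)
    qed
  qed
  then have "(\<lambda>n. 0) \<longlonglongrightarrow> (LINT t|M. h t * g t)" unfolding orth .
  from LIMSEQ_unique[OF this tendsto_const] have "(LINT t|M. h t * g t) = 0" .
  then have "complex_of_real (LINT t|M. cmod (h t)) = 0" unfolding hg by simp
  then have "(LINT t|M. norm (h t)) = 0" by simp
  then show ?thesis
    using integral_nonneg_eq_0_iff_AE[of M "\<lambda>t. norm (h t)"] h by simp
qed

text \<open>
  The fundamental lemma of the calculus of variations. Polynomials multiplied by cutoffs are
  test functions, and in the limit the cutoffs disappear.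
\<close>

lemma AE_zero_if_orthogonal_to_test:
  assumes h: "integrable M h" and orth: "\<And>\<phi>. \<phi> \<in> test \<Longrightarrow> (LINT t|M. h t * \<phi> t) = 0"
  shows "AE t in M. h t = 0"
proof (rule AE_zero_if_orthogonal_to_polynomials[OF h])
  fix p
  have "(\<lambda>k. LINT t|M. h t * (pchain p 0 t * cutoff (Suc k) t)) \<longlonglongrightarrow> (LINT t|M. h t * pchain p 0 t)"
    by (rule cutoff_integral_tendsto[OF h smooth_pchain])
  moreover have "(LINT t|M. h t * (pchain p 0 t * cutoff (Suc k) t)) = 0" for k
    by (rule orth[OF cutoff_mult_test[OF smooth_pchain]])
  ultimately have "(\<lambda>k. 0) \<longlonglongrightarrow> (LINT t|M. h t * pchain p 0 t)" by simp
  from LIMSEQ_unique[OF this tendsto_const] show "(LINT t|M. h t * pchain p 0 t) = 0" .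
qed

lemma test_continuous: "\<phi> \<in> test \<Longrightarrow> continuous_on S (nth_deriv k \<phi>)"
  using smooth_continuous test_smooth by blast

lemma test_integral_one:
  obtains \<psi> where "\<psi> \<in> test" "integral\<^sup>L M \<psi> = 1"
proof -
  have sm: "smooth (\<lambda>t. 1)" using smooth_pchain[of 1 0] by (simp add: pchain_0)
  have "(\<lambda>k. LINT t|M. 1 * (1 * cutoff (Suc k) t)) \<longlonglongrightarrow> (LINT t|M. 1 * (1 :: complex))"
    by (rule cutoff_integral_tendsto[OF integrable_const_M sm])
  moreover have "(LINT t|M. 1 * (1 :: complex)) \<noteq> 0"
    using ab by (simp add: measure_restrict_space)
  ultimately have "\<forall>\<^sub>F k in sequentially. (LINT t|M. 1 * (1 * cutoff (Suc k) t)) \<noteq> 0"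
    by (rule tendsto_imp_eventually_ne)
  then obtain k where k: "(LINT t|M. cutoff (Suc k) t) \<noteq> 0"
    using eventually_happens'[OF sequentially_bot] by force
  show ?thesis
  proof
    define d where "d = 1 / (LINT t|M. cutoff (Suc k) t)"
    show "(\<lambda>t. d * cutoff (Suc k) t) \<in> test"
      using cutoff_mult_test[OF smooth_cmult[OF sm, of d]] by simp
    show "(LINT t|M. d * cutoff (Suc k) t) = 1" using k by (simp add: d_def)
  qed
qed

lemma test_antiderivative:
  assumes \<theta>: "\<theta> \<in> test" and int: "integral\<^sup>L M \<theta> = 0"
  obtains \<phi> where "\<phi> \<in> test" "\<And>x. (\<phi> has_vector_derivative \<theta> x) (at x)"
proof -
  obtain e where e: "e > 0" "\<And>x. x \<notin> {a + e..b - e} \<Longrightarrow> \<theta> x = 0" and sm: "smooth \<theta>"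
    using \<theta> by (auto simp: test_iff)
  have cont: "continuous_on S \<theta>" for S using test_continuous[OF \<theta>, of S 0] by simp
  \<comment> \<open>The base point lies strictly to the left of \<open>a\<close>, so that the derivative at \<open>a\<close> is two-sided.\<close>
  define \<phi> where "\<phi> x = integral {a - 1..x} \<theta>" for x
  have restr: "integral S \<theta> = integral {a + e..b - e} \<theta>" if "{a + e..b - e} \<subseteq> S" for S
  proof -
    have "\<theta> = (\<lambda>x. if x \<in> {a + e..b - e} then \<theta> x else 0)" using e(2) by auto
    then have "integral S \<theta> = integral S (\<lambda>x. if x \<in> {a + e..b - e} then \<theta> x else 0)" by simp
    also have "\<dots> = integral ({a + e..b - e} \<inter> S) \<theta>" by (rule integral_restrict_Int)
    finally show ?thesis using that by (simp add: Int_absorb2)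
  qed
  have "integral\<^sup>L M \<theta> = integral {a<..<b} \<theta>"
    by (rule lebesgue_integral_eq_integral[OF l2_integrable[OF continuous_l2[OF cont]]]) simp
  then have zero: "integral {a + e..b - e} \<theta> = 0"
    using int restr[of "{a<..<b}"] e(1) by (simp add: subset_eq)
  have \<phi>0: "\<phi> x = 0" if "x \<notin> {a + e..b - e}" for x
  proof (cases "x < a + e")
    case True
    have "integral {a - 1..x} \<theta> = integral {a - 1..x} (\<lambda>x. 0)"
      by (rule integral_cong) (use True in \<open>auto intro!: e(2)\<close>)
    then show ?thesis by (simp add: \<phi>_def)
  next
    case False
    then have "{a + e..b - e} \<subseteq> {a - 1..x}" using that e(1) by auto
    then show ?thesis unfolding \<phi>_def using restr zero by simp
  qed
  have deriv: "(\<phi> has_vector_derivative \<theta> x) (at x)" for x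
  proof (cases "x < a")
    case True
    have "(\<phi> has_vector_derivative 0) (at x)"
      by (rule has_vector_derivative_transform_within_open[OF has_vector_derivative_const open_lessThan[of a]])
         (use True e(1) in \<open>auto intro!: \<phi>0[symmetric]\<close>)
    then show ?thesis using True e by simp
  next
    case False
    have "((\<lambda>u. integral {a - 1..u} \<theta>) has_vector_derivative \<theta> x) (at x within {a - 1..x + 1})"
      using False by (intro integral_has_vector_derivative cont) auto
    moreover have "at x within {a - 1..x + 1} = at x"
      using False by (intro at_within_interior) (simp add: interior_atLeastAtMost_real)
    ultimately show ?thesis by (simp add: \<phi>_def[abs_def])
  qed
  have "\<phi> \<in> test"
    unfolding test_iff using smooth_antiderivative[OF sm deriv] \<phi>0 e(1) by blast
  then show ?thesis using that deriv by blast
qed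

lemma chain_test_by_parts:
  assumes "chain m F" "\<phi> \<in> test" "k \<le> m"
  shows "(LINT t|M. F 0 t * nth_deriv k \<phi> t) = (-1) ^ k * (LINT t|M. F k t * \<phi> t)"
proof -
  have "(LINT t|M. nth_deriv (0 + k) \<phi> t * F 0 t) = (-1) ^ k * (LINT t|M. nth_deriv 0 \<phi> t * F (0 + k) t)"
    by (subst chain_by_parts[OF chain_smooth[OF test_smooth[OF assms(2)], of m] assms(1)])
       (use assms(3) in \<open>simp_all add: test_nth_deriv_zero[OF assms(2)]\<close>)
  then show ?thesis by (simp add: mult.commute)
qed

text \<open>
  A distribution whose derivative of order \<open>m\<close> vanishes is a polynomial of degree less than
  \<open>m\<close>. In the induction step, a test function with integral zero is the derivative of a test
  function, so the derivative of order \<open>m\<close> acts on test functions as a multiple of the integral;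
  subtracting the corresponding monomial makes it vanish.
\<close>

lemma orthogonal_to_test_derivatives:
  assumes "integrable M g" "\<And>\<phi>. \<phi> \<in> test \<Longrightarrow> (LINT t|M. g t * nth_deriv m \<phi> t) = 0"
  shows "\<exists>p. (pderiv ^^ m) p = 0 \<and> (AE t in M. g t = pchain p 0 t)"
  using assms
proof (induction m arbitrary: g)
  case 0
  then have "AE t in M. g t = 0" by (intro AE_zero_if_orthogonal_to_test) auto
  then show ?case by (intro exI[of _ 0]) (simp add: pchain_0)
next
  case (Suc m)
  obtain \<psi> where \<psi>: "\<psi> \<in> test" "integral\<^sup>L M \<psi> = 1" by (rule test_integral_one)
  define c where "c = (LINT t|M. g t * nth_deriv m \<psi> t)"
  define p1 where "p1 = monom ((-1) ^ m * c / fact m) m"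
  have p1: "(pderiv ^^ m) p1 = [:(-1) ^ m * c:]"
    unfolding p1_def funpow_pderiv_monom by simp
  note test_int = integrable_mult_continuous[OF _ test_continuous]
  have key: "(LINT t|M. g t * nth_deriv m \<phi> t) = c * integral\<^sup>L M \<phi>" if \<phi>: "\<phi> \<in> test" for \<phi>
  proof -
    define s where "s = integral\<^sup>L M \<phi>"
    have sm: "smooth \<phi>" "smooth \<psi>" using \<phi> \<psi> test_smooth by blast+
    have tint: "integrable M \<phi>" "integrable M \<psi>"
      using l2_integrable[OF continuous_l2[OF test_continuous[OF \<phi>, of _ 0]]]
        l2_integrable[OF continuous_l2[OF test_continuous[OF \<psi>(1), of _ 0]]] by simp_all
    have \<theta>: "(\<lambda>t. \<phi> t - s * \<psi> t) \<in> test"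
    proof -
      obtain e1 e2 where e: "e1 > 0" "e2 > 0" "\<And>x. x \<notin> {a + e1..b - e1} \<Longrightarrow> \<phi> x = 0"
        "\<And>x. x \<notin> {a + e2..b - e2} \<Longrightarrow> \<psi> x = 0"
        using \<phi> \<psi>(1) unfolding test_iff by metis
      have "\<phi> x - s * \<psi> x = 0" if "x \<notin> {a + min e1 e2..b - min e1 e2}" for x
      proof -
        have "x \<notin> {a + e1..b - e1}" "x \<notin> {a + e2..b - e2}" using that by auto
        then show ?thesis using e(3,4) by simp
      qed
      moreover have "smooth (\<lambda>t. \<phi> t - s * \<psi> t)"
        using smooth_add[OF sm(1) smooth_cmult[OF sm(2), of "-s"]] by simp
      moreover have "min e1 e2 > 0" using e by simp
      ultimately show ?thesis unfolding test_iff by blast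
    qed
    have "(LINT t|M. \<phi> t - s * \<psi> t) = 0"
      using \<psi>(2) tint by (simp add: s_def)
    from test_antiderivative[OF \<theta> this] obtain \<eta> where \<eta>: "\<eta> \<in> test" "\<And>x. (\<eta> has_vector_derivative (\<phi> x - s * \<psi> x)) (at x)"
      by blast
    have "nth_deriv (Suc m) \<eta> = (\<lambda>t. nth_deriv m \<phi> t - s * nth_deriv m \<psi> t)"
      using nth_deriv_Suc_eq[OF \<eta>(2)] nth_deriv_diff_cmult[OF sm] by simp
    then have "0 = (LINT t|M. g t * nth_deriv m \<phi> t - s * (g t * nth_deriv m \<psi> t))"
      using Suc.prems(2)[OF \<eta>(1)] by (simp add: algebra_simps)
    also have "\<dots> = (LINT t|M. g t * nth_deriv m \<phi> t) - s * c"
      using test_int[OF Suc.prems(1) \<phi>] test_int[OF Suc.prems(1) \<psi>(1)] by (simp add: c_def)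
    finally show ?thesis by (simp add: s_def)
  qed
  have p1_int: "integrable M (pchain p1 0)"
    by (rule l2_integrable[OF continuous_l2[OF pchain_continuous]])
  have "\<exists>p. (pderiv ^^ m) p = 0 \<and> (AE t in M. g t - pchain p1 0 t = pchain p 0 t)"
  proof (rule Suc.IH)
    show "integrable M (\<lambda>t. g t - pchain p1 0 t)" using Suc.prems(1) p1_int by simp
    fix \<phi> assume \<phi>: "\<phi> \<in> test"
    have "(LINT t|M. (g t - pchain p1 0 t) * nth_deriv m \<phi> t) =
        (LINT t|M. g t * nth_deriv m \<phi> t) - (LINT t|M. pchain p1 0 t * nth_deriv m \<phi> t)"
      using test_int[OF Suc.prems(1) \<phi>] test_int[OF p1_int \<phi>] by (simp add: left_diff_distrib)
    also have "(LINT t|M. pchain p1 0 t * nth_deriv m \<phi> t) = (-1) ^ m * (LINT t|M. pchain p1 m t * \<phi> t)"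
      by (rule chain_test_by_parts[OF chain_pchain \<phi> order_refl])
    also have "pchain p1 m = (\<lambda>t. (-1) ^ m * c)"
      by (simp add: pchain_def[abs_def] p1)
    also have "(-1) ^ m * (LINT t|M. (-1) ^ m * c * \<phi> t) = c * integral\<^sup>L M \<phi>"
      by (simp flip: power_add)
    finally show "(LINT t|M. (g t - pchain p1 0 t) * nth_deriv m \<phi> t) = 0"
      using key[OF \<phi>] by simp
  qed
  then obtain p2 where p2: "(pderiv ^^ m) p2 = 0" "AE t in M. g t - pchain p1 0 t = pchain p2 0 t"
    by blast
  have "(pderiv ^^ Suc m) (p1 + p2) = 0" by (simp add: funpow_pderiv_add p1 p2 pderiv_pCons)
  moreover have "AE t in M. g t = pchain (p1 + p2) 0 t"
    using p2(2) by eventually_elim (simp add: pchain_add algebra_simps)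
  ultimately show ?case by blast
qed

lemma weak_deriv_l2: "weak_deriv a b k f g \<Longrightarrow> f \<in> l2 M \<and> g \<in> l2 M"
  by (simp add: weak_deriv_def)

lemma l2_AE_cong:
  assumes "f \<in> l2 M" "g \<in> l2 M" "AE t in M. f t = g t" "continuous_on {a..b} h"
  shows "(LINT t|M. f t * h t) = (LINT t|M. g t * h t)"
proof (rule integral_cong_AE)
  show "(\<lambda>t. f t * h t) \<in> borel_measurable M" "(\<lambda>t. g t * h t) \<in> borel_measurable M"
    using integrable_mult_continuous[OF l2_integrable[OF assms(1)] assms(4)]
      integrable_mult_continuous[OF l2_integrable[OF assms(2)] assms(4)] by simp_all
  show "AE t in M. f t * h t = g t * h t" using assms(3) by eventually_elim simp
qed

lemma weak_deriv_chain:
  assumes F: "chain m F" and "k \<le> m" and f: "f \<in> l2 M" "AE t in M. f t = F 0 t"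
  shows "weak_deriv a b k f (F k)"
  unfolding weak_deriv_def
proof (intro conjI ballI)
  show "f \<in> l2 M" "F k \<in> l2 M" using f chain_l2[OF F] \<open>k \<le> m\<close> by auto
  fix \<phi> assume \<phi>: "\<phi> \<in> test"
  have "(LINT t|M. f t * nth_deriv k \<phi> t) = (LINT t|M. F 0 t * nth_deriv k \<phi> t)"
    by (intro l2_AE_cong f chain_l2[OF F] test_continuous[OF \<phi>]) simp
  then show "(LINT t|M. f t * nth_deriv k \<phi> t) = (-1) ^ k * (LINT t|M. F k t * \<phi> t)"
    using chain_test_by_parts[OF F \<phi> \<open>k \<le> m\<close>] by simp
qed

lemma weak_deriv_unique:
  assumes "weak_deriv a b k f g" "weak_deriv a b k f h"
  shows "AE t in M. g t = h t"
proof -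
  have gh: "g \<in> l2 M" "h \<in> l2 M" using assms weak_deriv_l2 by blast+
  have "AE t in M. g t - h t = 0"
  proof (rule AE_zero_if_orthogonal_to_test)
    show "integrable M (\<lambda>t. g t - h t)" using gh by (intro Bochner_Integration.integrable_diff l2_integrable)
    fix \<phi> assume \<phi>: "\<phi> \<in> test"
    have "(LINT t|M. g t * \<phi> t) = (LINT t|M. h t * \<phi> t)"
      using assms \<phi> by (simp add: weak_deriv_def)
    then show "(LINT t|M. (g t - h t) * \<phi> t) = 0"
      using integrable_mult_continuous[OF l2_integrable[OF gh(1)] test_continuous[OF \<phi>, of _ 0]]
        integrable_mult_continuous[OF l2_integrable[OF gh(2)] test_continuous[OF \<phi>, of _ 0]]
      by (simp add: left_diff_distrib)
  qed
  then show ?thesis by simp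
qed

lemma chain_iterated_J:
  assumes "w \<in> l2 M"
  shows "chain m (\<lambda>k. (J ^^ (m - k)) w)"
  unfolding chain_def
proof (intro conjI allI impI ballI)
  fix k x assume "k < m" "x \<in> {a..b}"
  then have "m - k = Suc (m - Suc k)" by simp
  then show "(J ^^ (m - k)) w x = (J ^^ (m - k)) w a + J ((J ^^ (m - Suc k)) w) x"
    by simp
qed (simp add: assms)

text \<open>
  An element of \<open>L\<^sup>2\<close> with a weak derivative \<open>w\<close> of order \<open>m\<close> differs from the iterated integral
  of \<open>w\<close> by a polynomial of degree less than \<open>m\<close>, hence has all the weak derivatives in between.
\<close>

lemma weak_deriv_obtains_chain:
  assumes "weak_deriv a b m f w"
  obtains F where "chain m F" "F m = w" "AE t in M. f t = F 0 t"
proof -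
  have f: "f \<in> l2 M" and w: "w \<in> l2 M" using assms weak_deriv_l2 by blast+
  define G where "G k = (J ^^ (m - k)) w" for k
  have G: "chain m G" "G m = w" using chain_iterated_J[OF w] by (simp_all add: G_def[abs_def])
  have G0: "G 0 \<in> l2 M" using chain_l2[OF G(1)] by simp
  have fi: "integrable M f" and Gi: "integrable M (G 0)" using f G0 l2_integrable by blast+
  have "\<exists>p. (pderiv ^^ m) p = 0 \<and> (AE t in M. f t - G 0 t = pchain p 0 t)"
  proof (rule orthogonal_to_test_derivatives)
    show "integrable M (\<lambda>t. f t - G 0 t)" using fi Gi by simp
    fix \<phi> assume \<phi>: "\<phi> \<in> test"
    have "(LINT t|M. f t * nth_deriv m \<phi> t) = (LINT t|M. G 0 t * nth_deriv m \<phi> t)"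
      using assms \<phi> chain_test_by_parts[OF G(1) \<phi> order_refl] by (simp add: weak_deriv_def G(2))
    then show "(LINT t|M. (f t - G 0 t) * nth_deriv m \<phi> t) = 0"
      using integrable_mult_continuous[OF fi test_continuous[OF \<phi>]]
        integrable_mult_continuous[OF Gi test_continuous[OF \<phi>]]
      by (simp add: left_diff_distrib)
  qed
  then obtain p where p: "(pderiv ^^ m) p = 0" "AE t in M. f t - G 0 t = pchain p 0 t" by blast
  show ?thesis
  proof
    show "chain m (\<lambda>k t. G k t + pchain p k t)" by (intro chain_add G chain_pchain)
    show "(\<lambda>t. G m t + pchain p m t) = w" by (simp add: G(2) pchain_def p)
    show "AE t in M. f t = G 0 t + pchain p 0 t" using p(2) by eventually_elim (simp add: algebra_simps)
  qed
qed

text \<open>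
  The indefinite integral of \<open>|f - g|\<close> vanishes identically, and its derivative is \<open>|f - g|\<close>
  everywhere on the closed interval, end points included.
\<close>

lemma continuous_AE_eq:
  fixes f g :: "real \<Rightarrow> complex"
  assumes f: "continuous_on {a..b} f" and g: "continuous_on {a..b} g"
    and eq: "AE t in M. f t = g t" and x: "x \<in> {a..b}"
  shows "f x = g x"
proof -
  define h where "h t = complex_of_real (cmod (f t - g t))" for t
  have h: "continuous_on {a..b} h" unfolding h_def[abs_def] by (intro continuous_intros f g)
  have "J h y = 0" if y: "y \<in> {a..b}" for y
  proof -
    have hi: "integrable M h" by (rule l2_integrable[OF continuous_l2[OF h]])
    have "J h y = (LINT t|M. (if t \<le> y then h t else 0))" by (rule J_eq_LINT_le(1)[OF hi y])
    also have "\<dots> = (LINT t|M. 0)"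
      by (rule integral_cong_AE[OF borel_measurable_integrable[OF J_eq_LINT_le(2)[OF hi y]]])
         (use eq in \<open>auto simp: h_def elim!: eventually_mono\<close>)
    finally show ?thesis by simp
  qed
  then have zero: "\<And>y. y \<in> {a..b} \<Longrightarrow> integral {a..y} h = 0" by (simp add: J_def)
  have "((\<lambda>u. integral {a..u} h) has_vector_derivative h x) (at x within {a..b})"
    by (rule integral_has_vector_derivative[OF h x])
  then have "((\<lambda>u. 0) has_vector_derivative h x) (at x within {a..b})"
    by (rule has_vector_derivative_transform[OF x, rotated]) (simp add: zero)
  moreover have "((\<lambda>u. 0 :: complex) has_vector_derivative 0) (at x within {a..b})" by simp
  ultimately have "h x = 0"
    using vector_derivative_unique_within[of x "{a..b}" "\<lambda>u. 0 :: complex" "h x" 0] x ab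
    by (auto simp: trivial_limit_within islimpt_Icc)
  then show ?thesis by (simp add: h_def)
qed

text \<open>
  Weak derivatives are unique almost everywhere, and a continuous representative is unique on
  the closed interval; so the definite description picks the values of the chain.
\<close>

lemma deriv_value_chain:
  assumes F: "chain m F" and k: "k < m" and f: "f \<in> l2 M" "AE t in M. f t = F 0 t"
    and c: "c \<in> {a..b}"
  shows "deriv_value a b k f c = F k c"
  unfolding deriv_value_def
proof (rule the_equality)
  have wd: "weak_deriv a b k f (F k)" using weak_deriv_chain[OF F _ f, of k] k by simp
  show "\<exists>g. continuous_on {a..b} g \<and> weak_deriv a b k f g \<and> g c = F k c"
    using wd chain_continuous[OF F k] by blast
  fix y assume "\<exists>g. continuous_on {a..b} g \<and> weak_deriv a b k f g \<and> g c = y"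
  then obtain g where g: "continuous_on {a..b} g" "weak_deriv a b k f g" "g c = y" by blast
  have "g c = F k c"
    by (rule continuous_AE_eq[OF g(1) chain_continuous[OF F k] weak_deriv_unique[OF g(2) wd] c])
  then show "y = F k c" using g by simp
qed

end

section \<open>Taylor polynomials and interpolation\<close>

lemma funpow_pderiv_eq_0: "degree p < k \<Longrightarrow> (pderiv ^^ k) (p :: complex poly) = 0"
proof -
  assume "degree p < k"
  then obtain j where k: "k = Suc (degree p + j)" using less_imp_Suc_add by blast
  have "degree ((pderiv ^^ (degree p + j)) p) = 0" by (simp add: degree_funpow_pderiv)
  then show ?thesis unfolding k by (auto elim!: degree_eq_zeroE simp: pderiv_pCons)
qed

lemma pchain_0_poly [simp]: "pchain 0 k t = 0"
proof -
  have "(pderiv ^^ k) (0 :: complex poly) = 0" by (induction k) auto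
  then show ?thesis by (simp add: pchain_def)
qed

lemma funpow_pderiv_smult: "(pderiv ^^ k) (Polynomial.smult c p) = Polynomial.smult (c :: complex) ((pderiv ^^ k) p)"
  by (induction k) (simp_all add: pderiv_smult)

lemma pchain_smult: "pchain (Polynomial.smult c p) k t = c * pchain p k t"
  by (simp add: pchain_def funpow_pderiv_smult)

lemma pchain_sum: "pchain (\<Sum>i\<in>I. p i) k t = (\<Sum>i\<in>I. pchain (p i) k t)"
  by (induction I rule: infinite_finite_induct) (simp_all add: pchain_add)

lemma pchain_Suc: "pchain p (Suc k) = pchain (pderiv p) k"
  by (simp add: pchain_def[abs_def] funpow_Suc_right del: funpow.simps)

text \<open>
  A factor \<open>(x - c)\<^sup>j\<close> makes the derivatives of order less than \<open>j\<close> vanish at \<open>c\<close> and leaves the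
  cofactor in the derivative of order \<open>j\<close>.
\<close>

lemma pchain_zero_of_order:
  shows "k < j \<Longrightarrow> pchain ([:- of_real c, 1:] ^ j * q) k c = 0"
    and "pchain ([:- of_real c, 1:] ^ j * q) j c = fact j * poly q (of_real c)"
proof -
  have step: "pderiv ([:- of_real c, 1:] ^ Suc j * q) =
      [:- of_real c, 1:] ^ j * (Polynomial.smult (of_nat (Suc j)) q + [:- of_real c, 1:] * pderiv q)" for j and q :: "complex poly"
  proof -
    have 1: "pderiv ([:- of_real c, 1:] ^ Suc j) = Polynomial.smult (of_nat (Suc j)) ([:- of_real c :: complex, 1:] ^ j)"
      by (simp add: pderiv_power_Suc pderiv_pCons del: power_Suc of_nat_Suc)
    have 2: "C ^ Suc j * q' + q * Polynomial.smult d (C ^ j) = C ^ j * (Polynomial.smult d q + C * q')"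
      for C q' :: "complex poly" and d by (simp add: algebra_simps)
    show ?thesis unfolding pderiv_mult 1 by (rule 2)
  qed
  have "(k < j \<longrightarrow> pchain ([:- of_real c, 1:] ^ j * q) k c = 0) \<and>
      pchain ([:- of_real c, 1:] ^ j * q) j c = fact j * poly q (of_real c)"
  proof (induction j arbitrary: k q)
    case 0
    then show ?case by (simp add: pchain_0)
  next
    case (Suc j)
    define X where "X = Polynomial.smult (of_nat (Suc j)) q + [:- of_real c, 1:] * pderiv q"
    have X: "pderiv ([:- of_real c, 1:] ^ Suc j * q) = [:- of_real c, 1:] ^ j * X"
      unfolding X_def by (rule step)
    have "pchain ([:- of_real c, 1:] ^ Suc j * q) k c = 0" if "k < Suc j"
    proof (cases k)
      case 0
      then show ?thesis by (simp add: pchain_0)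
    next
      case k: (Suc k')
      then show ?thesis using Suc.IH[of k' X] that unfolding k pchain_Suc X by simp
    qed
    moreover have "pchain ([:- of_real c, 1:] ^ Suc j * q) (Suc j) c = fact (Suc j) * poly q (of_real c)"
    proof -
      have "poly X (of_real c) = of_nat (Suc j) * poly q (of_real c)" by (simp add: X_def)
      then show ?thesis unfolding pchain_Suc X using Suc.IH[of 0 X] by (simp add: algebra_simps)
    qed
    ultimately show ?case by simp
  qed
  then show "k < j \<Longrightarrow> pchain ([:- of_real c, 1:] ^ j * q) k c = 0"
    "pchain ([:- of_real c, 1:] ^ j * q) j c = fact j * poly q (of_real c)" by auto
qed

definition taylor :: "real \<Rightarrow> (nat \<Rightarrow> complex) \<Rightarrow> nat \<Rightarrow> complex poly" where
  "taylor c \<alpha> m = (\<Sum>j<m. Polynomial.smult (\<alpha> j / fact j) ([:- of_real c, 1:] ^ j))"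

lemma pderiv_sum': "pderiv (\<Sum>i\<in>I. p i) = (\<Sum>i\<in>I. pderiv (p i :: complex poly))"
  by (induction I rule: infinite_finite_induct) (simp_all add: pderiv_add)

lemma pderiv_taylor: "pderiv (taylor c \<alpha> m) = taylor c (\<lambda>j. \<alpha> (Suc j)) (m - 1)"
proof (cases m)
  case (Suc r)
  have "pderiv (Polynomial.smult (\<alpha> (Suc j) / fact (Suc j)) ([:- of_real c, 1:] ^ Suc j)) =
      Polynomial.smult (\<alpha> (Suc j) / fact j) ([:- of_real c, 1:] ^ j)" for j
    by (simp add: pderiv_smult pderiv_power_Suc pderiv_pCons del: power_Suc of_nat_Suc)
  then show ?thesis
    unfolding taylor_def Suc sum.lessThan_Suc_shift pderiv_add pderiv_sum' by simp
qed (simp add: taylor_def)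

lemma funpow_pderiv_taylor: "(pderiv ^^ k) (taylor c \<alpha> m) = taylor c (\<lambda>j. \<alpha> (k + j)) (m - k)"
  by (induction k) (simp_all add: pderiv_taylor)

lemma pchain_taylor:
  "pchain (taylor c \<alpha> m) k t = (\<Sum>j<m - k. \<alpha> (k + j) / fact j * of_real (t - c) ^ j)"
  unfolding pchain_def funpow_pderiv_taylor by (simp add: taylor_def poly_sum poly_power)

lemma pchain_taylor_at: "k < m \<Longrightarrow> pchain (taylor c \<alpha> m) k c = \<alpha> k"
  by (simp add: pchain_taylor power_0_left if_distrib sum.delta cong: if_cong)

lemma funpow_pderiv_taylor_eq_0: "(pderiv ^^ m) (taylor c \<alpha> m) = 0"
  unfolding funpow_pderiv_taylor by (simp add: taylor_def)

lemma funpow_pderiv_map_cnj: "(pderiv ^^ k) (map_poly cnj p) = map_poly cnj ((pderiv ^^ k) p)"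
proof -
  have "pderiv (map_poly cnj q) = map_poly cnj (pderiv q)" for q
    by (rule poly_eqI) (simp add: coeff_pderiv coeff_map_poly)
  then show ?thesis by (induction k) simp_all
qed

lemma cnj_pchain: "cnj (pchain p k t) = pchain (map_poly cnj p) k t"
  by (simp add: pchain_def funpow_pderiv_map_cnj)

text \<open>
  Starting from a Taylor polynomial at \<open>c\<close>, the values at \<open>d\<close> are corrected one order at a time by
  multiples of \<open>(x - c)\<^sup>m (x - d)\<^sup>j\<close>, which changes neither the values at \<open>c\<close> nor those of lower order
  at \<open>d\<close>. Only \<open>j < m\<close> occurs, whence the bound on the degree.
\<close>

lemma Hermite_interpolation:
  assumes "c \<noteq> d"
  obtains p where "\<And>k. k < m \<Longrightarrow> pchain p k c = \<alpha> k" "\<And>k. k < m \<Longrightarrow> pchain p k d = \<beta> k"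
    "(pderiv ^^ (m + m)) p = 0"
proof -
  have "\<exists>p. (\<forall>k<m. pchain p k c = \<alpha> k) \<and> (\<forall>k<j. pchain p k d = \<beta> k) \<and> (pderiv ^^ (m + m)) p = 0"
    if "j \<le> m" for j
    using that
  proof (induction j)
    case 0
    have "(pderiv ^^ (m + m)) (taylor c \<alpha> m) = 0"
      unfolding funpow_pderiv_taylor by (simp add: taylor_def)
    then show ?case by (intro exI[of _ "taylor c \<alpha> m"]) (simp add: pchain_taylor_at)
  next
    case (Suc j)
    then obtain p where p: "\<forall>k<m. pchain p k c = \<alpha> k" "\<forall>k<j. pchain p k d = \<beta> k"
      and p0: "(pderiv ^^ (m + m)) p = 0" by auto
    let ?C = "[:- of_real c, 1:] :: complex poly" and ?D = "[:- of_real d, 1:] :: complex poly"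
    define w where "w = ?C ^ m * ?D ^ j"
    have wc: "pchain w k c = 0" if "k < m" for k
      unfolding w_def by (rule pchain_zero_of_order(1)[OF that])
    have w': "w = ?D ^ j * ?C ^ m" by (simp add: w_def mult.commute)
    have wd: "pchain w k d = 0" if "k < j" for k
      unfolding w' by (rule pchain_zero_of_order(1)[OF that])
    have wj: "pchain w j d \<noteq> 0"
      unfolding w' pchain_zero_of_order(2) using assms by (simp add: poly_power)
    let ?p = "p + Polynomial.smult ((\<beta> j - pchain p j d) / pchain w j d) w"
    have "\<forall>k<m. pchain ?p k c = \<alpha> k" using p(1) wc by (simp add: pchain_add pchain_smult)
    moreover have "\<forall>k<Suc j. pchain ?p k d = \<beta> k"
      using p(2) wd wj by (simp add: pchain_add pchain_smult less_Suc_eq)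
    moreover have "(pderiv ^^ (m + m)) ?p = 0"
    proof -
      have "degree w \<le> m + j"
        unfolding w_def by (rule order_trans[OF degree_mult_le]) (simp add: degree_linear_power)
      then have "(pderiv ^^ (m + m)) w = 0" using Suc.prems by (intro funpow_pderiv_eq_0) simp
      then show ?thesis
        using p0 by (simp add: funpow_pderiv_add funpow_pderiv_smult)
    qed
    ultimately show ?case by blast
  qed
  from this[OF order_refl] show ?thesis using that by blast
qed

section \<open>The maximal operator and Green's identity\<close>

lemma nth_deriv_cnj:
  assumes "smooth \<phi>"
  shows "nth_deriv k (\<lambda>x. cnj (\<phi> x)) = (\<lambda>x. cnj (nth_deriv k \<phi> x))" and "smooth (\<lambda>x. cnj (\<phi> x))"
proof -
  have d: "((\<lambda>x. cnj (nth_deriv k \<phi> x)) has_vector_derivative cnj (nth_deriv (Suc k) \<phi> x)) (at x)" for k x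
    by (rule bounded_linear.has_vector_derivative[OF bounded_linear_cnj smooth_has_derivative[OF assms]])
  show "nth_deriv k (\<lambda>x. cnj (\<phi> x)) = (\<lambda>x. cnj (nth_deriv k \<phi> x))"
  proof (induction k)
    case (Suc k)
    show ?case unfolding nth_deriv_Suc[of k "\<lambda>x. cnj (\<phi> x)"] Suc.IH
      using vector_derivative_at[OF d] by blast
  qed simp
  show "smooth (\<lambda>x. cnj (\<phi> x))"
    by (rule smooth_coinduct[where S = "range (\<lambda>k x. cnj (nth_deriv k \<phi> x))"])
       (auto intro!: d image_eqI[of _ _ 0])
qed

context bounded_interval
begin

text \<open>
  The operator on test functions, whose closure is the minimal operator.
\<close>

definition test_graph :: "nat \<Rightarrow> real graph" where
  "test_graph n = {(\<phi>, \<lambda>x. (-1) ^ n * nth_deriv (2 * n) \<phi> x) | \<phi>. \<phi> \<in> test}"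

lemma A_min_eq: "A_min n a b = graph_closure M (test_graph n)"
  by (simp add: A_min_def test_graph_def)

text \<open>
  The maximal operator. The condition says that the weak derivative of order \<open>2 n\<close> of \<open>f\<close> is
  \<open>(-1)\<^sup>n u\<close>.
\<close>

definition Amax :: "nat \<Rightarrow> real graph" where
  "Amax n = {(f, u). weak_deriv a b (2 * n) f (\<lambda>x. (-1) ^ n * u x)}"

lemma test_graph_l2: "test_graph n \<subseteq> l2 M \<times> l2 M"
proof
  fix p assume "p \<in> test_graph n"
  then obtain \<phi> where "\<phi> \<in> test" "p = (\<phi>, \<lambda>x. (-1) ^ n * nth_deriv (2 * n) \<phi> x)"
    by (auto simp: test_graph_def)
  then show "p \<in> l2 M \<times> l2 M"
    using continuous_l2[OF test_continuous[of \<phi> _ 0]] continuous_l2[OF test_continuous[of \<phi> _ "2 * n"]]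
    by (simp add: l2_cmult)
qed

lemma sign_mult_self: "(-1) ^ n * ((-1) ^ n * z) = (z :: complex)"
  by (simp flip: mult.assoc power_add)

lemma l2_sign_iff: "(\<lambda>x. (-1) ^ n * u x) \<in> l2 M \<longleftrightarrow> u \<in> l2 M"
  using l2_cmult[of u M "(-1) ^ n"] l2_cmult[of "\<lambda>x. (-1) ^ n * u x" M "(-1) ^ n"]
  by (auto simp: sign_mult_self)

lemma test_cnj: "\<phi> \<in> test \<Longrightarrow> (\<lambda>x. cnj (\<phi> x)) \<in> test"
  unfolding test_iff using nth_deriv_cnj(2) by auto

text \<open>
  The weak derivative is tested without complex conjugation, the adjoint with it; the two
  conditions agree because conjugates of test functions are test functions.
\<close>

lemma op_adjoint_test_graph: "op_adjoint M (test_graph n) = Amax n"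
proof -
  have "(\<forall>\<phi>\<in>test. l2_inner M (\<lambda>x. (-1) ^ n * nth_deriv (2 * n) \<phi> x) g = l2_inner M \<phi> v) \<longleftrightarrow>
    (\<forall>\<phi>\<in>test. (LINT x|M. g x * nth_deriv (2 * n) \<phi> x) =
      (-1) ^ (2 * n) * (LINT x|M. (-1) ^ n * v x * \<phi> x))" for g v
  proof -
    have *: "l2_inner M (\<lambda>x. (-1) ^ n * nth_deriv (2 * n) (\<lambda>x. cnj (\<phi> x)) x) g = l2_inner M (\<lambda>x. cnj (\<phi> x)) v \<longleftrightarrow>
      (LINT x|M. g x * nth_deriv (2 * n) \<phi> x) = (-1) ^ (2 * n) * (LINT x|M. (-1) ^ n * v x * \<phi> x)"
      if "\<phi> \<in> test" for \<phi>
    proof -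
      have 1: "l2_inner M (\<lambda>x. (-1) ^ n * nth_deriv (2 * n) (\<lambda>x. cnj (\<phi> x)) x) g =
          (-1) ^ n * cnj (LINT x|M. g x * nth_deriv (2 * n) \<phi> x)"
        unfolding nth_deriv_cnj(1)[OF test_smooth[OF that]] l2_inner_def
          Bochner_Integration.integral_cnj[symmetric] Bochner_Integration.integral_mult_right_zero[symmetric]
        by (rule Bochner_Integration.integral_cong) (simp_all add: mult_ac)
      have 2: "l2_inner M (\<lambda>x. cnj (\<phi> x)) v = cnj (LINT x|M. v x * \<phi> x)"
        unfolding l2_inner_def
        by (subst Bochner_Integration.integral_cnj[symmetric]) (simp add: mult_ac)
      have 3: "(-1) ^ (2 * n) * (LINT x|M. (-1) ^ n * v x * \<phi> x) = (-1) ^ n * (LINT x|M. v x * \<phi> x)"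
        by (simp add: mult.assoc)
      have "(-1) ^ n * cnj X = cnj Y \<longleftrightarrow> X = (-1) ^ n * Y" for X Y :: complex
      proof
        assume "(-1) ^ n * cnj X = cnj Y"
        then have "(-1) ^ n * ((-1) ^ n * cnj X) = (-1) ^ n * cnj Y" by simp
        then have "cnj X = cnj ((-1) ^ n * Y)" by (simp add: sign_mult_self)
        then show "X = (-1) ^ n * Y" by (simp only: complex_cnj_cancel_iff)
      qed (simp add: sign_mult_self)
      then show ?thesis unfolding 1 2 3 .
    qed
    show ?thesis
    proof safe
      fix \<phi> assume "\<phi> \<in> test" "\<forall>\<phi>\<in>test. l2_inner M (\<lambda>x. (-1) ^ n * nth_deriv (2 * n) \<phi> x) g = l2_inner M \<phi> v"
      then show "(LINT x|M. g x * nth_deriv (2 * n) \<phi> x) = (-1) ^ (2 * n) * (LINT x|M. (-1) ^ n * v x * \<phi> x)"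
        using *[of \<phi>] test_cnj[of \<phi>] by blast
    next
      fix \<phi> assume \<phi>: "\<phi> \<in> test" and r: "\<forall>\<phi>\<in>test. (LINT x|M. g x * nth_deriv (2 * n) \<phi> x) =
        (-1) ^ (2 * n) * (LINT x|M. (-1) ^ n * v x * \<phi> x)"
      show "l2_inner M (\<lambda>x. (-1) ^ n * nth_deriv (2 * n) \<phi> x) g = l2_inner M \<phi> v"
        using *[OF test_cnj[OF \<phi>]] bspec[OF r test_cnj[OF \<phi>]] by simp
    qed
  qed
  then show ?thesis
    unfolding op_adjoint_def Amax_def weak_deriv_def test_graph_def by (auto simp: l2_sign_iff)
qed

lemma op_adjoint_A_min: "op_adjoint M (A_min n a b) = Amax n"
  unfolding A_min_eq op_adjoint_graph_closure[OF test_graph_l2] by (rule op_adjoint_test_graph)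

lemma AmaxE:
  assumes "(f, u) \<in> Amax n"
  obtains F where "chain (2 * n) F" "AE t in M. f t = F 0 t" "F (2 * n) = (\<lambda>t. (-1) ^ n * u t)"
    "f \<in> l2 M" "u \<in> l2 M"
proof -
  have wd: "weak_deriv a b (2 * n) f (\<lambda>x. (-1) ^ n * u x)" using assms by (simp add: Amax_def)
  from weak_deriv_obtains_chain[OF this] obtain F where
    "chain (2 * n) F" "F (2 * n) = (\<lambda>x. (-1) ^ n * u x)" "AE t in M. f t = F 0 t" by blast
  then show ?thesis using that weak_deriv_l2[OF wd] l2_sign_iff by blast
qed

lemma AmaxI:
  assumes "chain (2 * n) F" "f \<in> l2 M" "AE t in M. f t = F 0 t" "F (2 * n) = (\<lambda>t. (-1) ^ n * u t)"
  shows "(f, u) \<in> Amax n"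
  using weak_deriv_chain[OF assms(1) order_refl assms(2,3)] assms(4) by (simp add: Amax_def)

lemma Domain_Amax: "Domain (Amax n) = sobolev (2 * n) a b"
proof (rule subset_antisym; rule subsetI)
  fix f assume "f \<in> Domain (Amax n)"
  then obtain u where "(f, u) \<in> Amax n" by blast
  then obtain F where F: "chain (2 * n) F" "AE t in M. f t = F 0 t" and f: "f \<in> l2 M"
    by (rule AmaxE)
  then show "f \<in> sobolev (2 * n) a b"
    unfolding sobolev_def using weak_deriv_chain[OF F(1) _ f F(2)] by blast
next
  fix f assume "f \<in> sobolev (2 * n) a b"
  then obtain g where g: "weak_deriv a b (2 * n) f g" by (auto simp: sobolev_def)
  have "(f, \<lambda>x. (-1) ^ n * g x) \<in> Amax n" using g by (simp add: Amax_def sign_mult_self)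
  then show "f \<in> Domain (Amax n)" by blast
qed

lemma chain_inner_by_parts:
  assumes F: "chain m F" and G: "chain l G" and "j + r \<le> m" "k + r \<le> l"
  shows "l2_inner M (F (j + r)) (G k) =
    (\<Sum>i<r. (-1) ^ i * (F (j + r - 1 - i) b * cnj (G (k + i) b) - F (j + r - 1 - i) a * cnj (G (k + i) a)))
    + (-1) ^ r * l2_inner M (F j) (G (k + r))"
  unfolding l2_inner_def by (rule chain_by_parts[OF F chain_cnj[OF G] assms(3,4)])

text \<open>This replaces the definite descriptions in the boundary maps by explicit values.\<close>

lemma \<Gamma>_chain:
  assumes F: "chain (2 * n) F" and f: "f \<in> l2 M" "AE t in M. f t = F 0 t"
  shows "\<Gamma>\<^sub>0 n a b f = Matrix.vec n (\<lambda>i. F i a) @\<^sub>v Matrix.vec n (\<lambda>i. F i b)"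
    and "\<Gamma>\<^sub>1 n a b f = Matrix.vec n (\<lambda>i. (-1) ^ (n - 1 - i) * F (2 * n - 1 - i) a) @\<^sub>v
      Matrix.vec n (\<lambda>i. (-1) ^ (n - i) * F (2 * n - 1 - i) b)"
    and "deriv_vec a b (2 * n) f a = Matrix.vec (2 * n) (\<lambda>i. F (2 * n - 1 - i) a)"
    and "deriv_vec a b (2 * n) f b = Matrix.vec (2 * n) (\<lambda>i. F (2 * n - 1 - i) b)"
proof -
  have dv: "deriv_value a b k f a = F k a" "deriv_value a b k f b = F k b" if "k < 2 * n" for k
    using deriv_value_chain[OF F that f] ab by auto
  show "\<Gamma>\<^sub>0 n a b f = Matrix.vec n (\<lambda>i. F i a) @\<^sub>v Matrix.vec n (\<lambda>i. F i b)"
    unfolding \<Gamma>\<^sub>0_def by (intro arg_cong2[of _ _ _ _ "(@\<^sub>v)"] eq_vecI) (auto simp: dv)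
  show "\<Gamma>\<^sub>1 n a b f = Matrix.vec n (\<lambda>i. (-1) ^ (n - 1 - i) * F (2 * n - 1 - i) a) @\<^sub>v
      Matrix.vec n (\<lambda>i. (-1) ^ (n - i) * F (2 * n - 1 - i) b)"
    unfolding \<Gamma>\<^sub>1_def by (intro arg_cong2[of _ _ _ _ "(@\<^sub>v)"] eq_vecI) (auto simp: dv)
  show "deriv_vec a b (2 * n) f a = Matrix.vec (2 * n) (\<lambda>i. F (2 * n - 1 - i) a)"
    "deriv_vec a b (2 * n) f b = Matrix.vec (2 * n) (\<lambda>i. F (2 * n - 1 - i) b)"
    unfolding deriv_vec_def by (auto intro!: eq_vecI simp: dv)
qed

lemma append_vec_cscalar_prod:
  "(Matrix.vec n p @\<^sub>v Matrix.vec n q) \<bullet>c (Matrix.vec n r @\<^sub>v Matrix.vec n s) =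
   (\<Sum>i<n. p i * cnj (r i)) + (\<Sum>i<n. q i * cnj (s i))"
proof -
  have "conjugate (Matrix.vec n r @\<^sub>v Matrix.vec n s) =
      Matrix.vec n (\<lambda>i. cnj (r i)) @\<^sub>v Matrix.vec n (\<lambda>i. cnj (s i))"
    by (rule eq_vecI) auto
  then have "(Matrix.vec n p @\<^sub>v Matrix.vec n q) \<bullet>c (Matrix.vec n r @\<^sub>v Matrix.vec n s) =
      Matrix.vec n p \<bullet> Matrix.vec n (\<lambda>i. cnj (r i)) + Matrix.vec n q \<bullet> Matrix.vec n (\<lambda>i. cnj (s i))"
    by (simp add: scalar_prod_append[of _ n _ n])
  then show ?thesis by (simp add: scalar_prod_def lessThan_atLeast0)
qed

lemma sum_split_reflect: "(\<Sum>i<2 * n. h i) = (\<Sum>i<n. h i + h (2 * n - 1 - i :: nat) :: complex)"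
proof -
  have "(\<Sum>i<2 * n. h i) = (\<Sum>i<n. h i) + (\<Sum>i=n..<n + n. h i)"
    by (simp add: mult_2 lessThan_atLeast0 sum.atLeastLessThan_concat)
  also have "(\<Sum>i=n..<n + n. h i) = (\<Sum>i<n. h (n + i))"
    using sum.shift_bounds_nat_ivl[of h 0 n n] by (simp add: lessThan_atLeast0 add.commute)
  also have "\<dots> = (\<Sum>i<n. h (n + (n - Suc i)))"
    by (rule sum.nat_diff_reindex[symmetric])
  also have "\<dots> = (\<Sum>i<n. h (2 * n - 1 - i))"
    by (intro sum.cong) (auto simp: mult_2)
  finally show ?thesis by (simp add: sum.distrib)
qed

text \<open>
  In the boundary terms of \<open>2 n\<close> integrations by parts, the terms number \<open>i\<close> and \<open>2 n - 1 - i\<close> are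
  paired. The first contributes a product of an entry of \<open>\<Gamma>\<^sub>1 f\<close> with one of \<open>\<Gamma>\<^sub>0 g\<close>, the second one
  of \<open>\<Gamma>\<^sub>0 f\<close> with one of \<open>\<Gamma>\<^sub>1 g\<close>; the signs in the definition of \<open>\<Gamma>\<^sub>1\<close> are those of these terms.
\<close>

lemma Amax_Green:
  assumes "(f, u) \<in> Amax n" "(g, v) \<in> Amax n"
  shows "l2_inner M u g - l2_inner M f v =
    \<Gamma>\<^sub>1 n a b f \<bullet>c \<Gamma>\<^sub>0 n a b g - \<Gamma>\<^sub>0 n a b f \<bullet>c \<Gamma>\<^sub>1 n a b g"
proof -
  obtain F where F: "chain (2 * n) F" "AE t in M. f t = F 0 t" "F (2 * n) = (\<lambda>t. (-1) ^ n * u t)"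
    and f: "f \<in> l2 M" "u \<in> l2 M" by (rule AmaxE[OF assms(1)])
  obtain G where G: "chain (2 * n) G" "AE t in M. g t = G 0 t" "G (2 * n) = (\<lambda>t. (-1) ^ n * v t)"
    and g: "g \<in> l2 M" "v \<in> l2 M" by (rule AmaxE[OF assms(2)])
  have F0: "F 0 \<in> l2 M" and G0: "G 0 \<in> l2 M" using chain_l2[OF F(1)] chain_l2[OF G(1)] by auto
  have 1: "l2_inner M u g = (-1) ^ n * l2_inner M (F (2 * n)) (G 0)"
    unfolding F(3) l2_inner_cmult_left sign_mult_self by (intro l2_inner_cong_AE f g G0 G(2)) simp
  have 2: "l2_inner M f v = (-1) ^ n * l2_inner M (F 0) (G (2 * n))"
    unfolding G(3) l2_inner_cmult_right using sign_mult_self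
    by (simp, intro l2_inner_cong_AE f g F0 F(2)) simp
  define h where "h i = (-1) ^ n * ((-1) ^ i * (F (2 * n - 1 - i) b * cnj (G i b) - F (2 * n - 1 - i) a * cnj (G i a)))" for i
  have "l2_inner M u g - l2_inner M f v = (\<Sum>i<2 * n. h i)"
    unfolding 1 2 using chain_inner_by_parts[OF F(1) G(1), of 0 "2 * n" 0]
    by (simp add: h_def sum_distrib_left algebra_simps)
  also have "\<dots> = (\<Sum>i<n. h i + h (2 * n - 1 - i))" by (rule sum_split_reflect)
  also have "\<dots> = (\<Sum>i<n. ((-1) ^ (n - 1 - i) * F (2 * n - 1 - i) a) * cnj (G i a)
      + ((-1) ^ (n - i) * F (2 * n - 1 - i) b) * cnj (G i b)
      - F i a * cnj ((-1) ^ (n - 1 - i) * G (2 * n - 1 - i) a)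
      - F i b * cnj ((-1) ^ (n - i) * G (2 * n - 1 - i) b))"
  proof (rule sum.cong[OF refl])
    fix i assume "i \<in> {..<n}"
    then obtain d where n: "n = Suc (i + d)" using less_imp_Suc_add by auto
    have i1: "n - 1 - i = d" and i2: "n - i = Suc d" and i3: "2 * n - 1 - (2 * n - 1 - i) = i"
      and i4: "2 * n - 1 - i = i + 1 + 2 * d" using n by auto
    have s1: "(-1) ^ n * ((-1) ^ i * z) = - ((-1) ^ d) * z" for z :: complex
      by (simp add: n power_add sign_mult_self)
    have s2: "(-1) ^ n * ((-1) ^ (2 * n - 1 - i) * z) = (-1) ^ d * z" for z :: complex
      unfolding i4 by (simp add: n power_add sign_mult_self)
    show "h i + h (2 * n - 1 - i) = ((-1) ^ (n - 1 - i) * F (2 * n - 1 - i) a) * cnj (G i a)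
      + ((-1) ^ (n - i) * F (2 * n - 1 - i) b) * cnj (G i b)
      - F i a * cnj ((-1) ^ (n - 1 - i) * G (2 * n - 1 - i) a)
      - F i b * cnj ((-1) ^ (n - i) * G (2 * n - 1 - i) b)"
      unfolding h_def i3 s1 s2 i1 i2 by (simp add: algebra_simps)
  qed
  also have "\<dots> = \<Gamma>\<^sub>1 n a b f \<bullet>c \<Gamma>\<^sub>0 n a b g - \<Gamma>\<^sub>0 n a b f \<bullet>c \<Gamma>\<^sub>1 n a b g"
    unfolding \<Gamma>_chain(1,2)[OF F(1) f(1) F(2)] \<Gamma>_chain(1,2)[OF G(1) g(1) G(2)] append_vec_cscalar_prod
    by (simp add: sum.distrib sum_subtractf)
  finally show ?thesis .
qed

lemma AmaxE_Domain:
  assumes "f \<in> Domain (Amax n)"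
  obtains F where "chain (2 * n) F" "AE t in M. f t = F 0 t" "f \<in> l2 M"
proof -
  from assms obtain u where "(f, u) \<in> Amax n" by (rule DomainE)
  then show ?thesis by (rule AmaxE) (rule that)
qed

lemma append_vec_carrier: "Matrix.vec n p @\<^sub>v Matrix.vec n q \<in> carrier_vec (2 * n)"
  by (rule carrier_vecI) simp

lemma append_vec_add:
  "(Matrix.vec n p @\<^sub>v Matrix.vec n q) + (Matrix.vec n r @\<^sub>v Matrix.vec n s) =
   Matrix.vec n (\<lambda>i. p i + r i) @\<^sub>v Matrix.vec n (\<lambda>i. q i + s i :: complex)"
  by (rule eq_vecI) auto

lemma append_vec_smult:
  "c \<cdot>\<^sub>v (Matrix.vec n p @\<^sub>v Matrix.vec n q) =
   Matrix.vec n (\<lambda>i. c * p i) @\<^sub>v Matrix.vec n (\<lambda>i. c * q i :: complex)"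
  by (rule eq_vecI) auto

text \<open>
  For surjectivity, the entries of a given pair of vectors, with the signs undone, prescribe all
  derivatives of order less than \<open>2 n\<close> at both ends, and a Hermite polynomial attains them.
\<close>

lemma boundary_triplet_\<Gamma>: "boundary_triplet M (Amax n) (2 * n) (\<Gamma>\<^sub>0 n a b) (\<Gamma>\<^sub>1 n a b)"
  unfolding boundary_triplet_def
proof (intro conjI)
  show "\<forall>\<Gamma>\<in>{\<Gamma>\<^sub>0 n a b, \<Gamma>\<^sub>1 n a b}.
      (\<forall>f\<in>Domain (Amax n). \<forall>g\<in>Domain (Amax n). (AE t in M. f t = g t) \<longrightarrow> \<Gamma> f = \<Gamma> g) \<and>
      (\<forall>f\<in>Domain (Amax n). \<Gamma> f \<in> carrier_vec (2 * n)) \<and>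
      (\<forall>f\<in>Domain (Amax n). \<forall>g\<in>Domain (Amax n). \<Gamma> (\<lambda>t. f t + g t) = \<Gamma> f + \<Gamma> g) \<and>
      (\<forall>f\<in>Domain (Amax n). \<forall>c. \<Gamma> (\<lambda>t. c * f t) = c \<cdot>\<^sub>v \<Gamma> f)"
  proof (intro ballI conjI allI impI)
    fix \<Gamma> assume "\<Gamma> \<in> {\<Gamma>\<^sub>0 n a b, \<Gamma>\<^sub>1 n a b}"
    then have \<Gamma>: "\<Gamma> = \<Gamma>\<^sub>0 n a b \<or> \<Gamma> = \<Gamma>\<^sub>1 n a b" by blast
    fix f assume "f \<in> Domain (Amax n)"
    then obtain F where F: "chain (2 * n) F" "AE t in M. f t = F 0 t" and f: "f \<in> l2 M"
      by (rule AmaxE_Domain)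
    note \<Gamma>f = \<Gamma>_chain(1,2)[OF F(1) f F(2)]
    show "\<Gamma> f \<in> carrier_vec (2 * n)" 
      using \<Gamma> by (elim disjE) (simp_all only: \<Gamma>f append_vec_carrier)
    {
      fix c
      have "AE t in M. c * f t = c * F 0 t" using F(2) by eventually_elim simp
      note \<Gamma>cf = \<Gamma>_chain(1,2)[OF chain_cmult[OF F(1)] l2_cmult[OF f] this]
      show "\<Gamma> (\<lambda>t. c * f t) = c \<cdot>\<^sub>v \<Gamma> f"
        using \<Gamma> by (elim disjE) (simp_all only: \<Gamma>f \<Gamma>cf append_vec_smult mult.left_commute[of c])
    }
    fix g assume "g \<in> Domain (Amax n)"
    then obtain G where G: "chain (2 * n) G" "AE t in M. g t = G 0 t" and g: "g \<in> l2 M"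
      by (rule AmaxE_Domain)
    note \<Gamma>g = \<Gamma>_chain(1,2)[OF G(1) g G(2)]
    show "\<Gamma> f = \<Gamma> g" if "AE t in M. f t = g t"
    proof -
      have "AE t in M. f t = G 0 t" using that G(2) by eventually_elim simp
      from \<Gamma>_chain(1,2)[OF G(1) f this] show ?thesis
        using \<Gamma> by (elim disjE) (simp_all only: \<Gamma>g)
    qed
    have "AE t in M. f t + g t = F 0 t + G 0 t" using F(2) G(2) by eventually_elim simp
    note \<Gamma>fg = \<Gamma>_chain(1,2)[OF chain_add[OF F(1) G(1)] l2_add[OF f g] this]
    show "\<Gamma> (\<lambda>t. f t + g t) = \<Gamma> f + \<Gamma> g"
      using \<Gamma> by (elim disjE) (simp_all only: \<Gamma>f \<Gamma>g \<Gamma>fg append_vec_add distrib_left)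
  qed
  show "\<forall>(f, u)\<in>Amax n. \<forall>(g, v)\<in>Amax n. l2_inner M u g - l2_inner M f v =
      \<Gamma>\<^sub>1 n a b f \<bullet>c \<Gamma>\<^sub>0 n a b g - \<Gamma>\<^sub>0 n a b f \<bullet>c \<Gamma>\<^sub>1 n a b g"
  proof clarify
    fix f u g v assume "(f, u) \<in> Amax n" "(g, v) \<in> Amax n"
    then show "l2_inner M u g - l2_inner M f v =
        \<Gamma>\<^sub>1 n a b f \<bullet>c \<Gamma>\<^sub>0 n a b g - \<Gamma>\<^sub>0 n a b f \<bullet>c \<Gamma>\<^sub>1 n a b g"
      by (rule Amax_Green)
  qed
  show "\<forall>p\<in>carrier_vec (2 * n). \<forall>q\<in>carrier_vec (2 * n). \<exists>f\<in>Domain (Amax n). \<Gamma>\<^sub>0 n a b f = p \<and> \<Gamma>\<^sub>1 n a b f = q"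
  proof (intro ballI)
    fix p q :: "complex Matrix.vec" assume p: "p \<in> carrier_vec (2 * n)" and q: "q \<in> carrier_vec (2 * n)"
    define \<alpha> where "\<alpha> k = (if k < n then vec_index p k else (-1) ^ (k - n) * vec_index q (2 * n - 1 - k))" for k
    define \<beta> where "\<beta> k = (if k < n then vec_index p (n + k) else (-1) ^ (k - n + 1) * vec_index q (n + (2 * n - 1 - k)))" for k
    have "a \<noteq> b" using ab by simp
    from Hermite_interpolation[OF this, of "2 * n" \<alpha> \<beta>] obtain P where
      P: "\<And>k. k < 2 * n \<Longrightarrow> pchain P k a = \<alpha> k" "\<And>k. k < 2 * n \<Longrightarrow> pchain P k b = \<beta> k"
      "(pderiv ^^ (2 * n + 2 * n)) P = 0"
      by blast
    let ?f = "pchain P 0"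
    have f: "?f \<in> l2 M" by (rule continuous_l2[OF pchain_continuous])
    have "(?f, \<lambda>t. (-1) ^ n * pchain P (2 * n) t) \<in> Amax n"
      by (rule AmaxI[OF chain_pchain f]) (simp_all add: sign_mult_self)
    then have "?f \<in> Domain (Amax n)" by blast
    moreover have "\<Gamma>\<^sub>0 n a b ?f = p"
      unfolding \<Gamma>_chain(1)[OF chain_pchain[of _ P] f AE_I2[OF refl]]
    proof (rule eq_vecI)
      fix i assume "i < dim_vec p"
      then have i: "i < 2 * n" using p by simp
      show "vec_index (Matrix.vec n (\<lambda>i. pchain P i a) @\<^sub>v Matrix.vec n (\<lambda>i. pchain P i b)) i = vec_index p i"
      proof (cases "i < n")
        case False
        then have "i - n < n" using i by simp
        then show ?thesis using False i P(2)[of "i - n"] by (simp add: \<beta>_def)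
      qed (use i P(1)[of i] in \<open>simp add: \<alpha>_def\<close>)
    qed (use p in simp)
    moreover have "\<Gamma>\<^sub>1 n a b ?f = q"
      unfolding \<Gamma>_chain(2)[OF chain_pchain[of _ P] f AE_I2[OF refl]]
    proof (rule eq_vecI)
      fix i assume "i < dim_vec q"
      then have i: "i < 2 * n" using q by simp
      show "vec_index (Matrix.vec n (\<lambda>i. (-1) ^ (n - 1 - i) * pchain P (2 * n - 1 - i) a) @\<^sub>v
        Matrix.vec n (\<lambda>i. (-1) ^ (n - i) * pchain P (2 * n - 1 - i) b)) i = vec_index q i"
      proof (cases "i < n")
        case True
        then have e: "2 * n - 1 - i - n = n - 1 - i" "2 * n - 1 - (2 * n - 1 - i) = i"
          "(2 * n - 1 - i < n) = False" "2 * n - 1 - i < 2 * n" by auto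
        have "pchain P (2 * n - 1 - i) a = (-1) ^ (n - 1 - i) * vec_index q i"
          using P(1)[OF e(4)] unfolding \<alpha>_def e(1-3) if_False .
        then show ?thesis using True by (simp add: sign_mult_self)
      next
        case False
        define j where "j = i - n"
        have j: "i = n + j" "j < n" using False i by (auto simp: j_def)
        then have e: "2 * n - 1 - j - n + 1 = n - j" "2 * n - 1 - (2 * n - 1 - j) = j"
          "(2 * n - 1 - j < n) = False" "2 * n - 1 - j < 2 * n" by auto
        have "pchain P (2 * n - 1 - j) b = (-1) ^ (n - j) * vec_index q (n + j)"
          using P(2)[OF e(4)] unfolding \<beta>_def e(1-3) if_False .
        then show ?thesis using j by (simp add: sign_mult_self)
      qed
    qed (use q in auto)
    ultimately show "\<exists>f\<in>Domain (Amax n). \<Gamma>\<^sub>0 n a b f = p \<and> \<Gamma>\<^sub>1 n a b f = q"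
      by (intro bexI[of _ ?f] conjI)
  qed
qed

end

section \<open>The Krein extension\<close>

context bounded_interval
begin

text \<open>
  The polynomials with vanishing derivative of order \<open>2 n\<close> form the kernel of the maximal operator.
  This space is closed under complex conjugation, so the pairing without a conjugate expresses
  orthogonality to it.
\<close>

definition A_Krein :: "nat \<Rightarrow> real graph" where
  "A_Krein n = {(f, u) \<in> Amax n. \<forall>p. (pderiv ^^ (2 * n)) p = 0 \<longrightarrow> (LINT t|M. u t * pchain p 0 t) = 0}"

text \<open>
  The restriction of the maximal operator to functions all of whose boundary values vanish. It
  contains the operator on test functions and, by Green's identity, is contained in every
  self-adjoint extension.
\<close>

definition A_zero_bc :: "nat \<Rightarrow> real graph" where
  "A_zero_bc n = {(f, u). \<exists>F. chain (2 * n) F \<and> f \<in> l2 M \<and> (AE t in M. f t = F 0 t) \<and>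
     F (2 * n) = (\<lambda>t. (-1) ^ n * u t) \<and> (\<forall>k<2 * n. F k a = 0 \<and> F k b = 0)}"

lemma pchain_l2: "pchain p k \<in> l2 M"
  by (rule continuous_l2[OF pchain_continuous])

lemma A0_Amax: "A_zero_bc n \<subseteq> Amax n"
proof clarify
  fix f u assume "(f, u) \<in> A_zero_bc n"
  then obtain F where "chain (2 * n) F" "f \<in> l2 M" "AE t in M. f t = F 0 t" "F (2 * n) = (\<lambda>t. (-1) ^ n * u t)"
    unfolding A_zero_bc_def by blast
  then show "(f, u) \<in> Amax n" by (rule AmaxI)
qed

lemma Amax_l2: "(f, u) \<in> Amax n \<Longrightarrow> f \<in> l2 M \<and> u \<in> l2 M"
  by (erule AmaxE) (rule conjI)

lemma test_graph_A0: "test_graph n \<subseteq> A_zero_bc n"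
proof
  fix p assume "p \<in> test_graph n"
  then obtain \<phi> where \<phi>: "\<phi> \<in> test" and p: "p = (\<phi>, \<lambda>x. (-1) ^ n * nth_deriv (2 * n) \<phi> x)"
    by (auto simp: test_graph_def)
  show "p \<in> A_zero_bc n"
    unfolding A_zero_bc_def p
    using chain_smooth[OF test_smooth[OF \<phi>], of "2 * n"] continuous_l2[OF test_continuous[OF \<phi>, of _ 0]]
      test_nth_deriv_zero[OF \<phi>]
    by (intro CollectI case_prodI exI[of _ "\<lambda>k. nth_deriv k \<phi>"]) (simp add: sign_mult_self)
qed

lemma A0_inner:
  assumes "(\<phi>, w) \<in> A_zero_bc n" "(g, v) \<in> Amax n"
  shows "l2_inner M w g = l2_inner M \<phi> v"
proof -
  obtain F where F: "chain (2 * n) F" "\<phi> \<in> l2 M" "AE t in M. \<phi> t = F 0 t"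
    "\<And>k. k < 2 * n \<Longrightarrow> F k a = 0 \<and> F k b = 0"
    using assms(1) unfolding A_zero_bc_def by blast
  obtain G where G: "chain (2 * n) G" "AE t in M. g t = G 0 t" "g \<in> l2 M"
    by (rule AmaxE[OF assms(2)])
  have "l2_inner M w g - l2_inner M \<phi> v = 0"
    unfolding Amax_Green[OF subsetD[OF A0_Amax assms(1)] assms(2)]
      \<Gamma>_chain(1,2)[OF F(1-3)] \<Gamma>_chain(1,2)[OF G(1,3,2)] append_vec_cscalar_prod
    by (simp add: F(4))
  then show ?thesis by simp
qed

text \<open>
  Subtracting the Taylor polynomial at \<open>a\<close> leaves a function that vanishes to order \<open>m\<close> at
  \<open>a\<close>; its boundary values at \<open>b\<close> are moments of \<open>F m\<close>.
\<close>

lemma orthogonal_iff_Taylor: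
  assumes F: "chain m F"
  defines "T \<equiv> taylor a (\<lambda>k. F k a) m"
  shows "(\<forall>p. (pderiv ^^ m) p = 0 \<longrightarrow> (LINT t|M. F m t * pchain p 0 t) = 0) \<longleftrightarrow>
    (\<forall>k<m. F k b = pchain T k b)" (is "?orth \<longleftrightarrow> ?bd")
proof -
  define R where "R k t = F k t - pchain T k t" for k t
  have R: "chain m R"
    unfolding R_def[abs_def] by (rule chain_diff[OF F chain_pchain])
  have Ra: "R k a = 0" if "k < m" for k
    using that by (simp add: R_def T_def pchain_taylor_at)
  have Rm: "R m = F m"
    by (simp add: R_def fun_eq_iff pchain_def T_def funpow_pderiv_taylor_eq_0)
  have green: "(LINT t|M. F m t * pchain p 0 t) =
      (\<Sum>i<m. (-1) ^ i * (R (m - 1 - i) b * pchain p i b))" if p: "(pderiv ^^ m) p = 0" for p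
  proof -
    have "(LINT t|M. R (0 + m) t * pchain p 0 t) =
      (\<Sum>i<m. (-1) ^ i * (R (0 + m - 1 - i) b * pchain p (0 + i) b - R (0 + m - 1 - i) a * pchain p (0 + i) a))
      + (-1) ^ m * (LINT t|M. R 0 t * pchain p (0 + m) t)"
      by (rule chain_by_parts[OF R chain_pchain[of m]]) simp_all
    also have "(\<lambda>t. R 0 t * pchain p (0 + m) t) = (\<lambda>t. 0)" by (simp add: pchain_def p)
    finally show ?thesis using Ra by (simp add: Rm)
  qed
  show ?thesis
  proof
    assume ?bd
    then have "R k b = 0" if "k < m" for k using that by (simp add: R_def)
    then show ?orth using green by simp
  next
    assume o: ?orth
    have "R k b = 0" if k: "k < m" for k
    proof -
      define j where "j = m - 1 - k"
      define q where "q = [:- complex_of_real b, 1:] ^ j"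
      have j: "j < m" "m - 1 - j = k" using k by (auto simp: j_def)
      have deg: "degree q = j" unfolding q_def by (rule degree_linear_power)
      have q: "(pderiv ^^ m) q = 0" using j deg by (intro funpow_pderiv_eq_0) simp
      have qi: "pchain q i b = (if i = j then fact j else 0)" for i
      proof -
        consider "i < j" | "i = j" | "i > j" by linarith
        then show ?thesis
        proof cases
          case 1
          then show ?thesis using pchain_zero_of_order(1)[of i j b 1] by (simp add: q_def)
        next
          case 2
          then show ?thesis using pchain_zero_of_order(2)[of b j 1] by (simp add: q_def)
        next
          case 3
          then show ?thesis using funpow_pderiv_eq_0[of q i] deg by (simp add: pchain_def)
        qed
      qed
      have "0 = (\<Sum>i<m. (-1) ^ i * (R (m - 1 - i) b * pchain q i b))" using green[OF q] o q by simp
      also have "\<dots> = (-1) ^ j * (R (m - 1 - j) b * fact j)"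
        using j(1) by (simp add: qi if_distrib sum.delta cong: if_cong)
      finally show ?thesis unfolding j(2) by simp
    qed
    then show ?bd by (simp add: R_def)
  qed
qed

lemma K_iff_Taylor:
  assumes F: "chain (2 * n) F" and f: "f \<in> l2 M" "AE t in M. f t = F 0 t"
  shows "f \<in> Domain (A_Krein n) \<longleftrightarrow> (\<forall>k<2 * n. F k b = pchain (taylor a (\<lambda>k. F k a) (2 * n)) k b)"
proof -
  have sg: "(LINT t|M. (-1) ^ n * u t * pchain p 0 t) = (-1) ^ n * (LINT t|M. u t * pchain p 0 t)" for u p
    by (simp add: mult.assoc)
  have sg0: "(-1) ^ n * z = 0 \<longleftrightarrow> z = 0" for z :: complex by simp
  have wd: "weak_deriv a b (2 * n) f (F (2 * n))" by (rule weak_deriv_chain[OF F order_refl f])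
  show ?thesis
    unfolding orthogonal_iff_Taylor[OF F, symmetric]
  proof
    assume "f \<in> Domain (A_Krein n)"
    then obtain u where "(f, u) \<in> Amax n" and o: "\<And>p. (pderiv ^^ (2 * n)) p = 0 \<Longrightarrow> (LINT t|M. u t * pchain p 0 t) = 0"
      by (auto simp: A_Krein_def)
    then have wu: "weak_deriv a b (2 * n) f (\<lambda>x. (-1) ^ n * u x)" by (simp add: Amax_def)
    show "\<forall>p. (pderiv ^^ (2 * n)) p = 0 \<longrightarrow> (LINT t|M. F (2 * n) t * pchain p 0 t) = 0"
    proof (intro allI impI)
      fix p :: "complex poly" assume p: "(pderiv ^^ (2 * n)) p = 0"
      have "(LINT t|M. F (2 * n) t * pchain p 0 t) = (LINT t|M. (-1) ^ n * u t * pchain p 0 t)"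
        by (rule l2_AE_cong[OF _ _ weak_deriv_unique[OF wd wu] pchain_continuous])
           (use weak_deriv_l2[OF wd] weak_deriv_l2[OF wu] in simp_all)
      then show "(LINT t|M. F (2 * n) t * pchain p 0 t) = 0" unfolding sg o[OF p] by simp
    qed
  next
    assume o: "\<forall>p. (pderiv ^^ (2 * n)) p = 0 \<longrightarrow> (LINT t|M. F (2 * n) t * pchain p 0 t) = 0"
    have "(f, \<lambda>t. (-1) ^ n * F (2 * n) t) \<in> A_Krein n"
      unfolding A_Krein_def using o wd by (simp add: Amax_def sign_mult_self sg)
    then show "f \<in> Domain (A_Krein n)" by blast
  qed
qed

text \<open>
  The polynomial is the Taylor polynomial at \<open>a\<close>: by the boundary condition, subtracting it removes
  the boundary values at both ends.
\<close>

lemma K_decomp: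
  assumes "(f, u) \<in> A_Krein n"
  obtains p where "(pderiv ^^ (2 * n)) p = 0" "(\<lambda>t. f t - pchain p 0 t, u) \<in> A_zero_bc n"
proof -
  have "(f, u) \<in> Amax n" using assms by (simp add: A_Krein_def)
  then obtain F where F: "chain (2 * n) F" "AE t in M. f t = F 0 t" "F (2 * n) = (\<lambda>t. (-1) ^ n * u t)"
    and f: "f \<in> l2 M" by (rule AmaxE)
  have "f \<in> Domain (A_Krein n)" using assms by blast
  then have bd: "\<forall>k<2 * n. F k b = pchain (taylor a (\<lambda>k. F k a) (2 * n)) k b"
    unfolding K_iff_Taylor[OF F(1) f F(2)] .
  define p where "p = taylor a (\<lambda>k. F k a) (2 * n)"
  have p: "(pderiv ^^ (2 * n)) p = 0" unfolding p_def by (rule funpow_pderiv_taylor_eq_0)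
  have "(\<lambda>t. f t - pchain p 0 t, u) \<in> A_zero_bc n"
    unfolding A_zero_bc_def
  proof (intro CollectI case_prodI exI[of _ "\<lambda>k t. F k t - pchain p k t"] conjI allI impI)
    show "chain (2 * n) (\<lambda>k t. F k t - pchain p k t)" by (rule chain_diff[OF F(1) chain_pchain])
    show "(\<lambda>t. f t - pchain p 0 t) \<in> l2 M" by (intro l2_diff f continuous_l2 pchain_continuous)
    show "AE t in M. f t - pchain p 0 t = F 0 t - pchain p 0 t" using F(2) by eventually_elim simp
    show "(\<lambda>t. F (2 * n) t - pchain p (2 * n) t) = (\<lambda>t. (-1) ^ n * u t)"
      by (simp add: F(3) pchain_def p)
    fix k assume k: "k < 2 * n"
    show "F k a - pchain p k a = 0" using k by (simp add: p_def pchain_taylor_at)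
    show "F k b - pchain p k b = 0" using k bd by (simp add: p_def)
  qed
  then show ?thesis using that p by blast
qed

lemma A0_K: "A_zero_bc n \<subseteq> A_Krein n"
proof clarify
  fix f u assume fu: "(f, u) \<in> A_zero_bc n"
  have "(LINT t|M. u t * pchain p 0 t) = 0" if p: "(pderiv ^^ (2 * n)) p = 0" for p
  proof -
    let ?q = "map_poly cnj p"
    have "(pchain ?q 0, \<lambda>t. 0) \<in> Amax n"
      by (rule AmaxI[OF chain_pchain[of _ ?q]])
         (simp_all add: pchain_l2 pchain_def[of _ "2 * n"] fun_eq_iff funpow_pderiv_map_cnj p)
    from A0_inner[OF fu this] have "l2_inner M u (pchain ?q 0) = 0" by simp
    moreover have "cnj (pchain ?q 0 t) = pchain p 0 t" for t
      unfolding cnj_pchain[of p 0 t, symmetric] by simp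
    ultimately show ?thesis by (simp add: l2_inner_def)
  qed
  then show "(f, u) \<in> A_Krein n" using fu A0_Amax unfolding A_Krein_def by blast
qed

lemma polynomial_K:
  assumes "(pderiv ^^ (2 * n)) p = 0"
  shows "(pchain p 0, \<lambda>t. 0) \<in> A_Krein n"
proof -
  have "(pchain p 0, \<lambda>t. 0) \<in> Amax n"
    by (rule AmaxI[OF chain_pchain[of _ p]]) (simp_all add: pchain_l2 pchain_def[of _ "2 * n"] fun_eq_iff assms)
  then show ?thesis by (simp add: A_Krein_def)
qed

lemma K_orthogonal:
  assumes "(f, u) \<in> A_Krein n" and p: "(pderiv ^^ (2 * n)) p = 0"
  shows "l2_inner M u (pchain p 0) = 0" "l2_inner M (pchain p 0) u = 0"
proof -
  have "(pderiv ^^ (2 * n)) (map_poly cnj p) = 0" by (simp add: funpow_pderiv_map_cnj p)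
  then have "(LINT t|M. u t * pchain (map_poly cnj p) 0 t) = 0" using assms(1) by (simp add: A_Krein_def)
  then show 1: "l2_inner M u (pchain p 0) = 0" by (simp add: l2_inner_def cnj_pchain)
  show "l2_inner M (pchain p 0) u = 0"
    using l2_inner_commute[of M u "pchain p 0"] 1 by simp
qed

lemma K_l2: "(f, u) \<in> A_Krein n \<Longrightarrow> f \<in> l2 M \<and> u \<in> l2 M"
  using Amax_l2 by (auto simp: A_Krein_def)

lemma K_subset_l2: "A_Krein n \<subseteq> l2 M \<times> l2 M"
  using K_l2 by auto

text \<open>
  An element of the adjoint is tested with the polynomials, which lie in the domain and are mapped
  to zero; this is the orthogonality. Conversely the operator is symmetric, because in the
  decomposition into zero boundary values and polynomials the second part contributes nothing.
\<close>

lemma op_adjoint_K: "op_adjoint M (A_Krein n) = A_Krein n"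
proof
  show "op_adjoint M (A_Krein n) \<subseteq> A_Krein n"
  proof clarify
    fix g v assume gv: "(g, v) \<in> op_adjoint M (A_Krein n)"
    have "op_adjoint M (A_Krein n) \<subseteq> Amax n"
      unfolding op_adjoint_test_graph[symmetric] by (intro op_adjoint_antimono subset_trans[OF test_graph_A0 A0_K])
    then have "(g, v) \<in> Amax n" using gv by blast
    moreover have "(LINT t|M. v t * pchain p 0 t) = 0" if p: "(pderiv ^^ (2 * n)) p = 0" for p
    proof -
      let ?q = "map_poly cnj p"
      have "(pderiv ^^ (2 * n)) ?q = 0" by (simp add: funpow_pderiv_map_cnj p)
      from op_adjointD[OF gv polynomial_K[OF this]] have "l2_inner M (pchain ?q 0) v = 0" by simp
      then have "l2_inner M v (pchain ?q 0) = 0" using l2_inner_commute[of M "pchain ?q 0" v] by simp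
      moreover have "cnj (pchain ?q 0 t) = pchain p 0 t" for t
        unfolding cnj_pchain[of p 0 t, symmetric] by simp
      ultimately show ?thesis by (simp add: l2_inner_def)
    qed
    ultimately show "(g, v) \<in> A_Krein n" by (simp add: A_Krein_def)
  qed
  show "A_Krein n \<subseteq> op_adjoint M (A_Krein n)"
  proof clarify
    fix g v assume gv: "(g, v) \<in> A_Krein n"
    have g: "g \<in> l2 M" "v \<in> l2 M" using K_l2[OF gv] by auto
    have "l2_inner M u g = l2_inner M f v" if fu: "(f, u) \<in> A_Krein n" for f u
    proof -
      have f: "f \<in> l2 M" using K_l2[OF fu] by auto
      obtain p where p: "(pderiv ^^ (2 * n)) p = 0" "(\<lambda>t. f t - pchain p 0 t, u) \<in> A_zero_bc n"
        by (rule K_decomp[OF fu])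
      have "(g, v) \<in> Amax n" using gv by (simp add: A_Krein_def)
      from A0_inner[OF p(2) this] show ?thesis
        using K_orthogonal(2)[OF gv p(1)] by (simp add: l2_inner_diff_left f pchain_l2 g)
    qed
    then show "(g, v) \<in> op_adjoint M (A_Krein n)" using g by (auto simp: op_adjoint_def)
  qed
qed

lemma A_min_subset_K: "A_min n a b \<subseteq> A_Krein n"
proof -
  have "test_graph n \<subseteq> op_adjoint M (A_Krein n)"
    unfolding op_adjoint_K by (rule subset_trans[OF test_graph_A0 A0_K])
  from graph_closure_subset_op_adjoint[OF this K_subset_l2] show ?thesis
    unfolding A_min_eq op_adjoint_K .
qed

text \<open>
  By \<open>n\<close> integrations by parts, the quadratic form is the integral of
  \<open>|\<phi>\<^sup>(\<^sup>n\<^sup>)|\<^sup>2\<close>, where \<open>\<phi>\<close> is the component with vanishing boundary values.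
\<close>

lemma nonneg_K: "nonneg M (A_Krein n)"
  unfolding nonneg_def
proof clarify
  fix f u assume fu: "(f, u) \<in> A_Krein n"
  have l2: "f \<in> l2 M" "u \<in> l2 M" using K_l2[OF fu] by auto
  obtain p where p: "(pderiv ^^ (2 * n)) p = 0" "(\<lambda>t. f t - pchain p 0 t, u) \<in> A_zero_bc n"
    by (rule K_decomp[OF fu])
  define \<phi> where "\<phi> t = f t - pchain p 0 t" for t
  obtain F where F: "chain (2 * n) F" "AE t in M. \<phi> t = F 0 t" "F (2 * n) = (\<lambda>t. (-1) ^ n * u t)"
    "\<And>k. k < 2 * n \<Longrightarrow> F k a = 0 \<and> F k b = 0" and \<phi>: "\<phi> \<in> l2 M"
    using p(2) unfolding A_zero_bc_def \<phi>_def[symmetric] by blast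
  have F0: "F 0 \<in> l2 M" using chain_l2[OF F(1)] by simp
  have "l2_inner M u f = l2_inner M u \<phi>"
    using K_orthogonal(1)[OF fu p(1)] by (simp add: \<phi>_def[abs_def] l2_inner_diff_right l2 pchain_l2)
  also have "\<dots> = (-1) ^ n * l2_inner M (F (2 * n)) (F 0)"
    unfolding F(3) l2_inner_cmult_left sign_mult_self by (intro l2_inner_cong_AE l2 \<phi> F0 F(2)) simp
  also have "l2_inner M (F (2 * n)) (F 0) = (-1) ^ n * l2_inner M (F n) (F n)"
  proof -
    have "l2_inner M (F (n + n)) (F 0) =
      (\<Sum>i<n. (-1) ^ i * (F (n + n - 1 - i) b * cnj (F (0 + i) b) - F (n + n - 1 - i) a * cnj (F (0 + i) a)))
      + (-1) ^ n * l2_inner M (F n) (F (0 + n))"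
      by (rule chain_inner_by_parts[OF F(1) F(1)]) simp_all
    also have "(\<Sum>i<n. (-1) ^ i * (F (n + n - 1 - i) b * cnj (F (0 + i) b) - F (n + n - 1 - i) a * cnj (F (0 + i) a))) = 0"
      by (rule sum.neutral) (simp add: F(4))
    finally show ?thesis by (simp add: mult_2)
  qed
  also have "(-1) ^ n * ((-1) ^ n * l2_inner M (F n) (F n)) = of_real (LINT t|M. (cmod (F n t))\<^sup>2)"
    unfolding sign_mult_self by (rule l2_inner_self)
  finally show "l2_inner M u f \<in> \<real>\<^sub>\<ge>\<^sub>0"
    by (simp add: nonneg_Reals_of_real_iff integral_nonneg_AE)
qed

text \<open>
  The polynomials divisible by \<open>W = ((x - a) (x - b))\<^sup>2\<^sup>n\<close> lie in the domain. To reach \<open>h\<close>,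
  approximate \<open>h / W\<close> by polynomials where this quotient is bounded; the weight \<open>W\<close> is bounded, so
  multiplication by it preserves the approximation.
\<close>

lemma densely_defined_K: "densely_defined M (A_Krein n)"
  unfolding densely_defined_def
proof (intro ballI allI impI)
  fix h and e :: real assume h: "h \<in> l2 M" and e: "e > 0"
  define w where "w = [:- complex_of_real a, 1:] ^ (2 * n) * [:- complex_of_real b, 1:] ^ (2 * n)"
  have w': "w = [:- complex_of_real b, 1:] ^ (2 * n) * [:- complex_of_real a, 1:] ^ (2 * n)"
    by (simp add: w_def mult.commute)
  define W where "W = pchain w 0"
  have W0: "W t \<noteq> 0" if "t \<in> {a<..<b}" for t
  proof -
    have "W t = (of_real t - of_real a) ^ (2 * n) * (of_real t - of_real b) ^ (2 * n)"
      by (simp add: W_def w_def pchain_0 poly_power)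
    then show ?thesis using that by simp
  qed
  have Wc: "continuous_on {a..b} W" unfolding W_def by (rule pchain_continuous)
  have hm: "h \<in> borel_measurable M" and Wm: "W \<in> borel_measurable M"
    using l2_measurable[OF h] continuous_measurable[OF Wc] by auto
  obtain C where C: "C > 0" "\<And>t. t \<in> {a..b} \<Longrightarrow> cmod (W t) \<le> C"
    using continuous_boundedE[OF Wc] by metis
  define g where "g N t = (if cmod (h t) \<le> real N * cmod (W t) then h t / W t else 0)" for N t
  have gm: "g N \<in> borel_measurable M" for N
    unfolding g_def[abs_def] using hm Wm by measurable
  have g_le: "cmod (g N t) \<le> real N" if "t \<in> {a<..<b}" for N t
    using W0[OF that] by (simp add: g_def norm_divide divide_le_eq)
  have gW: "g N t * W t = (if cmod (h t) \<le> real N * cmod (W t) then h t else 0)" if "t \<in> {a<..<b}" for N t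
    using W0[OF that] by (simp add: g_def)
  have "(\<lambda>N. LINT t|M. (cmod (h t - g N t * W t))\<^sup>2) \<longlonglongrightarrow> (LINT t|M. 0)"
  proof (rule integral_dominated_convergence)
    show "integrable M (\<lambda>t. (cmod (h t))\<^sup>2)" by (rule l2_square_integrable[OF h])
    show "(\<lambda>t. (cmod (h t - g N t * W t))\<^sup>2) \<in> borel_measurable M" for N
      using hm gm[of N] Wm by measurable
    show "AE t in M. (\<lambda>N. (cmod (h t - g N t * W t))\<^sup>2) \<longlonglongrightarrow> 0"
    proof (rule AE_I2)
      fix t assume "t \<in> space M"
      then have t: "t \<in> {a<..<b}" by simp
      obtain N0 :: nat where N0: "cmod (h t) / cmod (W t) \<le> real N0" using real_arch_simple by blast
      have "\<forall>\<^sub>F N in sequentially. (cmod (h t - g N t * W t))\<^sup>2 = 0"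
        unfolding eventually_sequentially
      proof (intro exI[of _ N0] allI impI)
        fix N assume "N0 \<le> N"
        then have "cmod (h t) / cmod (W t) \<le> real N" using N0 by linarith
        then have "cmod (h t) \<le> real N * cmod (W t)" using W0[OF t] by (simp add: divide_le_eq)
        then show "(cmod (h t - g N t * W t))\<^sup>2 = 0" by (simp add: gW[OF t])
      qed
      then show "(\<lambda>N. (cmod (h t - g N t * W t))\<^sup>2) \<longlonglongrightarrow> 0" by (rule tendsto_eventually)
    qed
    show "AE t in M. norm ((cmod (h t - g N t * W t))\<^sup>2) \<le> (cmod (h t))\<^sup>2" for N
      by (rule AE_I2) (simp add: gW)
  qed simp
  then have "\<forall>\<^sub>F N in sequentially. (LINT t|M. (cmod (h t - g N t * W t))\<^sup>2) < e\<^sup>2 / 4"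
    by (rule order_tendstoD(2)) (use e in simp)
  then obtain N where N: "(LINT t|M. (cmod (h t - g N t * W t))\<^sup>2) < e\<^sup>2 / 4"
    using eventually_happens'[OF sequentially_bot] by force
  from bounded_approx_polynomials[OF gm g_le, of N] obtain q where
    q: "AE t in M. (\<lambda>k. pchain (q k) 0 t) \<longlonglongrightarrow> g N t"
      "\<And>k t. t \<in> {a..b} \<Longrightarrow> cmod (pchain (q k) 0 t) \<le> \<bar>real N\<bar> + 2" by blast
  have qm: "pchain p 0 \<in> borel_measurable M" for p by (rule continuous_measurable[OF pchain_continuous])
  define D where "D = (2 * real N + 2) * C"
  have D_le: "cmod (g N t * W t - pchain (q k) 0 t * W t) \<le> D" if "t \<in> {a<..<b}" for t k
  proof -
    have "cmod (g N t - pchain (q k) 0 t) \<le> cmod (g N t) + cmod (pchain (q k) 0 t)"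
      by (rule norm_triangle_ineq4)
    also have "\<dots> \<le> 2 * real N + 2" using g_le[OF that, of N] q(2)[of t k] that by simp
    finally have "cmod (g N t - pchain (q k) 0 t) * cmod (W t) \<le> D"
      unfolding D_def using C(2)[of t] that by (intro mult_mono) auto
    then show ?thesis by (simp add: norm_mult flip: left_diff_distrib)
  qed
  have "(\<lambda>k. LINT t|M. (cmod (g N t * W t - pchain (q k) 0 t * W t))\<^sup>2) \<longlonglongrightarrow> (LINT t|M. 0)"
  proof (rule integral_dominated_convergence)
    show "integrable M (\<lambda>t. D\<^sup>2)" by (rule finite_measure.integrable_const[OF finite_measure_M])
    show "(\<lambda>t. (cmod (g N t * W t - pchain (q k) 0 t * W t))\<^sup>2) \<in> borel_measurable M" for k
      using gm[of N] Wm qm[of "q k"] by measurable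
    show "AE t in M. (\<lambda>k. (cmod (g N t * W t - pchain (q k) 0 t * W t))\<^sup>2) \<longlonglongrightarrow> 0"
      using q(1)
    proof eventually_elim
      case (elim t)
      then have "(\<lambda>k. (cmod (g N t * W t - pchain (q k) 0 t * W t))\<^sup>2)
          \<longlonglongrightarrow> (cmod (g N t * W t - g N t * W t))\<^sup>2"
        by (intro tendsto_intros)
      then show ?case by simp
    qed
    show "AE t in M. norm ((cmod (g N t * W t - pchain (q k) 0 t * W t))\<^sup>2) \<le> D\<^sup>2" for k
    proof (rule AE_I2)
      fix t assume "t \<in> space M"
      then show "norm ((cmod (g N t * W t - pchain (q k) 0 t * W t))\<^sup>2) \<le> D\<^sup>2"
        using power_mono[OF D_le norm_ge_zero, of t k 2] by simp
    qed
  qed simp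
  then have "\<forall>\<^sub>F k in sequentially. (LINT t|M. (cmod (g N t * W t - pchain (q k) 0 t * W t))\<^sup>2) < e\<^sup>2 / 4"
    by (rule order_tendstoD(2)) (use e in simp)
  then obtain k where k: "(LINT t|M. (cmod (g N t * W t - pchain (q k) 0 t * W t))\<^sup>2) < e\<^sup>2 / 4"
    using eventually_happens'[OF sequentially_bot] by force
  define P where "P = w * q k"
  have PW: "pchain P 0 t = pchain (q k) 0 t * W t" for t by (simp add: P_def pchain_0 W_def)
  have gW_l2: "(\<lambda>t. g N t * W t) \<in> l2 M"
  proof (rule l2_bound)
    show "(\<lambda>t. g N t * W t) \<in> borel_measurable M" using gm[of N] Wm by measurable
    show "integrable M (\<lambda>t. (cmod (h t))\<^sup>2)" by (rule l2_square_integrable[OF h])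
  qed (simp add: gW)
  have "(LINT t|M. (cmod (h t - pchain P 0 t))\<^sup>2) \<le>
      (LINT t|M. 2 * (cmod (h t - g N t * W t))\<^sup>2 + 2 * (cmod (g N t * W t - pchain P 0 t))\<^sup>2)"
  proof (rule integral_mono)
    show "integrable M (\<lambda>t. (cmod (h t - pchain P 0 t))\<^sup>2)"
      by (intro l2_square_integrable l2_diff h pchain_l2)
    show "integrable M (\<lambda>t. 2 * (cmod (h t - g N t * W t))\<^sup>2 + 2 * (cmod (g N t * W t - pchain P 0 t))\<^sup>2)"
      by (intro Bochner_Integration.integrable_add integrable_mult_right l2_square_integrable l2_diff h gW_l2 pchain_l2)
    show "(cmod (h t - pchain P 0 t))\<^sup>2 \<le> 2 * (cmod (h t - g N t * W t))\<^sup>2 + 2 * (cmod (g N t * W t - pchain P 0 t))\<^sup>2" for t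
      using norm_add_square_le[of "h t - g N t * W t" "g N t * W t - pchain P 0 t"] by simp
  qed
  also have "\<dots> = 2 * (LINT t|M. (cmod (h t - g N t * W t))\<^sup>2) + 2 * (LINT t|M. (cmod (g N t * W t - pchain P 0 t))\<^sup>2)"
    using l2_square_integrable[OF l2_diff[OF h gW_l2]] l2_square_integrable[OF l2_diff[OF gW_l2 pchain_l2]]
    by simp
  also have "\<dots> < e\<^sup>2" using N k unfolding PW by linarith
  finally have "l2_dist M h (pchain P 0) < e"
    unfolding l2_dist_def using e by (intro real_less_lsqrt) (simp_all add: integral_nonneg_AE)
  moreover have "pchain P 0 \<in> Domain (A_Krein n)"
  proof -
    have "pchain P j a = 0" "pchain P j b = 0" if "j < 2 * n" for j
    proof -
      show "pchain P j a = 0"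
        unfolding P_def w_def mult.assoc by (rule pchain_zero_of_order(1)[OF that])
      show "pchain P j b = 0"
        unfolding P_def w' mult.assoc by (rule pchain_zero_of_order(1)[OF that])
    qed
    then have "(pchain P 0, \<lambda>t. (-1) ^ n * pchain P (2 * n) t) \<in> A_zero_bc n"
      unfolding A_zero_bc_def using chain_pchain[of "2 * n" P] pchain_l2
      by (intro CollectI case_prodI exI[of _ "pchain P"]) (simp add: sign_mult_self)
    from subsetD[OF A0_K this] show ?thesis by (rule DomainI)
  qed
  ultimately show "\<exists>f\<in>Domain (A_Krein n). l2_dist M h f < e"
    by (intro bexI[of _ "pchain P 0"])
qed

lemma K_Ext: "A_Krein n \<in> Ext M (A_min n a b)"
  by (simp add: Ext_def A_min_subset_K selfadjoint_def densely_defined_K op_adjoint_K nonneg_K)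

text \<open>
  Write \<open>K\<close> for the operator with graph \<open>A_Krein n\<close>, and \<open>g = \<phi> + p\<close> with zero boundary values of \<open>\<phi>\<close>
  and \<open>p\<close> in the kernel of the maximal operator. Since \<open>\<phi>\<close> lies in the domain of every self-adjoint extension
  \<open>B\<close>, the form of \<open>B\<close> can be evaluated at \<open>f - \<phi>\<close>; for \<open>(B + x) f = (K + x) g = h\<close> it
  measures exactly by how much \<open>(g, h)\<close> exceeds \<open>(f, h)\<close>.
\<close>

lemma resolvent_difference:
  assumes B: "B \<in> Ext M (A_min n a b)" and fu: "(f, u) \<in> B" and gv: "(g, v) \<in> A_Krein n"
    and eq: "\<And>t. u t + of_real x * f t = v t + of_real x * g t"
  defines "h \<equiv> \<lambda>t. u t + of_real x * f t"
  shows "Re (l2_inner M f h) + x * Re (l2_inner M (\<lambda>t. f t - g t) (\<lambda>t. f t - g t)) \<le> Re (l2_inner M g h)"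
proof -
  have adj: "op_adjoint M B = B" and nn: "nonneg M B" and AB: "A_min n a b \<subseteq> B"
    using B by (auto simp: Ext_def selfadjoint_def)
  have Bl2: "B \<subseteq> l2 M \<times> l2 M" using op_adjoint_subset[of M B] unfolding adj .
  have BA: "B \<subseteq> Amax n" using op_adjoint_antimono[OF AB, of M] unfolding adj op_adjoint_A_min .
  have l2: "f \<in> l2 M" "u \<in> l2 M" "g \<in> l2 M" "v \<in> l2 M" using Bl2 fu K_l2[OF gv] by auto
  obtain p where p: "(pderiv ^^ (2 * n)) p = 0" "(\<lambda>t. g t - pchain p 0 t, v) \<in> A_zero_bc n"
    by (rule K_decomp[OF gv])
  define \<phi> where "\<phi> t = g t - pchain p 0 t" for t
  have \<phi>: "(\<phi>, v) \<in> A_zero_bc n" using p(2) by (simp add: \<phi>_def[abs_def])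
  have \<phi>l2: "\<phi> \<in> l2 M" using Amax_l2[OF subsetD[OF A0_Amax \<phi>]] by simp
  have B\<phi>: "l2_inner M s \<phi> = l2_inner M r v" if "(r, s) \<in> B" for r s
  proof -
    have "l2_inner M v r = l2_inner M \<phi> s" by (rule A0_inner[OF \<phi> subsetD[OF BA that]])
    then show ?thesis using l2_inner_commute[of M v r] l2_inner_commute[of M \<phi> s] by simp
  qed
  then have "(\<phi>, v) \<in> op_adjoint M B" using \<phi>l2 l2(4) by (simp add: op_adjoint_def split_beta)
  then have \<phi>B: "(\<phi>, v) \<in> B" unfolding adj .
  have u\<phi>: "l2_inner M u \<phi> = l2_inner M f v" by (rule B\<phi>[OF fu])
  have "(\<lambda>t. f t - \<phi> t, \<lambda>t. u t - v t) \<in> B"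
    using op_adjoint_diff[OF Bl2, of f u \<phi> v] fu \<phi>B unfolding adj by simp
  then have "l2_inner M (\<lambda>t. u t - v t) (\<lambda>t. f t - \<phi> t) \<in> \<real>\<^sub>\<ge>\<^sub>0"
    using nn by (auto simp: nonneg_def)
  then have pos: "Re (l2_inner M (\<lambda>t. u t - v t) (\<lambda>t. f t - \<phi> t)) \<ge> 0"
    by (simp add: complex_nonneg_Reals_iff)
  have v\<phi>: "l2_inner M v \<phi> = l2_inner M v g"
    using K_orthogonal(1)[OF gv p(1)] by (simp add: \<phi>_def[abs_def] l2_inner_diff_right l2 pchain_l2)
  have h2: "h = (\<lambda>t. v t + of_real x * g t)" unfolding h_def using eq by (rule ext)
  have e1: "l2_inner M h f = l2_inner M u f + x * l2_inner M f f"
    unfolding h_def by (simp add: l2_inner_add_left l2_inner_cmult_left l2 l2_cmult)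
  have e2: "l2_inner M h f = l2_inner M v f + x * l2_inner M g f"
    unfolding h2 by (simp add: l2_inner_add_left l2_inner_cmult_left l2 l2_cmult)
  have e3: "l2_inner M h g = l2_inner M v g + x * l2_inner M g g"
    unfolding h2 by (simp add: l2_inner_add_left l2_inner_cmult_left l2 l2_cmult)
  have e4: "l2_inner M f h = l2_inner M f v + x * l2_inner M f g"
    unfolding h2 by (simp add: l2_inner_add_right l2_inner_cmult_right l2 l2_cmult)
  have e5: "l2_inner M (\<lambda>t. u t - v t) (\<lambda>t. f t - \<phi> t) =
      l2_inner M u f - l2_inner M f v - l2_inner M v f + l2_inner M v g"
    by (simp add: l2_inner_diff_left l2_inner_diff_right l2 l2_diff \<phi>l2 u\<phi> v\<phi>)
  have e6: "l2_inner M (\<lambda>t. f t - g t) (\<lambda>t. f t - g t) =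
      l2_inner M f f - l2_inner M f g - l2_inner M g f + l2_inner M g g"
    by (simp add: l2_inner_diff_left l2_inner_diff_right l2 l2_diff)
  have "l2_inner M h g - l2_inner M f h =
      l2_inner M (\<lambda>t. u t - v t) (\<lambda>t. f t - \<phi> t) + x * l2_inner M (\<lambda>t. f t - g t) (\<lambda>t. f t - g t)"
    using e1 e2 unfolding e3 e4 e5 e6 by (simp add: algebra_simps)
  from arg_cong[OF this, of Re] have "Re (l2_inner M h g) - Re (l2_inner M f h) =
      Re (l2_inner M (\<lambda>t. u t - v t) (\<lambda>t. f t - \<phi> t)) + x * Re (l2_inner M (\<lambda>t. f t - g t) (\<lambda>t. f t - g t))"
    by simp
  moreover have "Re (l2_inner M h g) = Re (l2_inner M g h)"
    using arg_cong[OF l2_inner_commute[of M g h], of Re] by simp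
  ultimately show ?thesis using pos by linarith
qed

lemma is_krein_extension_K: "is_krein_extension M (A_min n a b) (A_Krein n)"
  unfolding is_krein_extension_def
proof (intro conjI ballI allI impI)
  fix B and x :: real assume B: "B \<in> Ext M (A_min n a b)" and x: "x > 0"
  show "op_le M (resolvent B x) (resolvent (A_Krein n) x)"
    unfolding op_le_def
  proof (intro ballI allI impI)
    fix h f g assume "(h, f) \<in> resolvent B x" "(h, g) \<in> resolvent (A_Krein n) x"
    then obtain u v where fu: "(f, u) \<in> B" and h: "h = (\<lambda>t. u t + of_real x * f t)"
      and gv: "(g, v) \<in> A_Krein n" and h2: "h = (\<lambda>t. v t + of_real x * g t)"
      unfolding resolvent_def by blast
    have "u t + of_real x * f t = v t + of_real x * g t" for t
      using h h2 by metis
    from resolvent_difference[OF B fu gv this]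
    have "Re (l2_inner M f h) + x * Re (l2_inner M (\<lambda>t. f t - g t) (\<lambda>t. f t - g t)) \<le> Re (l2_inner M g h)"
      unfolding h .
    moreover have "0 \<le> x * Re (l2_inner M (\<lambda>t. f t - g t) (\<lambda>t. f t - g t))"
      using x by (simp add: l2_inner_self integral_nonneg_AE)
    ultimately show "Re (l2_inner M f h) \<le> Re (l2_inner M g h)" by linarith
  qed
qed (rule K_Ext)

text \<open>
  Conversely, for a second Krein extension the same difference is non-positive, which forces
  \<open>f = g\<close>. For this one solves \<open>(K + x) g = h\<close>, for a single \<open>x\<close> and the operator \<open>K\<close> only.
\<close>

lemma krein_extension_unique:
  assumes L: "is_krein_extension M (A_min n a b) L" and x: "x > 0"
    and surj: "\<And>h. h \<in> l2 M \<Longrightarrow> \<exists>g v. (g, v) \<in> A_Krein n \<and> (\<forall>t. h t = v t + of_real x * g t)"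
  shows "L = A_Krein n"
proof -
  have LE: "L \<in> Ext M (A_min n a b)" and le: "op_le M (resolvent (A_Krein n) x) (resolvent L x)"
    using L K_Ext x by (auto simp: is_krein_extension_def)
  have adj: "op_adjoint M L = L" using LE by (simp add: Ext_def selfadjoint_def)
  have Ll2: "L \<subseteq> l2 M \<times> l2 M" using op_adjoint_subset[of M L] unfolding adj .
  have sub: "L \<subseteq> A_Krein n"
  proof clarify
    fix f u assume fu: "(f, u) \<in> L"
    have l2: "f \<in> l2 M" "u \<in> l2 M" using fu Ll2 by auto
    define h where "h t = u t + of_real x * f t" for t
    have hl2: "h \<in> l2 M" unfolding h_def[abs_def] by (intro l2_add l2_cmult l2)
    obtain g v where gv: "(g, v) \<in> A_Krein n" and h: "\<And>t. h t = v t + of_real x * g t"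
      using surj[OF hl2] by blast
    have "(h, f) \<in> resolvent L x" unfolding resolvent_def h_def[abs_def] using fu by blast
    moreover have "(h, g) \<in> resolvent (A_Krein n) x"
    proof -
      have "h = (\<lambda>t. v t + of_real x * g t)" using h by (rule ext)
      then show ?thesis unfolding resolvent_def using gv by blast
    qed
    ultimately have "Re (l2_inner M g h) \<le> Re (l2_inner M f h)"
      using le hl2 unfolding op_le_def by blast
    moreover have "u t + of_real x * f t = v t + of_real x * g t" for t
      using h[of t] by (simp add: h_def)
    note resolvent_difference[OF LE fu gv this]
    ultimately have "x * Re (l2_inner M (\<lambda>t. f t - g t) (\<lambda>t. f t - g t)) \<le> 0"
      unfolding h_def[abs_def] by linarith
    then have le0: "Re (l2_inner M (\<lambda>t. f t - g t) (\<lambda>t. f t - g t)) \<le> 0"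
      using x by (simp add: mult_le_0_iff)
    have gl2: "g \<in> l2 M" "v \<in> l2 M" using K_l2[OF gv] by auto
    have fg: "AE t in M. g t = f t"
      using AE_zero_of_l2_inner_self[OF l2_diff[OF l2(1) gl2(1)] le0] by eventually_elim simp
    have vu: "AE t in M. v t = u t"
      using fg
    proof eventually_elim
      case (elim t)
      then show ?case using h[of t] by (simp add: h_def)
    qed
    have "(g, v) \<in> op_adjoint M (A_Krein n)" using gv op_adjoint_K by simp
    from op_adjoint_AE[OF K_subset_l2 this l2 fg vu] show "(f, u) \<in> A_Krein n"
      unfolding op_adjoint_K .
  qed
  have "A_Krein n \<subseteq> L" using op_adjoint_antimono[OF sub, of M] unfolding adj op_adjoint_K .
  then show ?thesis using sub by (rule subset_antisym[rotated])
qed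

end

section \<open>Solving \<open>(K + x) g = h\<close>\<close>

lemma funpow_pderiv_sum: "(pderiv ^^ k) (\<Sum>i\<in>I. p i :: complex poly) = (\<Sum>i\<in>I. (pderiv ^^ k) (p i))"
proof (induction I rule: infinite_finite_induct)
  case empty
  show ?case by (induction k) simp_all
next
  case (infinite A)
  then show ?case by (induction k) simp_all
qed (simp add: funpow_pderiv_add)

lemma pchain_funpow: "pchain ((pderiv ^^ m) p) k = pchain p (k + m)"
  by (simp add: pchain_def[abs_def] funpow_add)

context bounded_interval
begin

lemma Jpow_l2:
  assumes "u \<in> l2 M"
  shows "(J ^^ k) u \<in> l2 M"
  using chain_l2[OF chain_iterated_J[OF assms, of k], of 0] by simp

lemma Jpow_continuous:
  assumes "u \<in> l2 M"
  shows "continuous_on {a..b} ((J ^^ Suc k) u)"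
  using J_continuous[OF l2_integrable[OF Jpow_l2[OF assms]]] by simp

lemma Jpow_diff:
  assumes "u \<in> l2 M" "v \<in> l2 M" "t \<in> {a..b}"
  shows "(J ^^ k) (\<lambda>t. u t - v t) t = (J ^^ k) u t - (J ^^ k) v t"
  using assms(3)
proof (induction k arbitrary: t)
  case (Suc k)
  have "J ((J ^^ k) (\<lambda>t. u t - v t)) t = J (\<lambda>t. (J ^^ k) u t - (J ^^ k) v t) t"
    by (rule J_cong[OF Suc.IH Suc.prems])
  also have "\<dots> = J ((J ^^ k) u) t - J ((J ^^ k) v) t"
    by (intro J_diff l2_integrable Jpow_l2 assms Suc.prems)
  finally show ?case by simp
qed simp

lemma Jpow_norm_le:
  assumes u: "continuous_on {a..b} u" and le: "\<And>t. t \<in> {a..b} \<Longrightarrow> cmod (u t) \<le> C" and t: "t \<in> {a..b}"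
  shows "cmod ((J ^^ k) u t) \<le> (b - a) ^ k * C"
proof -
  have cont: "continuous_on {a..b} ((J ^^ k) u)" for k
    using u Jpow_continuous[OF continuous_l2[OF u]] by (cases k) auto
  show ?thesis
    using t
  proof (induction k arbitrary: t)
    case 0
    then show ?case using le by simp
  next
    case (Suc k)
    have "cmod (J ((J ^^ k) u) t) \<le> (b - a) * ((b - a) ^ k * C)"
      by (rule J_norm_le[OF cont Suc.IH Suc.prems])
    then show ?case by (simp add: mult.assoc)
  qed
qed

text \<open>
  The integrals of \<open>u\<close> against polynomials of degree less than \<open>m\<close> are linear combinations of the
  values at \<open>b\<close> of the first \<open>m\<close> iterated integrals of \<open>u\<close>. Hermite interpolation provides polynomials dual to them, hence an
  explicit projection onto the polynomials along their orthogonal complement.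
\<close>

lemma obtain_projection:
  obtains q :: "nat \<Rightarrow> complex poly" where "\<And>j. (pderiv ^^ m) (q j) = 0"
    "\<And>u p. u \<in> l2 M \<Longrightarrow> (pderiv ^^ m) p = 0 \<Longrightarrow>
      (LINT t|M. (u t - (\<Sum>j<m. (J ^^ Suc j) u b * pchain (q j) 0 t)) * pchain p 0 t) = 0"
proof -
  have "\<exists>p. (\<forall>k<m. pchain p k a = 0) \<and> (\<forall>k<m. pchain p k b = (if m - Suc k = j then 1 else 0)) \<and>
      (pderiv ^^ (m + m)) p = 0" for j
  proof -
    have "a \<noteq> b" using ab by simp
    from Hermite_interpolation[OF this, of m "\<lambda>_. 0" "\<lambda>k. if m - Suc k = j then 1 else 0"]
    obtain p where "\<And>k. k < m \<Longrightarrow> pchain p k a = 0"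
      "\<And>k. k < m \<Longrightarrow> pchain p k b = (if m - Suc k = j then 1 else 0)" "(pderiv ^^ (m + m)) p = 0" by blast
    then show ?thesis by (intro exI[of _ p]) simp
  qed
  then obtain H where H: "\<And>j k. k < m \<Longrightarrow> pchain (H j) k a = 0"
    "\<And>j k. k < m \<Longrightarrow> pchain (H j) k b = (if m - Suc k = j then 1 else 0)"
    "\<And>j. (pderiv ^^ (m + m)) (H j) = 0" by metis
  define q where "q j = (pderiv ^^ m) (H j)" for j
  show ?thesis
  proof
    show "(pderiv ^^ m) (q j) = 0" for j
      using H(3)[of j] by (simp add: q_def funpow_add)
    fix u and p :: "complex poly" assume u: "u \<in> l2 M" and p: "(pderiv ^^ m) p = 0"
    define P where "P = (\<Sum>j<m. Polynomial.smult ((J ^^ Suc j) u b) (H j))"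
    have Pk: "pchain P k t = (\<Sum>j<m. (J ^^ Suc j) u b * pchain (H j) k t)" for k t
      by (simp only: P_def pchain_sum pchain_smult)
    define F where "F k t = (J ^^ (m - k)) u t - pchain P k t" for k t
    have F: "chain m F"
      unfolding F_def[abs_def] by (rule chain_diff[OF chain_iterated_J[OF u] chain_pchain])
    have Fa: "F k a = 0" if k: "k < m" for k
    proof -
      have "m - k = Suc (m - Suc k)" using k by simp
      then have "(J ^^ (m - k)) u a = 0" by simp
      then show ?thesis using H(1)[OF k] by (simp add: F_def Pk)
    qed
    have Fb: "F k b = 0" if k: "k < m" for k
    proof -
      have "pchain P k b = (\<Sum>j<m. if j = m - Suc k then (J ^^ Suc j) u b else 0)"
        unfolding Pk by (intro sum.cong) (use H(2)[OF k] in auto)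
      also have "\<dots> = (J ^^ Suc (m - Suc k)) u b" using k by (simp add: sum.delta del: funpow.simps)
      also have "Suc (m - Suc k) = m - k" using k by simp
      finally show ?thesis by (simp add: F_def)
    qed
    have "pchain (taylor a (\<lambda>k. F k a) m) k b = 0" if "k < m" for k
      unfolding pchain_taylor by (rule sum.neutral) (use Fa in auto)
    then have "(LINT t|M. F m t * pchain p 0 t) = 0"
      using orthogonal_iff_Taylor[OF F] Fb p by simp
    moreover have "F m t = u t - (\<Sum>j<m. (J ^^ Suc j) u b * pchain (q j) 0 t)" for t
      by (simp add: F_def Pk q_def pchain_funpow del: funpow.simps)
    ultimately show "(LINT t|M. (u t - (\<Sum>j<m. (J ^^ Suc j) u b * pchain (q j) 0 t)) * pchain p 0 t) = 0"
      by simp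
  qed
qed

text \<open>
  With \<open>w = (-1)\<^sup>n K g\<close> the equation becomes a fixed point equation for \<open>w\<close> involving the
  \<open>2 n\<close>-fold integral of \<open>w\<close> with a factor \<open>x\<close>; its unknown part is continuous, and for small
  \<open>x\<close> the fixed point map is a contraction in the supremum norm.
\<close>

lemma K_plus_surjective:
  assumes n: "n \<ge> 1"
  obtains x where "x > 0" "\<And>h. h \<in> l2 M \<Longrightarrow> \<exists>g v. (g, v) \<in> A_Krein n \<and> (\<forall>t. h t = v t + of_real x * g t)"
proof -
  define m where "m = 2 * n"
  obtain m' where m': "m = Suc m'" using n by (cases m) (auto simp: m_def)
  from obtain_projection[of m] obtain q :: "nat \<Rightarrow> complex poly" where
    q: "\<And>j. (pderiv ^^ m) (q j) = 0" and
    orth: "\<And>u p. u \<in> l2 M \<Longrightarrow> (pderiv ^^ m) p = 0 \<Longrightarrow>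
      (LINT t|M. (u t - (\<Sum>j<m. (J ^^ Suc j) u b * pchain (q j) 0 t)) * pchain p 0 t) = 0" by blast
  define Pr where "Pr u t = (\<Sum>j<m. (J ^^ Suc j) u b * pchain (q j) 0 t)" for u t
  define T where "T u t = (J ^^ m) u t - Pr ((J ^^ m) u) t" for u t
  have Pr_cont: "continuous_on {a..b} (Pr u)" for u
    unfolding Pr_def[abs_def] by (intro continuous_on_sum continuous_on_mult continuous_on_const pchain_continuous)
  have T_cont: "continuous_on {a..b} (T u)" if "u \<in> l2 M" for u
    unfolding T_def[abs_def] m' using Jpow_continuous[OF that, of m'] Pr_cont by (intro continuous_on_diff)
  have T_diff: "T (\<lambda>t. u t - v t) t = T u t - T v t" if u: "u \<in> l2 M" and v: "v \<in> l2 M" and t: "t \<in> {a..b}" for u v t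
  proof -
    have bI: "b \<in> {a..b}" using ab by simp
    have "(J ^^ Suc j) ((J ^^ m) (\<lambda>t. u t - v t)) b = (J ^^ Suc j) ((J ^^ m) u) b - (J ^^ Suc j) ((J ^^ m) v) b" for j
      using Jpow_diff[OF u v bI, of "Suc j + m"] by (simp only: funpow_add o_apply)
    then have "Pr ((J ^^ m) (\<lambda>t. u t - v t)) t = Pr ((J ^^ m) u) t - Pr ((J ^^ m) v) t"
      unfolding Pr_def by (simp only: left_diff_distrib sum_subtractf)
    then show ?thesis unfolding T_def by (simp add: Jpow_diff[OF u v t])
  qed
  have "\<forall>j. \<exists>C>0. \<forall>t\<in>{a..b}. cmod (pchain (q j) 0 t) \<le> C"
    using continuous_boundedE[OF pchain_continuous] by metis
  then obtain Q where Q: "\<And>j. Q j > 0" "\<And>j t. t \<in> {a..b} \<Longrightarrow> cmod (pchain (q j) 0 t) \<le> Q j"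
    by metis
  define C where "C = (b - a) ^ m + (\<Sum>j<m. (b - a) ^ (Suc j + m) * Q j)"
  have "0 < (b - a) ^ m" using ab by simp
  moreover have "0 \<le> (\<Sum>j<m. (b - a) ^ (Suc j + m) * Q j)"
    using ab Q(1) by (intro sum_nonneg mult_nonneg_nonneg) (auto simp: less_imp_le)
  ultimately have C: "C > 0" unfolding C_def by linarith
  have T_le: "cmod (T u t) \<le> C * D" if u: "continuous_on {a..b} u"
    and le: "\<And>t. t \<in> {a..b} \<Longrightarrow> cmod (u t) \<le> D" and t: "t \<in> {a..b}" for u t D
  proof -
    have bI: "b \<in> {a..b}" using ab by simp
    have D: "0 \<le> D" using le[OF t] norm_ge_zero order_trans by blast
    have "cmod (Pr ((J ^^ m) u) t) \<le> (\<Sum>j<m. (b - a) ^ (Suc j + m) * Q j * D)"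
      unfolding Pr_def
    proof (rule order_trans[OF norm_sum], rule sum_mono)
      fix j
      have "cmod ((J ^^ Suc j) ((J ^^ m) u) b) \<le> (b - a) ^ (Suc j + m) * D"
        using Jpow_norm_le[OF u le bI, of "Suc j + m"] by (simp only: funpow_add o_apply)
      then have "cmod ((J ^^ Suc j) ((J ^^ m) u) b) * cmod (pchain (q j) 0 t) \<le> ((b - a) ^ (Suc j + m) * D) * Q j"
        using Q(2)[OF t] ab D by (intro mult_mono) auto
      then show "cmod ((J ^^ Suc j) ((J ^^ m) u) b * pchain (q j) 0 t) \<le> (b - a) ^ (Suc j + m) * Q j * D"
        unfolding norm_mult by (simp only: mult_ac)
    qed
    moreover have "cmod ((J ^^ m) u t) \<le> (b - a) ^ m * D" by (rule Jpow_norm_le[OF u le t])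
    moreover have "cmod (T u t) \<le> cmod ((J ^^ m) u t) + cmod (Pr ((J ^^ m) u) t)"
      unfolding T_def by (rule norm_triangle_ineq4)
    moreover have "C * D = (b - a) ^ m * D + (\<Sum>j<m. (b - a) ^ (Suc j + m) * Q j * D)"
      unfolding C_def by (simp only: distrib_right sum_distrib_right)
    ultimately show ?thesis by linarith
  qed
  \<comment> \<open>The fixed point map has Lipschitz constant \<open>x C = 1/2\<close>.\<close>
  define x where "x = 1 / (2 * C)"
  have x: "x > 0" using C by (simp add: x_def)
  define e where "e = ((-1) ^ n :: complex)"
  have ee: "e * (e * z) = z" for z unfolding e_def by (rule sign_mult_self)
  have e1: "cmod e = 1" by (simp add: e_def norm_power)
  have "\<exists>g v. (g, v) \<in> A_Krein n \<and> (\<forall>t. h t = v t + of_real x * g t)" if h: "h \<in> l2 M" for h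
  proof -
    define w0 where "w0 t = e * (h t - Pr h t)" for t
    have Prl2: "Pr u \<in> l2 M" for u by (rule continuous_l2[OF Pr_cont])
    have w0: "w0 \<in> l2 M" unfolding w0_def[abs_def] by (intro l2_cmult l2_diff h Prl2)
    \<comment> \<open>Bounded continuous functions on the whole line are used; \<open>c\<close> extends from the interval.\<close>
  define c where "c t = max a (min b t)" for t
    have c_in: "c t \<in> {a..b}" for t using ab by (simp add: c_def)
    have c_id: "c t = t" if "t \<in> {a..b}" for t using that by (simp add: c_def)
    have c_cont: "continuous_on UNIV c" unfolding c_def[abs_def] by (intro continuous_intros)
    define f where "f y t = - (of_real x * e * T (\<lambda>t. w0 t + apply_bcontfun y t) (c t))" for y t
    have yl2: "(\<lambda>t. w0 t + apply_bcontfun y t) \<in> l2 M" for y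
      by (intro l2_add w0 continuous_l2 continuous_on_apply_bcontfun)
    have f_bc: "f y \<in> bcontfun" for y
    proof -
      let ?u = "\<lambda>t. w0 t + apply_bcontfun y t"
      obtain B where B: "B > 0" "\<And>t. t \<in> {a..b} \<Longrightarrow> cmod (T ?u t) \<le> B"
        using continuous_boundedE[OF T_cont[OF yl2]] by metis
      show ?thesis
      proof (rule bcontfun_normI)
        have "continuous_on UNIV (\<lambda>t. T ?u (c t))"
          by (rule continuous_on_compose2[OF T_cont[OF yl2] c_cont]) (use c_in in auto)
        then show "continuous_on UNIV (f y)"
          unfolding f_def[abs_def] by (intro continuous_on_minus continuous_on_mult continuous_on_const)
        show "norm (f y t) \<le> x * B" for t
          using mult_left_mono[OF B(2)[OF c_in, of t], of x] x by (simp add: f_def norm_mult e1)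
      qed
    qed
    define \<Phi> where "\<Phi> y = Bcontfun (f y)" for y
    have \<Phi>: "apply_bcontfun (\<Phi> y) = f y" for y
      unfolding \<Phi>_def by (rule Bcontfun_inverse[OF f_bc])
    have "dist (\<Phi> y) (\<Phi> z) \<le> 1 / 2 * dist y z" for y z
    proof (rule dist_bound)
      fix t
      let ?d = "\<lambda>t. (w0 t + apply_bcontfun y t) - (w0 t + apply_bcontfun z t)"
      have "cmod (T ?d (c t)) \<le> C * dist y z"
      proof (rule T_le[OF _ _ c_in])
        show "continuous_on {a..b} ?d" by (simp add: continuous_on_diff)
        show "cmod (?d s) \<le> dist y z" for s
          using dist_bounded[of y s z] by (simp add: dist_norm)
      qed
      moreover have "f y t - f z t = - (of_real x * e * T ?d (c t))"
        unfolding T_diff[OF yl2 yl2 c_in] f_def by (simp add: algebra_simps)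
      ultimately have "cmod (f y t - f z t) \<le> x * (C * dist y z)"
        using x by (simp add: norm_mult e1)
      also have "\<dots> = 1 / 2 * dist y z" using C by (simp add: x_def)
      finally show "dist (apply_bcontfun (\<Phi> y) t) (apply_bcontfun (\<Phi> z) t) \<le> 1 / 2 * dist y z"
        unfolding \<Phi> dist_norm .
    qed
    then have "\<exists>!y. \<Phi> y = y" by (intro banach_fix_type[of "1 / 2"]) auto
    then obtain y where y: "\<Phi> y = y" by blast
    define w where "w t = w0 t + apply_bcontfun y t" for t
    have w: "w \<in> l2 M" unfolding w_def[abs_def] by (rule yl2)
    define z where "z = (J ^^ m) w"
    have zl2: "z \<in> l2 M" unfolding z_def by (rule Jpow_l2[OF w])
    have w_eq: "w t = e * (h t - Pr h t) - of_real x * e * (z t - Pr z t)" if t: "t \<in> {a..b}" for t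
    proof -
      have "apply_bcontfun y t = f y t" using \<Phi>[of y] y by simp
      then have "apply_bcontfun y t = - (of_real x * e * T w t)"
        unfolding f_def c_id[OF t] w_def[abs_def] .
      then show ?thesis by (simp add: w_def w0_def T_def z_def)
    qed
    have w_orth: "(LINT t|M. w t * pchain p 0 t) = 0" if p: "(pderiv ^^ m) p = 0" for p
    proof -
      have i: "integrable M (\<lambda>t. (u t - Pr u t) * pchain p 0 t)" if "u \<in> l2 M" for u
        by (intro l2_mult_integrable l2_diff that Prl2 pchain_l2)
      have "(LINT t|M. w t * pchain p 0 t) =
          (LINT t|M. e * ((h t - Pr h t) * pchain p 0 t) - of_real x * e * ((z t - Pr z t) * pchain p 0 t))"
        by (intro Bochner_Integration.integral_cong[OF refl]) (simp add: w_eq algebra_simps)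
      also have "\<dots> = e * (LINT t|M. (h t - Pr h t) * pchain p 0 t)
          - of_real x * e * (LINT t|M. (z t - Pr z t) * pchain p 0 t)"
        using i[OF h] i[OF zl2] by simp
      also have "\<dots> = 0" using orth[OF h p] orth[OF zl2 p] by (simp only: Pr_def mult_zero_right diff_self)
      finally show ?thesis .
    qed
    \<comment> \<open>chosen so that \<open>x p\<close> is the projection of \<open>h - x z\<close>\<close>
    define p where "p = (\<Sum>j<m. Polynomial.smult (((J ^^ Suc j) h b - of_real x * (J ^^ Suc j) z b) / of_real x) (q j))"
    have p0: "(pderiv ^^ m) p = 0"
      by (simp add: p_def funpow_pderiv_sum funpow_pderiv_smult q)
    have pt: "of_real x * pchain p 0 t = Pr h t - of_real x * Pr z t" for t
    proof -
      have "of_real x * pchain p 0 t = (\<Sum>j<m. ((J ^^ Suc j) h b - of_real x * (J ^^ Suc j) z b) * pchain (q j) 0 t)"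
        unfolding p_def pchain_sum pchain_smult sum_distrib_left
        by (intro sum.cong refl) (use x in \<open>simp del: funpow.simps\<close>)
      also have "\<dots> = Pr h t - of_real x * Pr z t"
        unfolding Pr_def sum_distrib_left sum_subtractf[symmetric]
        by (intro sum.cong refl) (simp only: left_diff_distrib mult.assoc)
      finally show ?thesis .
    qed
    define G where "G k t = (J ^^ (m - k)) w t + pchain p k t" for k t
    have G: "chain m G"
      unfolding G_def[abs_def] by (rule chain_add[OF chain_iterated_J[OF w] chain_pchain])
    have G0: "G 0 t = z t + pchain p 0 t" for t by (simp add: G_def z_def)
    have Gm: "G m = w"
      using p0 by (simp add: G_def fun_eq_iff pchain_def)
    have G0l2: "G 0 \<in> l2 M" by (rule chain_l2[OF G]) simp
    have "(G 0, \<lambda>t. e * w t) \<in> Amax n"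
      by (rule AmaxI[OF G[unfolded m_def] G0l2]) (simp_all add: Gm[unfolded m_def] ee flip: e_def)
    moreover have "(LINT t|M. e * w t * pchain p' 0 t) = 0" if "(pderiv ^^ (2 * n)) p' = 0" for p'
      using w_orth[of p'] that by (simp add: m_def mult.assoc)
    ultimately have GK: "(G 0, \<lambda>t. e * w t) \<in> A_Krein n" by (simp add: A_Krein_def)
    \<comment> \<open>agrees with \<open>e w\<close> on the interval, and makes the equation hold off the interval as well\<close>
    define v where "v t = h t - of_real x * G 0 t" for t
    have "v t = e * w t" if "t \<in> {a..b}" for t
    proof -
      have 1: "of_real x * G 0 t = of_real x * z t + (Pr h t - of_real x * Pr z t)"
        unfolding G0 distrib_left pt ..
      have exe: "e * (of_real x * e * Y) = of_real x * Y" for Y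
      proof -
        have "e * (of_real x * e * Y) = of_real x * (e * (e * Y))" by (simp only: mult_ac)
        then show ?thesis by (simp only: ee)
      qed
      have 2: "e * w t = (h t - Pr h t) - of_real x * (z t - Pr z t)"
        unfolding w_eq[OF that] right_diff_distrib[of e] ee exe ..
      show ?thesis unfolding v_def 1 2 by (simp add: algebra_simps)
    qed
    then have "AE t in M. e * w t = v t" by (intro AE_I2) simp
    moreover have "v \<in> l2 M" unfolding v_def[abs_def] by (intro l2_diff h l2_cmult G0l2)
    ultimately have "(G 0, v) \<in> op_adjoint M (A_Krein n)"
      using GK op_adjoint_AE[OF K_subset_l2, of "G 0" "\<lambda>t. e * w t" n "G 0" v] G0l2
      by (simp add: op_adjoint_K)
    then have "(G 0, v) \<in> A_Krein n" unfolding op_adjoint_K .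
    moreover have "h t = v t + of_real x * G 0 t" for t by (simp add: v_def)
    ultimately show ?thesis by blast
  qed
  then show ?thesis using that x by blast
qed

lemma krein_extension_eq_K:
  assumes "n \<ge> 1"
  shows "krein_extension M (A_min n a b) = A_Krein n"
  unfolding krein_extension_def
proof (rule the_equality)
  show "is_krein_extension M (A_min n a b) (A_Krein n)" by (rule is_krein_extension_K)
  fix L assume L: "is_krein_extension M (A_min n a b) L"
  from K_plus_surjective[OF assms] obtain x where x: "x > 0"
    "\<And>h. h \<in> l2 M \<Longrightarrow> \<exists>g v. (g, v) \<in> A_Krein n \<and> (\<forall>t. h t = v t + of_real x * g t)" by blast
  show "L = A_Krein n" by (rule krein_extension_unique[OF L x])
qed

end

section \<open>The boundary conditions in matrix form\<close>

lemma S_mat_mult_vec: "S_mat n *\<^sub>v Matrix.vec n f = Matrix.vec n (\<lambda>i. f (n - 1 - i))"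
proof (rule eq_vecI)
  fix i assume "i < dim_vec (Matrix.vec n (\<lambda>i. f (n - 1 - i)))"
  then have i: "i < n" by simp
  have "vec_index (S_mat n *\<^sub>v Matrix.vec n f) i = (\<Sum>j=0..<n. (if (i + 1) + (j + 1) = n + 1 then 1 else 0) * f j)"
    using i by (simp add: S_mat_def scalar_prod_def)
  also have "\<dots> = (\<Sum>j=0..<n. (if j = n - 1 - i then f j else 0))"
    using i by (intro sum.cong refl) auto
  also have "\<dots> = f (n - 1 - i)" using i by (simp add: sum.delta)
  finally show "vec_index (S_mat n *\<^sub>v Matrix.vec n f) i = vec_index (Matrix.vec n (\<lambda>i. f (n - 1 - i))) i"
    using i by simp
qed (simp add: S_mat_def)

lemma Q_mat_mult_vec: "Q_mat n *\<^sub>v Matrix.vec n f = Matrix.vec n (\<lambda>i. (-1) ^ (n - i) * f i)"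
proof (rule eq_vecI)
  fix i assume "i < dim_vec (Matrix.vec n (\<lambda>i. (-1) ^ (n - i) * f i))"
  then have i: "i < n" by simp
  have "vec_index (Q_mat n *\<^sub>v Matrix.vec n f) i = (\<Sum>j=0..<n. (if i = j then (-1) ^ (n - i) else 0) * f j)"
    using i by (simp add: Q_mat_def scalar_prod_def)
  also have "\<dots> = (\<Sum>j=0..<n. (if j = i then (-1) ^ (n - i) * f j else 0))"
    by (intro sum.cong refl) auto
  also have "\<dots> = (-1) ^ (n - i) * f i" using i by (simp add: sum.delta)
  finally show "vec_index (Q_mat n *\<^sub>v Matrix.vec n f) i = vec_index (Matrix.vec n (\<lambda>i. (-1) ^ (n - i) * f i)) i"
    using i by simp
qed (simp add: Q_mat_def)

lemma vec_of_carrier: "v \<in> carrier_vec n \<Longrightarrow> v = Matrix.vec n (vec_index v)"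
  by (intro eq_vecI) auto

lemma S_mat_involution:
  assumes "v \<in> carrier_vec n"
  shows "S_mat n *\<^sub>v (S_mat n *\<^sub>v v) = v"
proof -
  have "S_mat n *\<^sub>v (S_mat n *\<^sub>v Matrix.vec n f) = Matrix.vec n f" for f
    unfolding S_mat_mult_vec by (rule eq_vecI) auto
  from this[of "vec_index v"] show ?thesis unfolding vec_of_carrier[OF assms, symmetric] .
qed

lemma Q_mat_involution:
  assumes "v \<in> carrier_vec n"
  shows "Q_mat n *\<^sub>v (Q_mat n *\<^sub>v v) = v"
proof -
  have "Q_mat n *\<^sub>v (Q_mat n *\<^sub>v Matrix.vec n f) = Matrix.vec n f" for f
    unfolding Q_mat_mult_vec by (rule eq_vecI) (simp_all flip: mult.assoc power_add)
  from this[of "vec_index v"] show ?thesis unfolding vec_of_carrier[OF assms, symmetric] .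
qed

lemma Toeplitz_blocks:
  "T_toeplitz (2 * n) a b =
   four_block_mat (T_toeplitz n a b) (0\<^sub>m n n) (T\<^sub>2 n a b) (T_toeplitz n a b)"
proof (rule eq_matI)
  fix i j assume "i < dim_row (four_block_mat (T_toeplitz n a b) (0\<^sub>m n n) (T\<^sub>2 n a b) (T_toeplitz n a b))"
    "j < dim_col (four_block_mat (T_toeplitz n a b) (0\<^sub>m n n) (T\<^sub>2 n a b) (T_toeplitz n a b))"
  then have "i < 2 * n" "j < 2 * n" by (simp_all add: T_toeplitz_def)
  then show "T_toeplitz (2 * n) a b $$ (i, j) =
      four_block_mat (T_toeplitz n a b) (0\<^sub>m n n) (T\<^sub>2 n a b) (T_toeplitz n a b) $$ (i, j)"
    by (cases "i < n"; cases "j < n") (auto simp: T_toeplitz_def T\<^sub>2_def)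
qed (simp_all add: T_toeplitz_def T\<^sub>2_def)

text \<open>
  The condition \<open>(\<alpha>', \<beta>') = T (\<alpha>, \<beta>)\<close> reads \<open>\<alpha>' = T\<^sub>1 \<alpha>\<close> and \<open>T\<^sub>2 \<alpha> = \<beta>' - T\<^sub>1 \<beta>\<close>. Solving the second
  equation for \<open>\<alpha>\<close> expresses the higher derivatives \<open>\<alpha>, \<alpha>'\<close> by the lower ones \<open>\<beta>, \<beta>'\<close>.
\<close>

lemma block_condition_iff:
  fixes T1 T2 R Q S :: "complex Matrix.mat"
  assumes carrier [simp]: "T1 \<in> carrier_mat n n" "T2 \<in> carrier_mat n n" "R \<in> carrier_mat n n"
      "Q \<in> carrier_mat n n" "S \<in> carrier_mat n n"
    and inv: "T2 * R = 1\<^sub>m n" "R * T2 = 1\<^sub>m n"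
    and Q: "\<And>v. v \<in> carrier_vec n \<Longrightarrow> Q *\<^sub>v (Q *\<^sub>v v) = v"
    and S: "\<And>v. v \<in> carrier_vec n \<Longrightarrow> S *\<^sub>v (S *\<^sub>v v) = v"
    and vec [simp]: "\<alpha> \<in> carrier_vec n" "\<alpha>' \<in> carrier_vec n" "\<beta> \<in> carrier_vec n" "\<beta>' \<in> carrier_vec n"
  shows "(- (Q *\<^sub>v \<alpha>)) @\<^sub>v (Q *\<^sub>v \<alpha>') =
      four_block_mat (Q * R * T1 * S) (- (Q * R * S)) (- (Q * T1 * R * T1 * S)) (Q * T1 * R * S) *\<^sub>v
        ((S *\<^sub>v \<beta>) @\<^sub>v (S *\<^sub>v \<beta>')) \<longleftrightarrow>
    \<alpha>' @\<^sub>v \<beta>' = four_block_mat T1 (0\<^sub>m n n) T2 T1 *\<^sub>v (\<alpha> @\<^sub>v \<beta>)" (is "?L \<longleftrightarrow> ?R")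
proof -
  have mv [simp]: "A *\<^sub>v v \<in> carrier_vec n" if "A \<in> carrier_mat n n" "v \<in> carrier_vec n" for A and v :: "complex Matrix.vec"
    using that by simp
  have mm [simp]: "A * B \<in> carrier_mat n n" if "A \<in> carrier_mat n n" "B \<in> carrier_mat n n" for A B :: "complex Matrix.mat"
    using that by simp
  have um: "(- A) *\<^sub>v v = - (A *\<^sub>v v)" if "A \<in> carrier_mat n n" "v \<in> carrier_vec n" for A and v :: "complex Matrix.vec"
    using that by (intro uminus_mult_mat_vec) simp
  define d where "d = \<beta>' - T1 *\<^sub>v \<beta>"
  have d [simp]: "d \<in> carrier_vec n" by (simp add: d_def)
  have Q_inj: "Q *\<^sub>v v = Q *\<^sub>v w \<longleftrightarrow> v = w" if "v \<in> carrier_vec n" "w \<in> carrier_vec n" for v w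
    using Q[OF that(1)] Q[OF that(2)] by metis
  have sub: "A *\<^sub>v d = A *\<^sub>v \<beta>' - A *\<^sub>v (T1 *\<^sub>v \<beta>)" if "A \<in> carrier_mat n n" for A
    unfolding d_def by (rule mult_minus_distrib_mat_vec[OF that]) simp_all
  have top: "(Q * R * T1 * S) *\<^sub>v (S *\<^sub>v \<beta>) + (- (Q * R * S)) *\<^sub>v (S *\<^sub>v \<beta>') = - (Q *\<^sub>v (R *\<^sub>v d))"
  proof -
    have 1: "(Q * R * T1 * S) *\<^sub>v (S *\<^sub>v \<beta>) = (Q * R) *\<^sub>v (T1 *\<^sub>v \<beta>)"
      by (simp add: assoc_mult_mat_vec[of _ n n _ n] S)
    have 2: "(- (Q * R * S)) *\<^sub>v (S *\<^sub>v \<beta>') = - ((Q * R) *\<^sub>v \<beta>')"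
      by (simp add: um assoc_mult_mat_vec[of _ n n _ n] S)
    have "Q *\<^sub>v (R *\<^sub>v d) = (Q * R) *\<^sub>v d" by (simp add: assoc_mult_mat_vec[of _ n n _ n])
    also have "\<dots> = (Q * R) *\<^sub>v \<beta>' - (Q * R) *\<^sub>v (T1 *\<^sub>v \<beta>)" by (rule sub) simp
    finally show ?thesis unfolding 1 2
      by (intro eq_vecI) (auto simp: carrier_matD[OF carrier(3)] carrier_matD[OF carrier(4)])
  qed
  have bot: "(- (Q * T1 * R * T1 * S)) *\<^sub>v (S *\<^sub>v \<beta>) + (Q * T1 * R * S) *\<^sub>v (S *\<^sub>v \<beta>') = Q *\<^sub>v (T1 *\<^sub>v (R *\<^sub>v d))"
  proof -
    have 1: "(- (Q * T1 * R * T1 * S)) *\<^sub>v (S *\<^sub>v \<beta>) = - ((Q * T1 * R) *\<^sub>v (T1 *\<^sub>v \<beta>))"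
      by (simp add: um assoc_mult_mat_vec[of _ n n _ n] S)
    have 2: "(Q * T1 * R * S) *\<^sub>v (S *\<^sub>v \<beta>') = (Q * T1 * R) *\<^sub>v \<beta>'"
      by (simp add: assoc_mult_mat_vec[of _ n n _ n] S)
    have "Q *\<^sub>v (T1 *\<^sub>v (R *\<^sub>v d)) = (Q * T1 * R) *\<^sub>v d" by (simp add: assoc_mult_mat_vec[of _ n n _ n])
    also have "\<dots> = (Q * T1 * R) *\<^sub>v \<beta>' - (Q * T1 * R) *\<^sub>v (T1 *\<^sub>v \<beta>)" by (rule sub) simp
    finally show ?thesis unfolding 1 2
      by (intro eq_vecI) (auto simp: carrier_matD[OF carrier(3)] carrier_matD[OF carrier(4)])
  qed
  have "?L \<longleftrightarrow> (- (Q *\<^sub>v \<alpha>)) @\<^sub>v (Q *\<^sub>v \<alpha>') = (- (Q *\<^sub>v (R *\<^sub>v d))) @\<^sub>v (Q *\<^sub>v (T1 *\<^sub>v (R *\<^sub>v d)))"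
    by (subst four_block_mat_mult_vec[of _ n n _ n _ n]) (simp_all add: top bot)
  also have "\<dots> \<longleftrightarrow> - (Q *\<^sub>v \<alpha>) = - (Q *\<^sub>v (R *\<^sub>v d)) \<and> Q *\<^sub>v \<alpha>' = Q *\<^sub>v (T1 *\<^sub>v (R *\<^sub>v d))"
    by (rule append_vec_eq[of _ n]) simp_all
  also have "- (Q *\<^sub>v \<alpha>) = - (Q *\<^sub>v (R *\<^sub>v d)) \<longleftrightarrow> Q *\<^sub>v \<alpha> = Q *\<^sub>v (R *\<^sub>v d)"
    by (metis uminus_uminus_vec)
  also have "(Q *\<^sub>v \<alpha> = Q *\<^sub>v (R *\<^sub>v d) \<and> Q *\<^sub>v \<alpha>' = Q *\<^sub>v (T1 *\<^sub>v (R *\<^sub>v d))) \<longleftrightarrow>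
      \<alpha> = R *\<^sub>v d \<and> \<alpha>' = T1 *\<^sub>v \<alpha>"
    by (simp add: Q_inj) blast
  also have "\<alpha> = R *\<^sub>v d \<longleftrightarrow> d = T2 *\<^sub>v \<alpha>"
  proof
    assume "\<alpha> = R *\<^sub>v d"
    then have "T2 *\<^sub>v \<alpha> = (T2 * R) *\<^sub>v d" by (simp add: assoc_mult_mat_vec[of _ n n _ n])
    then show "d = T2 *\<^sub>v \<alpha>" by (simp add: inv)
  next
    assume "d = T2 *\<^sub>v \<alpha>"
    then have "R *\<^sub>v d = (R * T2) *\<^sub>v \<alpha>" by (simp add: assoc_mult_mat_vec[of _ n n _ n])
    then show "\<alpha> = R *\<^sub>v d" by (simp add: inv)
  qed
  also have "d = T2 *\<^sub>v \<alpha> \<longleftrightarrow> \<beta>' = T2 *\<^sub>v \<alpha> + T1 *\<^sub>v \<beta>"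
  proof
    assume *: "d = T2 *\<^sub>v \<alpha>"
    have "\<beta>' = d + T1 *\<^sub>v \<beta>"
      unfolding d_def by (intro eq_vecI) (auto simp: carrier_vecD[OF vec(4)] carrier_matD[OF carrier(1)])
    then show "\<beta>' = T2 *\<^sub>v \<alpha> + T1 *\<^sub>v \<beta>" unfolding * .
  next
    assume *: "\<beta>' = T2 *\<^sub>v \<alpha> + T1 *\<^sub>v \<beta>"
    show "d = T2 *\<^sub>v \<alpha>"
      unfolding d_def * by (intro eq_vecI) (auto simp: carrier_matD[OF carrier(1)] carrier_matD[OF carrier(2)])
  qed
  also have "(\<beta>' = T2 *\<^sub>v \<alpha> + T1 *\<^sub>v \<beta> \<and> \<alpha>' = T1 *\<^sub>v \<alpha>) \<longleftrightarrow> ?R"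
  proof -
    have "four_block_mat T1 (0\<^sub>m n n) T2 T1 *\<^sub>v (\<alpha> @\<^sub>v \<beta>) =
        (T1 *\<^sub>v \<alpha> + 0\<^sub>m n n *\<^sub>v \<beta>) @\<^sub>v (T2 *\<^sub>v \<alpha> + T1 *\<^sub>v \<beta>)"
      by (rule four_block_mat_mult_vec[of _ n n _ n _ n]) simp_all
    also have "T1 *\<^sub>v \<alpha> + 0\<^sub>m n n *\<^sub>v \<beta> = T1 *\<^sub>v \<alpha>"
      by (intro eq_vecI) (auto simp: carrier_matD[OF carrier(1)] carrier_vecD[OF vec(3)])
    finally have "?R \<longleftrightarrow> \<alpha>' @\<^sub>v \<beta>' = (T1 *\<^sub>v \<alpha>) @\<^sub>v (T2 *\<^sub>v \<alpha> + T1 *\<^sub>v \<beta>)" by simp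
    also have "\<dots> \<longleftrightarrow> \<alpha>' = T1 *\<^sub>v \<alpha> \<and> \<beta>' = T2 *\<^sub>v \<alpha> + T1 *\<^sub>v \<beta>"
      by (rule append_vec_eq[of _ n]) simp_all
    finally show ?thesis by blast
  qed
  finally show ?thesis .
qed

context bounded_interval
begin

lemma Toeplitz_iff_Taylor:
  "Matrix.vec m (\<lambda>i. F (m - 1 - i) b) = T_toeplitz m a b *\<^sub>v Matrix.vec m (\<lambda>i. F (m - 1 - i) a) \<longleftrightarrow>
   (\<forall>k<m. F k b = pchain (taylor a (\<lambda>k. F k a) m) k b)" (is "?v = ?w \<longleftrightarrow> ?R")
proof -
  have w: "vec_index ?w i = pchain (taylor a (\<lambda>k. F k a) m) (m - 1 - i) b" if i: "i < m" for i
  proof -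
    have "vec_index ?w i = (\<Sum>j<m. (if j \<le> i then of_real ((b - a) ^ (i - j) / fact (i - j)) else 0) * F (m - 1 - j) a)"
      using i by (simp add: T_toeplitz_def scalar_prod_def lessThan_atLeast0)
    also have "\<dots> = (\<Sum>j<Suc i. of_real ((b - a) ^ (i - j) / fact (i - j)) * F (m - 1 - j) a)"
      using i by (intro sum.mono_neutral_cong_right) auto
    also have "\<dots> = (\<Sum>j<Suc i. of_real ((b - a) ^ (i - (Suc i - Suc j)) / fact (i - (Suc i - Suc j))) * F (m - 1 - (Suc i - Suc j)) a)"
      by (rule sum.nat_diff_reindex[symmetric])
    also have "\<dots> = (\<Sum>j<Suc i. F (m - 1 - i + j) a / fact j * of_real (b - a) ^ j)"
    proof (rule sum.cong[OF refl])
      fix j assume "j \<in> {..<Suc i}"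
      then have "i - (Suc i - Suc j) = j" "m - 1 - (Suc i - Suc j) = m - 1 - i + j" using i by auto
      then show "of_real ((b - a) ^ (i - (Suc i - Suc j)) / fact (i - (Suc i - Suc j))) * F (m - 1 - (Suc i - Suc j)) a
          = F (m - 1 - i + j) a / fact j * of_real (b - a) ^ j"
        by simp
    qed
    also have "\<dots> = pchain (taylor a (\<lambda>k. F k a) m) (m - 1 - i) b"
      using i unfolding pchain_taylor by (intro sum.cong) auto
    finally show ?thesis .
  qed
  have "?v = ?w \<longleftrightarrow> (\<forall>i<m. F (m - 1 - i) b = pchain (taylor a (\<lambda>k. F k a) m) (m - 1 - i) b)"
    unfolding vec_eq_iff using w by (auto simp: T_toeplitz_def)
  also have "\<dots> \<longleftrightarrow> ?R"
  proof
    assume l: "\<forall>i<m. F (m - 1 - i) b = pchain (taylor a (\<lambda>k. F k a) m) (m - 1 - i) b"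
    show ?R
    proof (intro allI impI)
      fix k assume "k < m"
      then have "m - 1 - k < m" "m - 1 - (m - 1 - k) = k" by auto
      then show "F k b = pchain (taylor a (\<lambda>k. F k a) m) k b" using l by metis
    qed
  qed auto
  finally show ?thesis .
qed

text \<open>
  A vector in the kernel of \<open>T\<^sub>2\<close> is the list of the highest derivatives at \<open>a\<close> of a
  polynomial \<open>p\<close> of degree less than \<open>2 n\<close> that vanishes to order \<open>n\<close> at both ends. By
  parts, the integral of \<open>|p\<^sup>(\<^sup>n\<^sup>)|\<^sup>2\<close> is zero, so \<open>p\<close> is zero.
\<close>

lemma det_T2: "det (T\<^sub>2 n a b) \<noteq> 0"
proof
  have T2: "T\<^sub>2 n a b \<in> carrier_mat n n" by (simp add: T\<^sub>2_def)
  assume "det (T\<^sub>2 n a b) = 0"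
  then obtain v where v: "v \<in> carrier_vec n" "v \<noteq> 0\<^sub>v n" and Tv: "T\<^sub>2 n a b *\<^sub>v v = 0\<^sub>v n"
    unfolding det_0_iff_vec_prod_zero_field[OF T2] by blast
  define \<alpha> where "\<alpha> k = (if k < n then 0 else vec_index v (2 * n - 1 - k))" for k
  define p where "p = taylor a \<alpha> (2 * n)"
  have pa: "pchain p k a = 0" if "k < n" for k
    using that by (simp add: p_def pchain_taylor_at \<alpha>_def)
  have pb: "pchain p k b = 0" if k: "k < n" for k
  proof -
    define i where "i = n - 1 - k"
    have i: "i < n" "k = n - 1 - i" using k by (auto simp: i_def)
    have w: "vec_index (Matrix.vec (2 * n) (\<lambda>i. \<alpha> (2 * n - 1 - i))) j = (if j < n then vec_index v j else 0)"
      if "j < 2 * n" for j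
    proof (cases "j < n")
      case True
      then have "\<not> 2 * n - 1 - j < n" "2 * n - 1 - (2 * n - 1 - j) = j" by auto
      then show ?thesis using True that by (simp add: \<alpha>_def)
    next
      case False
      then have "2 * n - 1 - j < n" using that by auto
      then show ?thesis using False that by (simp add: \<alpha>_def)
    qed
    have "pchain p k b = (\<Sum>l<2 * n - k. \<alpha> (k + l) / fact l * of_real (b - a) ^ l)"
      unfolding p_def by (rule pchain_taylor)
    also have "\<dots> = (\<Sum>l<2 * n - k. \<alpha> (k + (2 * n - k - Suc l)) / fact (2 * n - k - Suc l) * of_real (b - a) ^ (2 * n - k - Suc l))"
      by (rule sum.nat_diff_reindex[symmetric])
    also have "\<dots> = (\<Sum>j<n. of_real ((b - a) ^ (n + i - j) / fact (n + i - j)) * vec_index v j)"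
    proof (rule sum.mono_neutral_cong_right)
      show "\<forall>l\<in>{..<2 * n - k} - {..<n}.
          \<alpha> (k + (2 * n - k - Suc l)) / fact (2 * n - k - Suc l) * of_real (b - a) ^ (2 * n - k - Suc l) = 0"
        by (auto simp: \<alpha>_def)
      fix j assume "j \<in> {..<n}"
      then have e: "2 * n - k - Suc j = n + i - j" "(k + (n + i - j) < n) = False" "2 * n - 1 - (k + (n + i - j)) = j"
        using i by auto
      have "\<alpha> (k + (n + i - j)) = vec_index v j" unfolding \<alpha>_def e(2,3) if_False ..
      then show "\<alpha> (k + (2 * n - k - Suc j)) / fact (2 * n - k - Suc j) * of_real (b - a) ^ (2 * n - k - Suc j) =
          of_real ((b - a) ^ (n + i - j) / fact (n + i - j)) * vec_index v j"
        unfolding e(1) by simp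
    qed (use k in auto)
    also have "\<dots> = vec_index (T\<^sub>2 n a b *\<^sub>v v) i"
      using i v(1) by (simp add: T\<^sub>2_def scalar_prod_def lessThan_atLeast0)
    also have "\<dots> = 0" using i by (simp add: Tv)
    finally show ?thesis .
  qed
  have "l2_inner M (pchain p (n + n)) (pchain p 0) =
      (\<Sum>i<n. (-1) ^ i * (pchain p (n + n - 1 - i) b * cnj (pchain p (0 + i) b) - pchain p (n + n - 1 - i) a * cnj (pchain p (0 + i) a)))
      + (-1) ^ n * l2_inner M (pchain p n) (pchain p (0 + n))"
    by (rule chain_inner_by_parts[OF chain_pchain[of "2 * n"] chain_pchain[of "2 * n"]]) simp_all
  moreover have "pchain p (n + n) = (\<lambda>t. 0)"
    using funpow_pderiv_taylor_eq_0[of "2 * n" a \<alpha>] by (simp add: pchain_def[abs_def] p_def mult_2)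
  ultimately have "l2_inner M (pchain p n) (pchain p n) = 0"
    using pa pb by simp
  then have "AE t in M. pchain p n t = 0" by (intro AE_zero_of_l2_inner_self pchain_l2) simp
  then have zero: "pchain p n t = 0" if "t \<in> {a..b}" for t
    using continuous_AE_eq[OF pchain_continuous continuous_on_const, of p n 0 t] that by simp
  have "(pderiv ^^ n) p = 0"
  proof (rule ccontr)
    assume "(pderiv ^^ n) p \<noteq> 0"
    then have "finite {z. poly ((pderiv ^^ n) p) z = 0}" by (rule poly_roots_finite)
    moreover have "of_real ` {a..b} \<subseteq> {z. poly ((pderiv ^^ n) p) z = 0}"
      using zero by (auto simp: pchain_def)
    ultimately have "finite (complex_of_real ` {a..b})" by (rule finite_subset[rotated])
    then have "finite {a..b}" by (rule finite_imageD) (simp add: inj_on_def)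
    then show False using infinite_Icc[OF ab] by contradiction
  qed
  then have p0: "pchain p (k + n) a = 0" for k
    using fun_cong[OF pchain_funpow[of n p k], of a] by simp
  have "v = 0\<^sub>v n"
  proof (rule eq_vecI)
    fix j assume "j < dim_vec (0\<^sub>v n :: complex Matrix.vec)"
    then have j: "j < n" by simp
    then have "2 * n - 1 - j = (n - 1 - j) + n" "2 * n - 1 - j < 2 * n" "\<not> 2 * n - 1 - j < n"
      "2 * n - 1 - (2 * n - 1 - j) = j" by auto
    then have "vec_index v j = pchain p (n - 1 - j + n) a"
      using pchain_taylor_at[of "2 * n - 1 - j" "2 * n" a \<alpha>] by (simp add: p_def \<alpha>_def)
    then show "vec_index v j = vec_index (0\<^sub>v n) j" unfolding p0 using j by simp
  qed (use v(1) in simp)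
  then show False using v(2) by simp
qed

lemma T2_inverse:
  obtains R where "mat_inverse (T\<^sub>2 n a b) = Some R" "R \<in> carrier_mat n n"
    "T\<^sub>2 n a b * R = 1\<^sub>m n" "R * T\<^sub>2 n a b = 1\<^sub>m n"
proof -
  have T2: "T\<^sub>2 n a b \<in> carrier_mat n n" by (simp add: T\<^sub>2_def)
  have "T\<^sub>2 n a b \<in> Units (ring_mat TYPE(complex) n ())"
    by (rule det_non_zero_imp_unit[OF T2 det_T2])
  then obtain R where "mat_inverse (T\<^sub>2 n a b) = Some R"
    using mat_inverse(1)[OF T2, of "()"] by (cases "mat_inverse (T\<^sub>2 n a b)") auto
  then show ?thesis using that mat_inverse(2)[OF T2] by blast
qed

lemma boundary_conditions_iff:
  assumes F: "chain (2 * n) F" and f: "f \<in> l2 M" "AE t in M. f t = F 0 t"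
  shows "deriv_vec a b (2 * n) f b = T_toeplitz (2 * n) a b *\<^sub>v deriv_vec a b (2 * n) f a \<longleftrightarrow> f \<in> Domain (A_Krein n)"
    and "\<Gamma>\<^sub>1 n a b f = B_K n a b *\<^sub>v \<Gamma>\<^sub>0 n a b f \<longleftrightarrow> f \<in> Domain (A_Krein n)"
proof -
  note \<Gamma> = \<Gamma>_chain[OF F f]
  show i: "deriv_vec a b (2 * n) f b = T_toeplitz (2 * n) a b *\<^sub>v deriv_vec a b (2 * n) f a \<longleftrightarrow> f \<in> Domain (A_Krein n)"
    unfolding \<Gamma>(3,4) K_iff_Taylor[OF F f] by (rule Toeplitz_iff_Taylor)
  define \<alpha> \<beta> where "\<alpha> c = Matrix.vec n (\<lambda>i. F (2 * n - 1 - i) c)"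
    and "\<beta> c = Matrix.vec n (\<lambda>i. F (n - 1 - i) c)" for c
  have dv: "Matrix.vec (2 * n) (\<lambda>i. F (2 * n - 1 - i) c) = \<alpha> c @\<^sub>v \<beta> c" for c
  proof (rule eq_vecI)
    fix i assume "i < dim_vec (\<alpha> c @\<^sub>v \<beta> c)"
    then have "i < 2 * n" by (simp add: \<alpha>_def \<beta>_def)
    moreover have "n - 1 - (i - n) = 2 * n - 1 - i" if "\<not> i < n" using that by auto
    ultimately show "vec_index (Matrix.vec (2 * n) (\<lambda>i. F (2 * n - 1 - i) c)) i = vec_index (\<alpha> c @\<^sub>v \<beta> c) i"
      by (auto simp: \<alpha>_def \<beta>_def)
  qed (simp add: \<alpha>_def \<beta>_def)
  have S\<beta>: "Matrix.vec n (\<lambda>i. F i c) = S_mat n *\<^sub>v \<beta> c" for c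
    unfolding \<beta>_def S_mat_mult_vec by (rule eq_vecI) auto
  have Q\<alpha>: "Matrix.vec n (\<lambda>i. (-1) ^ (n - i) * F (2 * n - 1 - i) c) = Q_mat n *\<^sub>v \<alpha> c" for c
    unfolding \<alpha>_def Q_mat_mult_vec ..
  have Q\<alpha>': "Matrix.vec n (\<lambda>i. (-1) ^ (n - 1 - i) * F (2 * n - 1 - i) c) = - (Q_mat n *\<^sub>v \<alpha> c)" for c
  proof (rule eq_vecI)
    fix i assume "i < dim_vec (- (Q_mat n *\<^sub>v \<alpha> c))"
    then have i: "i < n" by (simp add: Q_mat_def)
    then have e: "n - i = Suc (n - 1 - i)" by simp
    have "vec_index (- (Q_mat n *\<^sub>v \<alpha> c)) i = - ((-1) ^ (n - i) * F (2 * n - 1 - i) c)"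
      unfolding \<alpha>_def Q_mat_mult_vec using i by simp
    then show "vec_index (Matrix.vec n (\<lambda>i. (-1) ^ (n - 1 - i) * F (2 * n - 1 - i) c)) i = vec_index (- (Q_mat n *\<^sub>v \<alpha> c)) i"
      using i unfolding e by simp
  qed (simp add: Q_mat_def)
  obtain R where R: "mat_inverse (T\<^sub>2 n a b) = Some R" "R \<in> carrier_mat n n"
    "T\<^sub>2 n a b * R = 1\<^sub>m n" "R * T\<^sub>2 n a b = 1\<^sub>m n" by (rule T2_inverse)
  have "\<Gamma>\<^sub>1 n a b f = B_K n a b *\<^sub>v \<Gamma>\<^sub>0 n a b f \<longleftrightarrow>
      \<alpha> b @\<^sub>v \<beta> b = four_block_mat (T_toeplitz n a b) (0\<^sub>m n n) (T\<^sub>2 n a b) (T_toeplitz n a b) *\<^sub>v (\<alpha> a @\<^sub>v \<beta> a)"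
    unfolding \<Gamma>(1,2) S\<beta> Q\<alpha> Q\<alpha>' B_K_def Let_def R(1) option.sel
    by (rule block_condition_iff[OF _ _ R(2) _ _ R(3,4) Q_mat_involution S_mat_involution])
       (simp_all add: T_toeplitz_def T\<^sub>2_def Q_mat_def S_mat_def \<alpha>_def \<beta>_def)
  also have "\<dots> \<longleftrightarrow> deriv_vec a b (2 * n) f b = T_toeplitz (2 * n) a b *\<^sub>v deriv_vec a b (2 * n) f a"
    unfolding \<Gamma>(3,4) dv Toeplitz_blocks ..
  finally show "\<Gamma>\<^sub>1 n a b f = B_K n a b *\<^sub>v \<Gamma>\<^sub>0 n a b f \<longleftrightarrow> f \<in> Domain (A_Krein n)"
    unfolding i .
qed

lemma Domain_K_boundary:
  "Domain (A_Krein n) = {f \<in> sobolev (2 * n) a b.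
     deriv_vec a b (2 * n) f b = T_toeplitz (2 * n) a b *\<^sub>v deriv_vec a b (2 * n) f a}"
  "Domain (A_Krein n) = {f \<in> sobolev (2 * n) a b. \<Gamma>\<^sub>1 n a b f = B_K n a b *\<^sub>v \<Gamma>\<^sub>0 n a b f}"
proof -
  have sub: "Domain (A_Krein n) \<subseteq> sobolev (2 * n) a b"
    unfolding Domain_Amax[symmetric] by (rule Domain_mono) (auto simp: A_Krein_def)
  have iff: "(deriv_vec a b (2 * n) f b = T_toeplitz (2 * n) a b *\<^sub>v deriv_vec a b (2 * n) f a) = (f \<in> Domain (A_Krein n))"
    "(\<Gamma>\<^sub>1 n a b f = B_K n a b *\<^sub>v \<Gamma>\<^sub>0 n a b f) = (f \<in> Domain (A_Krein n))" if "f \<in> sobolev (2 * n) a b" for f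
  proof -
    have "f \<in> Domain (Amax n)" using that by (simp add: Domain_Amax)
    then obtain F where F: "chain (2 * n) F" "AE t in M. f t = F 0 t" "f \<in> l2 M" by (rule AmaxE_Domain)
    show "(deriv_vec a b (2 * n) f b = T_toeplitz (2 * n) a b *\<^sub>v deriv_vec a b (2 * n) f a) = (f \<in> Domain (A_Krein n))"
      "(\<Gamma>\<^sub>1 n a b f = B_K n a b *\<^sub>v \<Gamma>\<^sub>0 n a b f) = (f \<in> Domain (A_Krein n))"
      by (rule boundary_conditions_iff[OF F(1,3,2)])+
  qed
  show "Domain (A_Krein n) = {f \<in> sobolev (2 * n) a b.
     deriv_vec a b (2 * n) f b = T_toeplitz (2 * n) a b *\<^sub>v deriv_vec a b (2 * n) f a}"
    using sub iff(1) by blast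
  show "Domain (A_Krein n) = {f \<in> sobolev (2 * n) a b. \<Gamma>\<^sub>1 n a b f = B_K n a b *\<^sub>v \<Gamma>\<^sub>0 n a b f}"
    using sub iff(2) by blast
qed

end

theorem theorem3p1:
  fixes n :: nat and a b :: real
  assumes "n \<ge> 1" and "a < b"
  shows "boundary_triplet (lebesgue_on {a<..<b}) (op_adjoint (lebesgue_on {a<..<b}) (A_min n a b))
           (2 * n) (\<Gamma>\<^sub>0 n a b) (\<Gamma>\<^sub>1 n a b) \<and>
         Domain (krein_extension (lebesgue_on {a<..<b}) (A_min n a b)) =
           {f \<in> sobolev (2 * n) a b.
              deriv_vec a b (2 * n) f b = T_toeplitz (2 * n) a b *\<^sub>v deriv_vec a b (2 * n) f a} \<and>
         Domain (krein_extension (lebesgue_on {a<..<b}) (A_min n a b)) =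
           {f \<in> sobolev (2 * n) a b. \<Gamma>\<^sub>1 n a b f = B_K n a b *\<^sub>v \<Gamma>\<^sub>0 n a b f}"
proof -
  interpret bounded_interval a b using assms(2) by unfold_locales
  show ?thesis
    unfolding op_adjoint_A_min krein_extension_eq_K[OF assms(1)]
    by (intro conjI boundary_triplet_\<Gamma> Domain_K_boundary)
qed

end
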